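(* Let $p(n)$ denote the number of partitions of $n$. For every integer $n\geq 95$, the cubic polynomial $$p(n-1)+3p(n)x+3p(n+1)x^2+p(n+2)x^3$$ has three distinct real zeros.
   Context: A partition of a positive integer $n$ is a nonincreasing sequence of positive integers summing to $n$; $p(n)$ is the number of such partitions. *)

theory Defs
  imports Complex_Main "HOL-Computational_Algebra.Polynomial"
begin

definition partitions :: "nat \<Rightarrow> nat list set" where
  "partitions n = {xs. sorted_wrt (\<ge>) xs \<and> (\<forall>x\<in>set xs. 0 < x) \<and> sum_list xs = n}"

definition num_partitions :: "nat \<Rightarrow> nat" where
  "num_partitions n = card (partitions n)"

(* Finiteness ensures that card is the true number of partitions. *)
lemma finite_partitions: "finite (partitions n)"
proof -
  have len: "length xs \<le> sum_list xs" if "\<forall>x\<in>set xs. 0 < x" for xs :: "nat list"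
    using that by (induction xs) auto
  have "partitions n \<subseteq> {xs. set xs \<subseteq> {..n} \<and> length xs \<le> n}"
    using len by (auto simp: partitions_def dest: member_le_sum_list)
  then show ?thesis
    by (rule finite_subset) (simp add: finite_lists_length_le)
qed

end

theory Submission
  imports Defs "HOL-Complex_Analysis.Complex_Analysis" "HOL-Probability.Probability" "HOL-Real_Asymp.Real_Asymp"
begin

text \<open>
  Write \<open>a\<^sub>i = p(n - 1 + i)\<close>. The cubic has three distinct real zeros as soon as
  \<open>4 (a\<^sub>1\<^sup>2 - a\<^sub>0 a\<^sub>2) (a\<^sub>2\<^sup>2 - a\<^sub>1 a\<^sub>3) > (a\<^sub>1 a\<^sub>2 - a\<^sub>0 a\<^sub>3)\<^sup>2\<close>.

  For \<open>n > 1200\<close> this comes from the circle method. The pentagonal number theorem turns Euler's product at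
  \<open>e\<^bsup>-t\<^esup>\<close> into a theta series, Poisson summation gives its transformation \<open>t \<mapsto> 4\<pi>\<^sup>2/t\<close>, and integrating
  the generating function over one vertical line yields
  \<open>p(n) = C e\<^bsup>c s\<^esup> (c s - 1) / s\<^sup>3 (1 + \<epsilon>)\<close> with \<open>s\<^sup>2 = n - 1/24\<close>, \<open>c\<^sup>2 = 2\<pi>\<^sup>2/3\<close> and an exponentially
  small \<open>\<epsilon>\<close>. With \<open>X\<close> and \<open>Y\<close> the negated second differences of \<open>ln p\<close> at \<open>n\<close> and \<open>n + 1\<close>, the inequality
  only needs that \<open>X\<close> and \<open>Y\<close> are of order \<open>s\<^sup>-\<^sup>3\<close> while \<open>X - Y\<close> is of order \<open>s\<^sup>-\<^sup>5\<close>.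

  For \<open>95 \<le> n \<le> 1200\<close> the inequality is checked on the leading bits of the values of \<open>p\<close>,
  which are computed by Euler's recurrence.
\<close>

section \<open>Euler's product and the pentagonal number theorem\<close>

text \<open>The margin is a single power of \<open>s\<close>. With \<open>a = 1 - exp (- X)\<close>
  and \<open>b = 1 - exp (- Y)\<close> the inequality becomes
  \<open>(a - b)^2 < a b (2 (a + b) - a b)\<close>, that is, order s^-10 against order s^-9. So
  \<open>ln p\<close> must be known up to O(s^-5), with an error of which only the size is known,
  and the leading asymptotics alone would be too coarse. The factor \<open>c s - 1\<close> has to
  come out exactly. It does because the saddle point integral is a Bessel function of half-integer
  order, which a substitution turns into a truncated Gaussian integral. The saddle point on the
  positive axis is r = pi / sqrt (6 (n - 1/24)). Only an exponential gain is required away from it,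
  and comparing Euler's product at \<open>q\<close> with the product at \<open>|q|\<close> supplies
  this on the whole remaining line; the comparison takes the place of a Farey dissection. The
  constants are tuned to r \<le> 1/27 and s \<ge> 34, which hold in the range treated
  analytically.\<close>

definition bounded_partitions :: "nat \<Rightarrow> nat \<Rightarrow> nat list set" where
  "bounded_partitions k n = {xs \<in> partitions n. \<forall>x\<in>set xs. x \<le> k}"

lemma finite_bounded_partitions: "finite (bounded_partitions k n)"
  unfolding bounded_partitions_def using finite_partitions by auto

lemma bounded_partitions_0: "bounded_partitions 0 n = (if n = 0 then {[]} else {})"
proof -
  have "xs = []" if "\<forall>x\<in>set xs. 0 < x" "\<forall>x\<in>set xs. x \<le> (0::nat)" for xs
    using that by (cases xs) auto
  then show ?thesis unfolding bounded_partitions_def partitions_def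
    by (auto simp del: le_zero_eq) fastforce+
qed

text \<open>Lists are nonincreasing, so a list containing the part \<open>Suc k\<close> begins with
  it, and removing this head leaves an arbitrary list of the same kind with smaller sum. On
  generating functions this is division by \<open>1 - X^(k+1)\<close>.\<close>

lemma bounded_partitions_Suc:
  "bounded_partitions (Suc k) n = bounded_partitions k n \<union>
     (if Suc k \<le> n then (#) (Suc k) ` bounded_partitions (Suc k) (n - Suc k) else {})"
  (is "?L = ?R")
proof
  show "?L \<subseteq> ?R"
  proof
    fix xs assume xs: "xs \<in> ?L"
    show "xs \<in> ?R"
    proof (cases "\<forall>x\<in>set xs. x \<le> k")
      case True
      then show ?thesis using xs by (auto simp: bounded_partitions_def)
    next
      case False
      then obtain x where x: "x \<in> set xs" "x = Suc k"
        using xs by (force simp: bounded_partitions_def le_Suc_eq)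
      then obtain y ys where xs_eq: "xs = y # ys" by (cases xs) auto
      have y: "y = Suc k"
        using xs x by (auto simp: bounded_partitions_def partitions_def xs_eq)
      have "ys \<in> bounded_partitions (Suc k) (n - Suc k)" "Suc k \<le> n"
        using xs by (auto simp: bounded_partitions_def partitions_def xs_eq y)
      then show ?thesis by (auto simp: xs_eq y)
    qed
  qed
  show "?R \<subseteq> ?L"
    by (auto simp: bounded_partitions_def partitions_def split: if_splits)
qed

lemma bounded_partitions_eq: "n \<le> k \<Longrightarrow> bounded_partitions k n = partitions n"
  unfolding bounded_partitions_def partitions_def using member_le_sum_list by fastforce

lemma card_bounded_partitions_Suc:
  "card (bounded_partitions (Suc k) n) = card (bounded_partitions k n) +
     (if Suc k \<le> n then card (bounded_partitions (Suc k) (n - Suc k)) else 0)"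
proof -
  have "bounded_partitions k n \<inter> (#) (Suc k) ` B = {}" for B
    by (auto simp: bounded_partitions_def)
  then show ?thesis
    by (subst bounded_partitions_Suc)
       (simp add: card_Un_disjoint finite_bounded_partitions card_image)
qed

text \<open>Polymorphic because it is used at \<open>fps_X\<close>, at complex points and at real
  points.\<close>

definition euler_prod :: "nat \<Rightarrow> 'a::comm_ring_1 \<Rightarrow> 'a" where
  "euler_prod k q = (\<Prod>i=1..k. 1 - q ^ i)"

lemma euler_prod_Suc: "euler_prod (Suc k) q = euler_prod k q * (1 - q ^ Suc k)"
  by (simp add: euler_prod_def)

definition bounded_partition_fps :: "nat \<Rightarrow> complex fps" where
  "bounded_partition_fps k = Abs_fps (\<lambda>n. of_nat (card (bounded_partitions k n)))"

lemma euler_prod_times_bounded_partition_fps: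
  "euler_prod k fps_X * bounded_partition_fps k = 1"
proof (induction k)
  case 0
  show ?case
    by (rule fps_ext) (simp add: euler_prod_def bounded_partition_fps_def bounded_partitions_0)
next
  case (Suc k)
  have "(1 - fps_X ^ Suc k) * bounded_partition_fps (Suc k) = bounded_partition_fps k"
    by (rule fps_ext)
       (auto simp: algebra_simps bounded_partition_fps_def fps_X_power_mult_nth
          card_bounded_partitions_Suc simp del: power_Suc)
  then show ?case using Suc.IH by (simp add: euler_prod_Suc mult.assoc del: power_Suc)
qed

section \<open>Shanks' finite form of the pentagonal number theorem\<close>

definition tri :: "nat \<Rightarrow> nat" where "tri s = (\<Sum>i\<le>s. i)"

lemma tri_0 [simp]: "tri 0 = 0" and tri_Suc [simp]: "tri (Suc s) = tri s + Suc s"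
  by (simp_all add: tri_def)

lemma two_tri: "2 * tri s = s * (s + 1)"
  by (induction s) auto

text \<open>Since \<open>tri j = j (j + 1) / 2\<close>, this and \<open>pent_plus\<close> are the
  generalised pentagonal numbers \<open>j (3 j - 1) / 2\<close> and \<open>j (3 j + 1) / 2\<close>,
  written without division.\<close>

definition pent_minus :: "nat \<Rightarrow> nat" where "pent_minus j = j * (j - 1) + tri j"

definition pent_plus :: "nat \<Rightarrow> nat" where "pent_plus j = j * j + tri j"

definition pent_sum :: "nat \<Rightarrow> 'a::comm_ring_1 \<Rightarrow> 'a" where
  "pent_sum n q = 1 + (\<Sum>j=1..n. (-1) ^ j * (q ^ pent_minus j + q ^ pent_plus j))"

text \<open>Summand of Shanks' identity. Index \<open>s = 0\<close> gives the finite Euler product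
  itself; for 1 \<le> s \<le> n the exponent \<open>s * n + tri s\<close> exceeds \<open>n\<close>,
  so the product and the pentagonal sum agree up to degree \<open>n\<close>.\<close>

definition shanks_term :: "'a::comm_ring_1 \<Rightarrow> nat \<Rightarrow> nat \<Rightarrow> 'a" where
  "shanks_term q n s = (-1) ^ s * (\<Prod>i\<in>{s<..n}. 1 - q ^ i) * q ^ (s * n + tri s)"

lemma shanks_identity:
  fixes q :: "'a::comm_ring_1"
  shows "(\<Sum>s\<le>n. shanks_term q n s) = pent_sum n q"
proof (induction n)
  case 0
  then show ?case by (simp add: shanks_term_def pent_sum_def)
next
  case (Suc n)
  define R where "R = (\<lambda>s. \<Prod>i\<in>{s<..n}. 1 - q ^ i)"
  have R_Suc: "R s = (1 - q ^ Suc s) * R (Suc s)" if "s < n" for s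
  proof -
    have "{s<..n} = insert (Suc s) {Suc s<..n}" using that by auto
    then show ?thesis by (simp add: R_def)
  qed
  have R_top: "(\<Prod>i\<in>{s<..Suc n}. 1 - q ^ i) = R s * (1 - q ^ Suc n)" if "s \<le> n" for s
  proof -
    have "{s<..Suc n} = insert (Suc n) {s<..n}" using that by auto
    then show ?thesis by (simp add: R_def mult.commute)
  qed
  have R_fold: "(\<Prod>i\<in>{s<..n}. 1 - q ^ i) = R s" for s
    by (simp add: R_def)
  \<comment> \<open>The change from \<open>n\<close> to \<open>Suc n\<close> telescopes in
    \<open>s\<close>. At \<open>m = n\<close> the closed form is the term with exponent
    \<open>pent_minus (Suc n)\<close>; the new index \<open>s = Suc n\<close> supplies the one with
    \<open>pent_plus (Suc n)\<close>.\<close>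
  have tele: "(\<Sum>s\<le>m. shanks_term q (Suc n) s - shanks_term q n s) =
      - ((-1) ^ m * R m * q ^ (Suc m * n + tri (Suc m)))" if "m \<le> n" for m
    using that
  proof (induction m)
    case 0
    show ?case by (simp add: shanks_term_def R_top) (simp add: R_def algebra_simps)
  next
    case (Suc m)
    have e1: "q ^ (Suc m * Suc n + tri (Suc m)) = q ^ (Suc m * n + tri (Suc m)) * q ^ Suc m"
      by (simp add: power_add [symmetric] algebra_simps)
    have e2: "q ^ (Suc (Suc m) * n + tri (Suc (Suc m))) = q ^ (Suc m * n + tri (Suc m)) * q ^ Suc m * q ^ Suc n"
      by (simp add: power_add [symmetric] algebra_simps)
    have "R m = (1 - q ^ Suc m) * R (Suc m)" using Suc.prems by (intro R_Suc) auto
    moreover have "shanks_term q (Suc n) (Suc m) - shanks_term q n (Suc m) =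
      (-1) ^ Suc m * R (Suc m) * q ^ (Suc m * n + tri (Suc m)) * (q ^ Suc m * (1 - q ^ Suc n) - 1)"
      unfolding shanks_term_def R_top[OF Suc.prems] e1
      by (simp add: R_fold algebra_simps del: tri_Suc power_Suc)
    ultimately have "(\<Sum>s\<le>Suc m. shanks_term q (Suc n) s - shanks_term q n s) =
      - ((-1) ^ m * ((1 - q ^ Suc m) * R (Suc m)) * q ^ (Suc m * n + tri (Suc m))) +
      (-1) ^ Suc m * R (Suc m) * q ^ (Suc m * n + tri (Suc m)) * (q ^ Suc m * (1 - q ^ Suc n) - 1)"
      using Suc by simp
    then show ?case unfolding e2 by (simp add: algebra_simps del: tri_Suc)
  qed
  have e3: "pent_minus (Suc n) = Suc n * n + tri (Suc n)" by (simp add: pent_minus_def)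
  have "(\<Sum>s\<le>Suc n. shanks_term q (Suc n) s) =
     (\<Sum>s\<le>n. shanks_term q n s) + (\<Sum>s\<le>n. shanks_term q (Suc n) s - shanks_term q n s) + shanks_term q (Suc n) (Suc n)"
    by (simp add: sum_subtractf)
  also have "\<dots> = pent_sum (Suc n) q"
    unfolding Suc.IH tele[OF order_refl] pent_sum_def
    by (simp add: e3 shanks_term_def R_def pent_plus_def algebra_simps del: tri_Suc)
  finally show ?case .
qed

definition partition_fps :: "complex fps" where
  "partition_fps = Abs_fps (\<lambda>n. of_nat (num_partitions n))"

text \<open>The infinite product, given by its stabilised coefficients: coefficient \<open>n\<close>
  is the same in all partial sums from index \<open>n\<close> on.\<close>

definition euler_fps :: "complex fps" where
  "euler_fps = Abs_fps (\<lambda>n. fps_nth (pent_sum n fps_X) n)"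

lemma pent_minus_ge: "j \<le> pent_minus j" and pent_plus_ge: "j \<le> pent_plus j"
  by (cases j; simp add: pent_minus_def pent_plus_def)+

lemma pent_sum_Suc:
  "pent_sum (Suc k) q = pent_sum k q + (-1) ^ Suc k * (q ^ pent_minus (Suc k) + q ^ pent_plus (Suc k))"
  by (simp add: pent_sum_def)

lemma fps_nth_uminus_one_power_mult:
  "fps_nth ((-1) ^ j * f) n = (-1) ^ j * fps_nth (f :: 'a::comm_ring_1 fps) n"
  by (cases "even j") auto

lemma fps_nth_pent_sum_Suc:
  "fps_nth (pent_sum (Suc k) (fps_X :: complex fps)) n = fps_nth (pent_sum k fps_X) n +
     (-1) ^ Suc k * ((if n = pent_minus (Suc k) then 1 else 0) + (if n = pent_plus (Suc k) then 1 else 0))"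
  unfolding pent_sum_Suc fps_add_nth fps_nth_uminus_one_power_mult by (simp add: fps_X_power_nth)

lemma fps_nth_pent_sum:
  assumes "n \<le> k" shows "fps_nth (pent_sum k fps_X) n = fps_nth euler_fps n"
  using assms
proof (induction k rule: dec_induct)
  case base
  then show ?case by (simp add: euler_fps_def)
next
  case (step k)
  then show ?case
    using pent_minus_ge[of "Suc k"] pent_plus_ge[of "Suc k"] by (auto simp: fps_nth_pent_sum_Suc)
qed

lemma fps_nth_euler_prod:
  assumes "n \<le> k" shows "fps_nth (euler_prod k (fps_X :: complex fps)) n = fps_nth euler_fps n"
proof -
  have zero: "fps_nth (shanks_term (fps_X :: complex fps) k s) n = 0" if "s \<in> {1..k}" for s
  proof -
    have "k + 1 \<le> s * k + tri s"
      using that by (intro add_mono; cases s) auto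
    then show ?thesis using assms by (simp add: shanks_term_def fps_X_power_mult_right_nth)
  qed
  have "fps_nth euler_fps n = fps_nth (\<Sum>s\<le>k. shanks_term fps_X k s) n"
    by (simp add: shanks_identity fps_nth_pent_sum assms)
  also have "\<dots> = (\<Sum>s\<in>{0..k}. fps_nth (shanks_term fps_X k s) n)"
    by (simp add: fps_sum_nth atMost_atLeast0)
  also have "\<dots> = fps_nth (shanks_term fps_X k 0) n"
    using zero by (subst sum.atLeast_Suc_atMost) auto
  also have "shanks_term fps_X k 0 = (euler_prod k (fps_X :: complex fps))"
  proof -
    have "{0<..k} = {1..k}" by auto
    then show ?thesis by (simp add: shanks_term_def euler_prod_def)
  qed
  finally show ?thesis by simp
qed

text \<open>Coefficient \<open>n\<close> sees only parts of size at most \<open>n\<close>, so both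
  series may be replaced by the product truncated at \<open>n\<close> and its inverse.\<close>

theorem euler_fps_times_partition_fps: "euler_fps * partition_fps = 1"
proof (rule fps_ext)
  fix n
  have "fps_nth (euler_fps * partition_fps) n = fps_nth (euler_prod n fps_X * bounded_partition_fps n) n"
    unfolding fps_mult_nth
    by (intro sum.cong)
       (auto simp: fps_nth_euler_prod partition_fps_def bounded_partition_fps_def num_partitions_def
         bounded_partitions_eq)
  then show "fps_nth (euler_fps * partition_fps) n = fps_nth 1 n"
    by (simp add: euler_prod_times_bounded_partition_fps)
qed

section \<open>Analytic convergence in the unit disc\<close>

lemma norm_fps_nth_pent_sum_le: "norm (fps_nth (pent_sum k (fps_X :: complex fps)) n) \<le> 2 * n + 1"
proof -
  have le: "norm (fps_nth (pent_sum k (fps_X :: complex fps)) n) \<le> 2 * k + 1" for k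
  proof (induction k)
    case 0
    show ?case by (auto simp: pent_sum_def)
  next
    case (Suc k)
    have "norm (fps_nth (pent_sum (Suc k) (fps_X :: complex fps)) n) \<le>
        norm (fps_nth (pent_sum k (fps_X :: complex fps)) n) + 2"
      unfolding fps_nth_pent_sum_Suc
      by (rule order.trans[OF norm_triangle_ineq]) (auto simp: norm_mult norm_power)
    then show ?case using Suc.IH by simp
  qed
  show ?thesis
  proof (cases "n \<le> k")
    case True
    then show ?thesis using le[of n] by (simp add: fps_nth_pent_sum)
  next
    case False
    then show ?thesis using le[of k] by simp
  qed
qed

lemma summable_odd_times_power:
  fixes r :: real assumes "0 \<le> r" "r < 1"
  shows "summable (\<lambda>n. real (2 * n + 1) * r ^ n)"
proof -
  have "conv_radius (\<lambda>n. real (2 * n + 1)) = 1"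
  proof (rule conv_radius_ratio_limit_nonzero)
    have "(\<lambda>n. (2 * real n + 1) / (2 * real n + 3)) \<longlonglongrightarrow> 1" by real_asymp
    then show "(\<lambda>n. norm (real (2 * n + 1)) / norm (real (2 * Suc n + 1))) \<longlonglongrightarrow> 1"
      by (simp add: algebra_simps)
  qed auto
  then show ?thesis using assms by (intro summable_in_conv_radius) auto
qed

lemma pent_sum_sums:
  "(\<lambda>n. fps_nth (pent_sum k fps_X) n * q ^ n) sums pent_sum k (q :: complex)"
proof (induction k)
  case 0
  show ?case using sums_single[of 0 "\<lambda>n. q ^ n"]
    by (simp add: pent_sum_def if_distrib[of "\<lambda>x. x * _"] cong: if_cong)
next
  case (Suc k)
  have single: "(\<lambda>n. (if n = m then 1 else 0) * q ^ n) sums (q ^ m)" for m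
    using sums_single[of m "\<lambda>n. q ^ n"] by (simp add: if_distrib[of "\<lambda>x. x * _"] cong: if_cong)
  show ?case
    unfolding fps_nth_pent_sum_Suc pent_sum_Suc[of k q]
    using sums_add[OF Suc sums_mult[OF sums_add[OF single[of "pent_minus (Suc k)"] single[of "pent_plus (Suc k)"]], of "(-1) ^ Suc k"]]
    by (simp only: algebra_simps)
qed

lemma fps_conv_radius_euler_fps: "fps_conv_radius euler_fps \<ge> 1"
  unfolding fps_conv_radius_def
proof (rule conv_radius_geI_ex')
  fix r :: real assume r: "0 < r" "ereal r < 1"
  show "summable (\<lambda>n. fps_nth euler_fps n * of_real r ^ n)"
  proof (rule summable_comparison_test')
    show "summable (\<lambda>n. real (2 * n + 1) * r ^ n)"
      using r by (intro summable_odd_times_power) auto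
    show "norm (fps_nth euler_fps n * of_real r ^ n) \<le> real (2 * n + 1) * r ^ n" for n
      using r norm_fps_nth_pent_sum_le[of n n]
      by (auto simp: norm_mult norm_power fps_nth_pent_sum intro!: mult_right_mono)
  qed
qed

text \<open>Tannery's theorem for the coefficients: each is eventually constant in \<open>k\<close>
  and bounded by \<open>2 n + 1\<close> uniformly in \<open>k\<close>.\<close>

lemma pent_sum_tendsto:
  assumes "norm (q :: complex) < 1"
  shows "(\<lambda>k. pent_sum k q) \<longlonglongrightarrow> eval_fps euler_fps q"
proof -
  have "(\<lambda>k. \<Sum>n. fps_nth (pent_sum k fps_X) n * q ^ n) \<longlonglongrightarrow> (\<Sum>n. fps_nth euler_fps n * q ^ n)"
  proof (rule tannerys_theorem[THEN conjunct2, THEN conjunct2])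
    show "(\<lambda>k. fps_nth (pent_sum k fps_X) n * q ^ n) \<longlonglongrightarrow> fps_nth euler_fps n * q ^ n" for n
      by (rule tendsto_eventually, rule eventually_mono[OF eventually_ge_at_top[of n]])
         (simp add: fps_nth_pent_sum)
    show "\<forall>\<^sub>F (n, k) in sequentially \<times>\<^sub>F sequentially.
        norm (fps_nth (pent_sum k fps_X) n * q ^ n) \<le> real (2 * n + 1) * norm q ^ n"
      using norm_fps_nth_pent_sum_le
      by (intro always_eventually) (auto simp: norm_mult norm_power intro!: mult_right_mono)
    show "summable (\<lambda>n. real (2 * n + 1) * norm q ^ n)"
      using assms by (intro summable_odd_times_power) auto
  qed auto
  then show ?thesis
    using pent_sum_sums by (simp add: eval_fps_def sums_iff)
qed

text \<open>Shanks' identity is used here as an estimate: the difference of pentagonal sum and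
  product consists of \<open>n\<close> terms of size at most \<open>C r^n\<close>.\<close>

lemma euler_prod_tendsto:
  assumes q: "norm (q :: complex) < 1"
  shows "(\<lambda>k. euler_prod k q) \<longlonglongrightarrow> eval_fps euler_fps q"
proof -
  define r where "r = norm q"
  have r: "0 \<le> r" "r < 1" using q by (auto simp: r_def)
  \<comment> \<open>Bounds every product of factors \<open>1 + r^i\<close>, through
    \<open>1 + x \<le> exp x\<close> and the geometric series.\<close>
  define C where "C = exp (1 / (1 - r))"
  have term_le: "norm (shanks_term q n s) \<le> C * r ^ n" if "s \<in> {1..n}" for n s
  proof -
    have "norm (\<Prod>i\<in>{s<..n}. 1 - q ^ i) \<le> (\<Prod>i\<in>{s<..n}. exp (r ^ i))"
      unfolding prod_norm [symmetric]
    proof (intro prod_mono conjI norm_ge_zero)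
      fix i
      have "norm (1 - q ^ i) \<le> 1 + r ^ i"
        using norm_triangle_ineq4[of 1 "q ^ i"] by (simp add: norm_power r_def)
      also have "\<dots> \<le> exp (r ^ i)" by (rule exp_ge_add_one_self)
      finally show "norm (1 - q ^ i) \<le> exp (r ^ i)" .
    qed
    also have "\<dots> = exp (\<Sum>i\<in>{s<..n}. r ^ i)" by (simp add: exp_sum)
    also have "\<dots> \<le> C"
      unfolding C_def exp_le_cancel_iff
    proof -
      have "(\<Sum>i\<in>{s<..n}. r ^ i) \<le> (\<Sum>i. r ^ i)"
        using r by (intro sum_le_suminf summable_geometric) auto
      then show "(\<Sum>i\<in>{s<..n}. r ^ i) \<le> 1 / (1 - r)" using r by (simp add: suminf_geometric)
    qed
    finally have 1: "norm (\<Prod>i\<in>{s<..n}. 1 - q ^ i) \<le> C" .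
    have "n \<le> s * n + tri s" using that by (cases s) auto
    then have 2: "r ^ (s * n + tri s) \<le> r ^ n" using r by (intro power_decreasing) auto
    show ?thesis unfolding shanks_term_def norm_mult norm_power
      using 1 2 r by (simp add: r_def[symmetric] mult_mono C_def)
  qed
  have "norm (pent_sum n q - euler_prod n q) \<le> C * (real n * r ^ n)" for n
  proof -
    have set_eq: "{0<..n} = {1..n}" by auto
    have "pent_sum n q = (\<Sum>s\<in>{0..n}. shanks_term q n s)"
      by (simp add: shanks_identity [symmetric] atMost_atLeast0)
    also have "\<dots> = shanks_term q n 0 + (\<Sum>s\<in>{1..n}. shanks_term q n s)"
      by (subst sum.atLeast_Suc_atMost) auto
    finally have "pent_sum n q - euler_prod n q = (\<Sum>s\<in>{1..n}. shanks_term q n s)"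
      by (simp add: shanks_term_def euler_prod_def set_eq)
    also have "norm \<dots> \<le> (\<Sum>s\<in>{1..n}. C * r ^ n)" by (rule sum_norm_le) (rule term_le)
    finally show ?thesis by (simp add: mult_ac)
  qed
  moreover have "(\<lambda>n. C * (real n * r ^ n)) \<longlonglongrightarrow> 0"
    using powser_times_n_limit_0[of r] r by (intro tendsto_mult_right_zero) auto
  ultimately have "(\<lambda>n. pent_sum n q - euler_prod n q) \<longlonglongrightarrow> 0"
    by (rule Lim_null_comparison[OF always_eventually[OF allI]])
  from tendsto_diff[OF pent_sum_tendsto[OF q] this] show ?thesis by simp
qed

section \<open>Lower bounds for Euler's product\<close>

lemma ln_one_minus_sums:
  fixes x :: real assumes "\<bar>x\<bar> < 1" shows "(\<lambda>n. x ^ n / real n) sums (- ln (1 - x))"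
  using sums_minus[OF ln_series'[of "-x"]] assms by simp

lemma Ln_one_minus_sums:
  fixes w :: complex assumes "norm w < 1" shows "(\<lambda>n. w ^ n / of_nat n) sums (- ln (1 - w))"
proof -
  have "(\<lambda>n. - ((- ((-1) ^ Suc n / of_nat n * (-w) ^ n)))) sums (ln (1 + - w))"
    using Ln_series[of "-w"] assms by simp
  from sums_minus[OF this] show ?thesis
    by (simp add: power_mult_distrib [symmetric])
qed

text \<open>The series of \<open>- ln (1 - w) - w\<close> is dominated termwise by that of
  \<open>- ln (1 - |w|) - |w|\<close>. Keeping the linear terms apart preserves the factor
  \<open>exp (|w| - Re w)\<close>, which measures the deviation of \<open>w\<close> from the
  positive axis.\<close>

lemma norm_one_minus_ge:
  assumes "norm (w :: complex) < 1"
  shows "(1 - norm w) * exp (norm w - Re w) \<le> norm (1 - w)"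
proof -
  define \<rho> where "\<rho> = norm w"
  have \<rho>: "0 \<le> \<rho>" "\<rho> < 1" using assms by (auto simp: \<rho>_def)
  have ne: "1 - w \<noteq> 0" using assms by auto
  \<comment> \<open>The summand at \<open>n = 0\<close> is a division by zero and hence 0; the
    subtracted term removes \<open>n = 1\<close>.\<close>
  have s1: "(\<lambda>n. w ^ n / of_nat n - (if n = 1 then w else 0)) sums (- ln (1 - w) - w)"
    using sums_diff[OF Ln_one_minus_sums[OF assms] sums_single[of 1 "\<lambda>_. w"]] by simp
  have s2: "(\<lambda>n. \<rho> ^ n / real n - (if n = 1 then \<rho> else 0)) sums (- ln (1 - \<rho>) - \<rho>)"
    using sums_diff[OF ln_one_minus_sums[of \<rho>] sums_single[of 1 "\<lambda>_. \<rho>"]] \<rho> by simp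
  have "norm (- ln (1 - w) - w) \<le> - ln (1 - \<rho>) - \<rho>"
  proof (rule norm_sums_le[OF s1 s2])
    show "norm (w ^ n / of_nat n - (if n = 1 then w else 0)) \<le> \<rho> ^ n / real n - (if n = 1 then \<rho> else 0)" for n
      by (simp add: \<rho>_def norm_divide norm_power)
  qed
  moreover have "Re (- ln (1 - w) - w) \<le> norm (- ln (1 - w) - w)" by (rule complex_Re_le_cmod)
  moreover have "Re (ln (1 - w)) = ln (norm (1 - w))" using ne by simp
  ultimately have "ln (1 - \<rho>) + (\<rho> - Re w) \<le> ln (norm (1 - w))" by simp
  then have "exp (ln (1 - \<rho>) + (\<rho> - Re w)) \<le> exp (ln (norm (1 - w)))" by simp
  then show ?thesis using \<rho> ne by (simp add: exp_add \<rho>_def del: exp_le_cancel_iff)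
qed

text \<open>Expanding the logarithms and exchanging the sums bounds their negated total by the sum
  of \<open>1 / (m (exp (m y) - 1))\<close> over \<open>m\<close>; then
  \<open>exp x - 1 \<ge> x\<close> reduces it to the sum of \<open>1 / (m^2 y)\<close>, which is
  \<open>pi^2 / (6 y)\<close>.\<close>

lemma euler_prod_real_ge:
  fixes y :: real assumes y: "y > 0"
  shows "exp (- (pi\<^sup>2 / (6 * y))) \<le> euler_prod k (exp (- y))"
proof -
  define r where "r = exp (- y)"
  have r: "0 < r" "r < 1" using y by (auto simp: r_def)
  have "(\<lambda>n. \<Sum>i=1..k. (r ^ i) ^ n / real n) sums (\<Sum>i=1..k. - ln (1 - r ^ i))"
    using r by (intro sums_sum ln_one_minus_sums) (auto simp: power_less_one_iff)
  then have s1: "(\<lambda>n. \<Sum>i=1..k. (r ^ i) ^ Suc n / real (Suc n)) sums (\<Sum>i=1..k. - ln (1 - r ^ i))"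
    by (subst sums_Suc_iff) simp
  have s2: "(\<lambda>n. 1 / (real n + 1)\<^sup>2 * (1 / y)) sums (pi\<^sup>2 / 6 * (1 / y))"
    by (intro sums_mult2) (use inverse_squares_sums in \<open>simp add: add_ac\<close>)
  have "(\<Sum>i=1..k. - ln (1 - r ^ i)) \<le> pi\<^sup>2 / 6 * (1 / y)"
  proof (rule sums_le[OF _ s1 s2])
    fix n
    define m where "m = Suc n"
    have "0 < r ^ m" "r ^ m < 1" using r by (simp_all add: m_def power_Suc_less_one del: power_Suc)
    have rm: "r ^ m = exp (- (real m * y))" by (simp add: r_def exp_of_nat_mult [symmetric])
    have "real m * y \<le> exp (real m * y) - 1" "0 < real m * y"
      using exp_ge_add_one_self[of "real m * y"] y by (linarith, simp add: m_def)
    moreover have "0 < (exp (real m * y) - 1) * (real m * y)"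
      using calculation by (metis mult_pos_pos less_le_trans)
    ultimately have my: "1 / (exp (real m * y) - 1) \<le> 1 / (real m * y)"
      by (intro divide_left_mono) simp_all
    have "(\<Sum>i=1..k. (r ^ i) ^ m) = (\<Sum>i=1..k. (r ^ m) ^ i)" by (simp add: power_mult [symmetric] mult.commute)
    also have "\<dots> \<le> r ^ m / (1 - r ^ m)"
    proof -
      have "(\<Sum>i=1..k. (r ^ m) ^ i) = r ^ m * (\<Sum>i<k. (r ^ m) ^ i)"
        unfolding sum_distrib_left
        by (rule sum.reindex_bij_witness[of _ Suc "\<lambda>i. i - 1"]) (auto simp flip: power_Suc)
      also have "(\<Sum>i<k. (r ^ m) ^ i) \<le> (\<Sum>i. (r ^ m) ^ i)"
        using \<open>0 < r ^ m\<close> \<open>r ^ m < 1\<close> by (intro sum_le_suminf summable_geometric) auto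
      also have "(\<Sum>i. (r ^ m) ^ i) = 1 / (1 - r ^ m)"
        using \<open>0 < r ^ m\<close> \<open>r ^ m < 1\<close> by (intro suminf_geometric) auto
      finally show ?thesis using \<open>0 < r ^ m\<close> by simp
    qed
    also have "r ^ m / (1 - r ^ m) = 1 / (exp (real m * y) - 1)"
    proof -
      have "exp (real m * y) > 1" using \<open>0 < real m * y\<close> by simp
      then show ?thesis unfolding rm exp_minus by (simp add: field_simps)
    qed
    also note my
    finally have "(\<Sum>i=1..k. (r ^ i) ^ m) / real m \<le> 1 / (real m * y) / real m"
      by (rule divide_right_mono) simp
    then show "(\<Sum>i=1..k. (r ^ i) ^ Suc n / real (Suc n)) \<le> 1 / (real n + 1)\<^sup>2 * (1 / y)"
      by (simp add: m_def sum_divide_distrib power2_eq_square algebra_simps)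
  qed
  then have "exp (- (pi\<^sup>2 / (6 * y))) \<le> exp (\<Sum>i=1..k. ln (1 - r ^ i))"
    by (simp add: sum_negf)
  also have "\<dots> = euler_prod k r"
    unfolding euler_prod_def using r by (subst exp_sum) (auto intro!: prod.cong simp: power_less_one_iff)
  finally show ?thesis by (simp add: r_def)
qed

lemma euler_prod_of_real: "euler_prod k (of_real r :: complex) = of_real (euler_prod k r)"
  by (simp add: euler_prod_def)

lemma norm_euler_fps_real_ge:
  assumes "y > 0"
  shows "exp (- (pi\<^sup>2 / (6 * y))) \<le> norm (eval_fps euler_fps (of_real (exp (- y))))"
proof -
  have "(\<lambda>k. norm (euler_prod k (of_real (exp (- y)) :: complex))) \<longlonglongrightarrow> norm (eval_fps euler_fps (of_real (exp (- y))))"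
    using assms by (intro tendsto_norm euler_prod_tendsto) auto
  moreover have "exp (- (pi\<^sup>2 / (6 * y))) \<le> norm (euler_prod k (of_real (exp (- y)) :: complex))" for k
    using order.trans[OF euler_prod_real_ge[OF assms, of k] abs_ge_self]
    unfolding euler_prod_of_real norm_of_real .
  ultimately show ?thesis by (intro tendsto_lowerbound) auto
qed

text \<open>\<open>norm_one_minus_ge\<close> multiplied over all \<open>w = q^i\<close>; two
  geometric series add up to the exponent. This comparison of \<open>q\<close> with
  \<open>|q|\<close> later controls the minor arcs.\<close>

lemma norm_euler_fps_ge:
  assumes q: "norm q < 1"
  shows "norm (eval_fps euler_fps (of_real (norm q))) * exp (norm q / (1 - norm q) - Re (q / (1 - q)))
       \<le> norm (eval_fps euler_fps q)"
proof (rule LIMSEQ_le)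
  define r where "r = norm q"
  have r: "0 \<le> r" "r < 1" using q by (auto simp: r_def)
  have geo: "(\<lambda>k. \<Sum>i=1..k. x ^ i) \<longlonglongrightarrow> x / (1 - x)" if "norm x < 1" for x :: complex
  proof -
    have "(\<lambda>i. x * x ^ i) sums (x * (1 / (1 - x)))" by (intro sums_mult geometric_sums that)
    then have "(\<lambda>k. \<Sum>i<k. x * x ^ i) \<longlonglongrightarrow> x / (1 - x)" by (simp add: sums_def)
    moreover have "(\<Sum>i<k. x * x ^ i) = (\<Sum>i=1..k. x ^ i)" for k
      by (rule sum.reindex_bij_witness[of _ "\<lambda>i. i - 1" Suc]) (auto simp flip: power_Suc)
    ultimately show ?thesis by simp
  qed
  have "(\<lambda>k. exp (Re (\<Sum>i=1..k. of_real r ^ i) - Re (\<Sum>i=1..k. q ^ i))) \<longlonglongrightarrow>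
      exp (Re (of_real r / (1 - of_real r)) - Re (q / (1 - q)))"
    using r q by (intro tendsto_intros geo) auto
  moreover have "Re (of_real r / (1 - of_real r)) = r / (1 - r)"
    by (metis Re_complex_of_real of_real_1 of_real_diff of_real_divide)
  ultimately show "(\<lambda>k. norm (euler_prod k (of_real r :: complex)) * exp (\<Sum>i=1..k. r ^ i - Re (q ^ i)))
     \<longlonglongrightarrow> norm (eval_fps euler_fps (of_real (norm q))) * exp (norm q / (1 - norm q) - Re (q / (1 - q)))"
    using euler_prod_tendsto[of "of_real r"] r
    by (intro tendsto_mult tendsto_norm) (auto simp: r_def sum_subtractf simp flip: of_real_power)
  show "(\<lambda>k. norm (euler_prod k q)) \<longlonglongrightarrow> norm (eval_fps euler_fps q)"
    by (intro tendsto_norm euler_prod_tendsto q)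
  have "norm (euler_prod k (of_real r :: complex)) * exp (\<Sum>i=1..k. r ^ i - Re (q ^ i)) \<le> norm (euler_prod k q)" for k
  proof -
    have "norm (euler_prod k (of_real r :: complex)) = (\<Prod>i=1..k. 1 - r ^ i)"
    proof -
      have "0 \<le> euler_prod k r"
        unfolding euler_prod_def using r by (intro prod_nonneg) (auto simp: power_le_one)
      then show ?thesis by (simp add: euler_prod_of_real) (simp add: euler_prod_def)
    qed
    then have "norm (euler_prod k (of_real r :: complex)) * exp (\<Sum>i=1..k. r ^ i - Re (q ^ i))
        = (\<Prod>i=1..k. (1 - norm (q ^ i)) * exp (norm (q ^ i) - Re (q ^ i)))"
      by (simp add: exp_sum prod.distrib r_def norm_power)
    also have "\<dots> \<le> (\<Prod>i=1..k. norm (1 - q ^ i))"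
    proof (intro prod_mono conjI norm_one_minus_ge)
      fix i assume "i \<in> {1..k}"
      then show "norm (q ^ i) < 1" using q by (auto simp: norm_power power_less_one_iff)
      then show "0 \<le> (1 - norm (q ^ i)) * exp (norm (q ^ i) - Re (q ^ i))" by simp
    qed
    finally show ?thesis by (simp add: euler_prod_def prod_norm)
  qed
  then show "\<exists>N. \<forall>n\<ge>N. norm (euler_prod n (complex_of_real r)) * exp (\<Sum>i = 1..n. r ^ i - Re (q ^ i)) \<le> norm (euler_prod n q)"
    by blast
qed

lemma eval_euler_fps_nonzero:
  assumes "norm q < 1" shows "eval_fps euler_fps q \<noteq> 0"
proof (cases "q = 0")
  case True
  then show ?thesis by (simp add: eval_fps_at_0 euler_fps_def pent_sum_def)
next
  case False
  have "0 < exp (- (pi\<^sup>2 / (6 * (- ln (norm q)))))" by simp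
  also have "\<dots> \<le> norm (eval_fps euler_fps (of_real (norm q)))"
    using norm_euler_fps_real_ge[of "- ln (norm q)"] assms False by simp
  finally show ?thesis using norm_euler_fps_ge[OF assms]
    by (smt (verit, best) exp_gt_zero mult_pos_pos norm_zero)
qed

lemma inverse_euler_fps: "inverse euler_fps = partition_fps"
  using fps_inverse_unique[OF euler_fps_times_partition_fps] .

lemma fps_conv_radius_partition_fps: "fps_conv_radius partition_fps \<ge> 1"
  and eval_partition_fps: "norm q < 1 \<Longrightarrow> eval_fps partition_fps q = inverse (eval_fps euler_fps q)"
proof -
  have nz: "eval_fps euler_fps z \<noteq> 0" if "ereal (norm z) < 1" for z
    using that by (intro eval_euler_fps_nonzero) simp
  show "fps_conv_radius partition_fps \<ge> 1"
    using fps_conv_radius_inverse[of 1 euler_fps, OF nz] fps_conv_radius_euler_fps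
    by (simp add: inverse_euler_fps min_def split: if_splits)
  show "eval_fps partition_fps q = inverse (eval_fps euler_fps q)" if "norm q < 1"
    using eval_fps_inverse[of 1 euler_fps q, OF nz] fps_conv_radius_euler_fps that
    by (simp add: inverse_euler_fps less_le_trans)
qed

section \<open>Poisson summation for Gaussians\<close>

text \<open>Symmetry makes \<open>h\<close> a continuous function \<open>H\<close> of
  \<open>cos (2 pi x)\<close>, and vanishing cosine coefficients make \<open>h\<close> orthogonal to
  every polynomial in that cosine. Approximating \<open>H\<close> by polynomials shows that the
  integral of \<open>h^2\<close> is 0.\<close>

lemma cos_coeffs_zero_imp_zero:
  fixes h :: "real \<Rightarrow> real"
  assumes cont: "continuous_on {0..1} h"
    and sym: "\<And>x. x \<in> {0..1} \<Longrightarrow> h (1 - x) = h x"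
    and coeff: "\<And>j::nat. integral {0..1} (\<lambda>x. h x * cos (2 * pi * j * x)) = 0"
    and x: "x \<in> {0..1}"
  shows "h x = 0"
proof -
  \<comment> \<open>Multipliers \<open>u\<close> for which \<open>h u\<close> still has only zero
    cosine coefficients. Demanding all coefficients, not just the mean, makes the set closed under
    multiplication by \<open>cos (2 pi x)\<close>.\<close>
  define V where "V = {u. continuous_on {0..1} u \<and>
    (\<forall>j::nat. integral {0..1} (\<lambda>x. h x * u x * cos (2 * pi * j * x)) = (0::real))}"
  have cont_prod: "continuous_on {0..1} (\<lambda>x. h x * u x * cos (2 * pi * real j * x))"
    if "u \<in> V" for u j using that cont by (auto simp: V_def intro!: continuous_intros)
  have V_add: "(\<lambda>x. u x + v x) \<in> V" if "u \<in> V" "v \<in> V" for u v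
  proof -
    have "integral {0..1} (\<lambda>x. h x * (u x + v x) * cos (2 * pi * j * x)) = 0" for j :: nat
    proof -
      have "integral {0..1} (\<lambda>x. h x * (u x + v x) * cos (2 * pi * j * x)) =
        integral {0..1} (\<lambda>x. h x * u x * cos (2 * pi * j * x) + h x * v x * cos (2 * pi * j * x))"
        by (simp add: algebra_simps)
      also have "\<dots> = integral {0..1} (\<lambda>x. h x * u x * cos (2 * pi * j * x)) + integral {0..1} (\<lambda>x. h x * v x * cos (2 * pi * j * x))"
        using that by (intro integral_add integrable_continuous_real cont_prod)
      finally have "integral {0..1} (\<lambda>x. h x * (u x + v x) * cos (2 * pi * j * x)) = \<dots>" .
      then show ?thesis using that by (simp add: V_def)
    qed
    then show ?thesis using that by (auto simp: V_def intro!: continuous_intros)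
  qed
  have V_scale: "(\<lambda>x. u x * c) \<in> V" if "u \<in> V" for u c
  proof -
    have "integral {0..1} (\<lambda>x. h x * (u x * c) * cos (2 * pi * j * x)) =
        c * integral {0..1} (\<lambda>x. h x * u x * cos (2 * pi * j * x))" for j :: nat
      by (subst integral_mult_right [symmetric]) (simp add: mult_ac)
    then show ?thesis using that by (auto simp: V_def intro!: continuous_intros)
  qed
  have V_cos: "(\<lambda>x. u x * cos (2 * pi * x)) \<in> V" if "u \<in> V" for u
  proof -
    have "integral {0..1} (\<lambda>x. h x * (u x * cos (2 * pi * x)) * cos (2 * pi * j * x)) = 0" for j :: nat
    proof -
      \<comment> \<open>\<open>i\<close> is \<open>|j - 1|\<close>, the frequency of the difference
        angle; for \<open>j = 0\<close> truncated subtraction would give 0 in place of 1.\<close>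
      define i where "i = (if j = 0 then 1 else j - 1)"
      have cc: "cos (2 * pi * x) * cos (2 * pi * j * x) =
          (cos (2 * pi * real (j + 1) * x) + cos (2 * pi * real i * x)) / 2" for x
      proof (cases j)
        case 0
        then show ?thesis by (simp add: i_def)
      next
        case (Suc m)
        have "cos (2 * pi * x) * cos (2 * pi * j * x) = (cos (2 * pi * x - 2 * pi * j * x) + cos (2 * pi * x + 2 * pi * j * x)) / 2"
          by (rule cos_times_cos)
        also have "cos (2 * pi * x - 2 * pi * j * x) = cos (- (2 * pi * x - 2 * pi * j * x))" by (rule cos_minus [symmetric])
        also have "- (2 * pi * x - 2 * pi * j * x) = 2 * pi * real i * x" by (simp add: Suc i_def algebra_simps)
        also have "2 * pi * x + 2 * pi * j * x = 2 * pi * real (j + 1) * x" by (simp add: algebra_simps)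
        finally show ?thesis by simp
      qed
      have "integral {0..1} (\<lambda>x. h x * (u x * cos (2 * pi * x)) * cos (2 * pi * j * x)) =
        integral {0..1} (\<lambda>x. (h x * u x * cos (2 * pi * real (j + 1) * x) + h x * u x * cos (2 * pi * real i * x)) / 2)"
      proof (rule integral_cong)
        fix x
        have "h x * (u x * cos (2 * pi * x)) * cos (2 * pi * j * x) = h x * u x * (cos (2 * pi * x) * cos (2 * pi * j * x))"
          by (simp only: mult_ac)
        then show "h x * (u x * cos (2 * pi * x)) * cos (2 * pi * j * x) =
          (h x * u x * cos (2 * pi * real (j + 1) * x) + h x * u x * cos (2 * pi * real i * x)) / 2"
          by (simp only: cc distrib_left times_divide_eq_right)
      qed
      also have "\<dots> = (integral {0..1} (\<lambda>x. h x * u x * cos (2 * pi * real (j + 1) * x)) +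
          integral {0..1} (\<lambda>x. h x * u x * cos (2 * pi * real i * x))) / 2"
        unfolding integral_divide
        by (rule arg_cong[where f = "\<lambda>x. x / 2"], rule integral_add; intro integrable_continuous_real cont_prod that)
      also have "\<dots> = 0"
      proof -
        have "integral {0..1} (\<lambda>x. h x * u x * cos (2 * pi * real n * x)) = 0" for n
          using that by (auto simp: V_def)
        then show ?thesis by (simp only: add_0 div_0)
      qed
      finally show ?thesis .
    qed
    then show ?thesis using that by (auto simp: V_def intro!: continuous_intros)
  qed
  have V_poly: "(\<lambda>x. u x * g (cos (2 * pi * x))) \<in> V" if "real_polynomial_function g" "u \<in> V" for g u
    using that
  proof (induction g arbitrary: u rule: real_polynomial_function.induct)
    case (linear f)
    obtain c where "f = (\<lambda>x. x * c)" using linear(1) real_bounded_linear by auto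
    then show ?case using V_scale[OF V_cos[OF linear(2)], of c] by (simp add: mult_ac)
  next
    case (const c)
    then show ?case by (rule V_scale)
  next
    case (add f g)
    show ?case using V_add[OF add.IH(1)[OF add.prems] add.IH(2)[OF add.prems]] by (simp add: algebra_simps)
  next
    case (mult f g)
    show ?case using mult.IH(2)[OF mult.IH(1)[OF mult.prems]] by (simp add: mult_ac)
  qed
  have "(\<lambda>x. 1) \<in> V" using coeff by (simp add: V_def)
  from V_poly[OF _ this] have poly_V: "(\<lambda>x. g (cos (2 * pi * x))) \<in> V" if "real_polynomial_function g" for g
    using that by simp
  have poly_cont: "continuous_on {0..1} (\<lambda>x. g (cos (2 * pi * x)))" if "real_polynomial_function g" for g
    using poly_V[OF that] by (simp add: V_def)
  have poly_orth: "integral {0..1} (\<lambda>x. h x * g (cos (2 * pi * x))) = 0" if "real_polynomial_function g" for g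
  proof -
    have "integral {0..1} (\<lambda>x. h x * g (cos (2 * pi * x)) * cos (2 * pi * real 0 * x)) = 0"
      using poly_V[OF that] unfolding V_def by blast
    then show ?thesis by simp
  qed
  \<comment> \<open>\<open>arccos c / (2 pi)\<close> ranges over \<open>[0, 1/2]\<close>; on the
    other half \<open>h\<close> is recovered by symmetry.\<close>
  define H where "H c = h (arccos c / (2 * pi))" for c
  have H_cont: "continuous_on {-1..1} H"
    unfolding H_def
  proof (intro continuous_on_compose2[OF cont] continuous_intros continuous_on_arccos)
    have "arccos c / (2 * pi) \<in> {0..1}" if "c \<in> {-1..1}" for c
      using arccos_bounded[of c] that pi_gt_zero by (simp add: field_simps)
    then show "(\<lambda>x. arccos x / (2 * pi)) ` {-1..1} \<subseteq> {0..1}" by blast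
  qed auto
  have hH: "h y = H (cos (2 * pi * y))" if "y \<in> {0..1}" for y
  proof -
    have *: "h y = H (cos (2 * pi * y))" if "y \<in> {0..1/2}" for y
      using that by (simp add: H_def arccos_cos field_simps)
    show ?thesis
    proof (cases "y \<le> 1/2")
      case True
      then show ?thesis using * that by auto
    next
      case False
      have "cos (2 * pi * (1 - y)) = cos (2 * pi - 2 * pi * y)" by (simp add: algebra_simps)
      also have "\<dots> = cos (2 * pi * y)" by (simp add: cos_diff)
      finally have "cos (2 * pi * (1 - y)) = cos (2 * pi * y)" .
      then show ?thesis using *[of "1 - y"] sym[of y] that False by auto
    qed
  qed
  define B where "B = integral {0..1} (\<lambda>y. \<bar>h y\<bar>)"
  have B: "B \<ge> 0" unfolding B_def by (rule integral_nonneg) (auto intro!: integrable_continuous_real continuous_intros cont)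
  have sq_le: "integral {0..1} (\<lambda>y. h y * h y) \<le> e * B" if e: "e > 0" for e
  proof -
    obtain g where g: "real_polynomial_function g" "\<And>c. c \<in> {-1..1} \<Longrightarrow> \<bar>H c - g c\<bar> < e"
      using Stone_Weierstrass_real_polynomial_function[OF _ H_cont e] by auto
    have "integral {0..1} (\<lambda>y. h y * h y) = integral {0..1} (\<lambda>y. h y * h y) - integral {0..1} (\<lambda>y. h y * g (cos (2 * pi * y)))"
      by (simp add: poly_orth[OF g(1)])
    also have "\<dots> = integral {0..1} (\<lambda>y. h y * h y - h y * g (cos (2 * pi * y)))"
      by (rule integral_diff [symmetric]; intro integrable_continuous_real continuous_intros cont poly_cont g(1))
    also have "\<dots> = integral {0..1} (\<lambda>y. h y * (h y - g (cos (2 * pi * y))))"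
      by (simp only: right_diff_distrib)
    also have "\<dots> \<le> integral {0..1} (\<lambda>y. e * \<bar>h y\<bar>)"
    proof (rule integral_le)
      fix y :: real assume y: "y \<in> {0..1}"
      have "h y * (h y - g (cos (2 * pi * y))) \<le> \<bar>h y\<bar> * \<bar>h y - g (cos (2 * pi * y))\<bar>"
        by (metis abs_ge_self abs_mult)
      also have "\<dots> \<le> \<bar>h y\<bar> * e"
        using g(2)[of "cos (2 * pi * y)"] hH[OF y] by (intro mult_left_mono) (auto simp: less_imp_le)
      finally show "h y * (h y - g (cos (2 * pi * y))) \<le> e * \<bar>h y\<bar>" by (simp add: mult.commute)
    qed (auto intro!: integrable_continuous_real continuous_intros cont poly_cont g(1))
    also have "\<dots> = e * B" by (simp add: B_def)
    finally show ?thesis .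
  qed
  have "integral {0..1} (\<lambda>y. h y * h y) \<le> 0"
  proof (rule field_le_epsilon)
    fix e :: real assume e: "e > 0"
    have "integral {0..1} (\<lambda>y. h y * h y) \<le> e / (B + 1) * B" using e B by (intro sq_le) auto
    also have "\<dots> \<le> e" using e B by (simp add: field_simps)
    finally show "integral {0..1} (\<lambda>y. h y * h y) \<le> 0 + e" by simp
  qed
  moreover have "integral {0..1} (\<lambda>y. h y * h y) \<ge> 0"
    by (rule integral_nonneg) (auto intro!: integrable_continuous_real continuous_intros cont)
  ultimately have "integral {0..1} (\<lambda>y. h y * h y) = 0" by simp
  then have "h x * h x = 0"
    using x by (subst (asm) integral_eq_0_iff) (auto intro!: continuous_intros cont)
  then show ?thesis by simp
qed

text \<open>This is the characteristic function of the standard normal distribution,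
  rescaled.\<close>

lemma has_bochner_integral_gaussian_cos:
  assumes a: "a > (0::real)"
  shows "has_bochner_integral lborel (\<lambda>x. exp (- a * x\<^sup>2) * cos (2 * pi * s * x)) (sqrt (pi / a) * exp (- (pi\<^sup>2 * s\<^sup>2 / a)))"
proof -
  \<comment> \<open>Chosen so that scaling the variable by \<open>sqrt (2 * a)\<close> turns
    frequency \<open>t\<close> into \<open>2 pi s\<close>.\<close>
  define t where "t = 2 * pi * s / sqrt (2 * a)"
  have 1: "integrable lborel (\<lambda>x. std_normal_density x * cos (t * x))"
    by (rule Bochner_Integration.integrable_bound[OF integrable_std_normal_moment[of 0]])
       (auto simp: abs_mult intro!: mult_left_le)
  have "complex_of_real (exp (- (t\<^sup>2) / 2)) = (LINT x|std_normal_distribution. iexp (t * x))"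
    using fun_cong[OF char_std_normal_distribution, of t] by (simp add: char_def)
  also have "\<dots> = (LINT x|lborel. std_normal_density x *\<^sub>R iexp (t * x))"
    by (subst integral_density) auto
  finally have "exp (- (t\<^sup>2) / 2) = Re (LINT x|lborel. std_normal_density x *\<^sub>R iexp (t * x))"
    by (metis Re_complex_of_real)
  also have "\<dots> = (LINT x|lborel. Re (std_normal_density x *\<^sub>R iexp (t * x)))"
  proof (rule integral_Re [symmetric])
    show "integrable lborel (\<lambda>x. std_normal_density x *\<^sub>R iexp (t * x))"
      by (rule Bochner_Integration.integrable_bound[OF integrable_std_normal_moment[of 0]]) auto
  qed
  also have "(\<lambda>x. Re (std_normal_density x *\<^sub>R iexp (t * x))) = (\<lambda>x. std_normal_density x * cos (t * x))"
    by (simp add: Re_exp)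
  finally have "has_bochner_integral lborel (\<lambda>x. std_normal_density x * cos (t * x)) (exp (- (t\<^sup>2) / 2))"
    using 1 by (simp add: has_bochner_integral_iff)
  then have "has_bochner_integral lborel (\<lambda>x. std_normal_density (0 + sqrt (2 * a) * x) * cos (t * (0 + sqrt (2 * a) * x)))
     (exp (- (t\<^sup>2) / 2) /\<^sub>R \<bar>sqrt (2 * a)\<bar>)"
    using a by (subst (asm) lborel_has_bochner_integral_real_affine_iff[of "sqrt (2 * a)" _ _ 0]) auto
  then have "has_bochner_integral lborel (\<lambda>x. sqrt (2 * pi) * (std_normal_density (0 + sqrt (2 * a) * x) * cos (t * (0 + sqrt (2 * a) * x))))
     (sqrt (2 * pi) * (exp (- (t\<^sup>2) / 2) /\<^sub>R \<bar>sqrt (2 * a)\<bar>))"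
    by (rule has_bochner_integral_mult_right)
  moreover have "sqrt (2 * pi) * (exp (- (t\<^sup>2) / 2) /\<^sub>R \<bar>sqrt (2 * a)\<bar>) = sqrt (pi / a) * exp (- (pi\<^sup>2 * s\<^sup>2 / a))"
    using a by (simp add: t_def power_divide real_sqrt_divide real_sqrt_mult field_simps power_mult_distrib)
  moreover have "sqrt (2 * pi) * (std_normal_density (0 + sqrt (2 * a) * x) * cos (t * (0 + sqrt (2 * a) * x))) =
     exp (- a * x\<^sup>2) * cos (2 * pi * s * x)" for x
    using a by (simp add: std_normal_density_def t_def power_mult_distrib mult_ac)
  ultimately show ?thesis by simp
qed

section \<open>The periodised Gaussian and its cosine series\<close>

lemma summable_exp_neg_square:
  assumes a: "a > (0::real)" shows "summable (\<lambda>m::nat. exp (- a * (real m)\<^sup>2))"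
proof (rule summable_comparison_test')
  show "summable (\<lambda>m. exp (- a) ^ m)" using a by (intro summable_geometric) auto
  show "norm (exp (- a * (real m)\<^sup>2)) \<le> exp (- a) ^ m" for m
  proof -
    have "real m \<le> (real m)\<^sup>2" by (metis of_nat_mono of_nat_power power2_nat_le_imp_le order_refl power2_nat_le_eq_le self_le_power le_add1 le_square power2_eq_square of_nat_le_iff)
    then have "exp (- a * (real m)\<^sup>2) \<le> exp (real m * (- a))" using a by (simp add: mult.commute)
    also have "\<dots> = exp (- a) ^ m" by (rule exp_of_nat_mult)
    finally show ?thesis by simp
  qed
qed

text \<open>On the unit interval the periodised Gaussian is summed in pairs, so that it is
  visibly symmetric under \<open>x \<mapsto> 1 - x\<close>.\<close>

definition gauss_pair :: "real \<Rightarrow> nat \<Rightarrow> real \<Rightarrow> real" where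
  "gauss_pair a m x = exp (- a * (x + real m)\<^sup>2) + exp (- a * (x - real m - 1)\<^sup>2)"

lemma gauss_pair_le:
  assumes "a > 0" "x \<in> {0..1}" shows "norm (gauss_pair a m x) \<le> 2 * exp (- a * (real m)\<^sup>2)"
proof -
  have "(real m)\<^sup>2 \<le> (x + real m)\<^sup>2" "(real m)\<^sup>2 \<le> (x - real m - 1)\<^sup>2"
    using assms by (auto simp: abs_le_square_iff [symmetric])
  then have "exp (- a * (x + real m)\<^sup>2) \<le> exp (- a * (real m)\<^sup>2)"
    "exp (- a * (x - real m - 1)\<^sup>2) \<le> exp (- a * (real m)\<^sup>2)"
    using assms(1) by (simp_all del: abs_le_square_iff power2_le_iff_abs_le)
  moreover have "norm (gauss_pair a m x) = exp (- a * (x + real m)\<^sup>2) + exp (- a * (x - real m - 1)\<^sup>2)"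
    by (simp add: gauss_pair_def)
  ultimately show ?thesis by linarith
qed

lemma uniform_limit_gauss_pair:
  assumes "a > 0"
  shows "uniform_limit {0..1} (\<lambda>K x. \<Sum>m<K. gauss_pair a m x) (\<lambda>x. \<Sum>m. gauss_pair a m x) sequentially"
  by (rule Weierstrass_m_test[OF gauss_pair_le[OF assms]])
     (use summable_exp_neg_square[OF assms] in \<open>auto intro: summable_mult\<close>)

text \<open>Cosine coefficients of the sum of \<open>exp (- a (x + m)^2)\<close> over all integers
  \<open>m\<close>; for \<open>j > 0\<close> the factor 2 joins the frequencies \<open>j\<close> and
  \<open>- j\<close>.\<close>

definition gauss_cos_coeff :: "real \<Rightarrow> nat \<Rightarrow> real" where
  "gauss_cos_coeff a j = (if j = 0 then 1 else 2) * sqrt (pi / a) * exp (- (pi\<^sup>2 * (real j)\<^sup>2 / a))"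

lemma summable_gauss_cos_coeff:
  assumes "a > 0" shows "summable (gauss_cos_coeff a)"
proof (rule summable_comparison_test')
  have "summable (\<lambda>m::nat. exp (- (pi\<^sup>2 / a) * (real m)\<^sup>2))"
    using assms by (intro summable_exp_neg_square) auto
  then show "summable (\<lambda>m::nat. 2 * sqrt (pi / a) * exp (- (pi\<^sup>2 / a) * (real m)\<^sup>2))"
    by (rule summable_mult)
  show "norm (gauss_cos_coeff a j) \<le> 2 * sqrt (pi / a) * exp (- (pi\<^sup>2 / a) * (real j)\<^sup>2)" for j
    using assms by (auto simp: gauss_cos_coeff_def abs_mult)
qed

lemma uniform_limit_gauss_cos:
  assumes "a > 0"
  shows "uniform_limit {0..1} (\<lambda>K x. \<Sum>j<K. gauss_cos_coeff a j * cos (2 * pi * j * x))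
     (\<lambda>x. \<Sum>j. gauss_cos_coeff a j * cos (2 * pi * j * x)) sequentially"
proof (rule Weierstrass_m_test[OF _ summable_gauss_cos_coeff[OF assms]])
  show "norm (gauss_cos_coeff a j * cos (2 * pi * real j * x)) \<le> gauss_cos_coeff a j" for j x
    using assms by (auto simp: abs_mult gauss_cos_coeff_def intro!: mult_left_le)
qed

lemma has_integral_cos_period:
  fixes i :: int
  shows "((\<lambda>x. cos (2 * pi * i * x)) has_integral (if i = 0 then 1 else 0)) {0..1}"
proof (cases "i = 0")
  case False
  have "((\<lambda>x. cos (2 * pi * i * x)) has_integral
      (sin (2 * pi * i * 1) / (2 * pi * i) - sin (2 * pi * i * 0) / (2 * pi * i))) {0..1}"
    using False by (intro fundamental_theorem_of_calculus)
      (auto intro!: derivative_eq_intros simp flip: has_real_derivative_iff_has_vector_derivative)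
  then show ?thesis using False sin_int_2pin[of i] by (simp add: mult_ac)
qed (use has_integral_const_real[of "1::real" 0 1] in simp)

lemma has_integral_cos_cos:
  fixes i j :: nat
  shows "((\<lambda>x. cos (2 * pi * i * x) * cos (2 * pi * j * x)) has_integral
     (if i = j then if j = 0 then 1 else 1/2 else 0)) {0..1}"
proof -
  have "((\<lambda>x. (cos (2 * pi * of_int (int i - int j) * x) + cos (2 * pi * of_int (int i + int j) * x)) / 2) has_integral
    ((if int i - int j = 0 then 1 else 0) + (if int i + int j = 0 then 1 else 0)) / 2) {0..1}"
    by (intro has_integral_divide has_integral_add has_integral_cos_period)
  moreover have "cos (2 * pi * i * x) * cos (2 * pi * j * x) =
      (cos (2 * pi * of_int (int i - int j) * x) + cos (2 * pi * of_int (int i + int j) * x)) / 2" for x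
    by (simp add: cos_times_cos algebra_simps)
  moreover have "((if int i - int j = 0 then 1 else 0) + (if int i + int j = 0 then 1 else 0)) / 2 =
      (if i = j then if j = 0 then 1 else 1/2 else (0::real))" by auto
  ultimately show ?thesis by (simp only:)
qed

text \<open>Unfolding: on the unit interval the \<open>m\<close>-th pair represents the Gaussian on
  \<open>[m, m + 1]\<close> and on \<open>[- m - 1, - m]\<close>, and integer shifts do not change
  the cosine.\<close>

lemma integral_gauss_pair_cos:
  assumes "a > 0"
  shows "((\<lambda>x. (\<Sum>m<K. gauss_pair a m x) * cos (2 * pi * real j * x)) has_integral
     integral {- real K..real K} (\<lambda>x. exp (- a * x\<^sup>2) * cos (2 * pi * real j * x))) {0..1}"
proof (induction K)
  case 0
  then show ?case by simp
next
  case (Suc K)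
  define f where "f = (\<lambda>x. exp (- a * x\<^sup>2) * cos (2 * pi * real j * x))"
  have int_f: "f integrable_on {u..v}" for u v
    unfolding f_def by (intro integrable_continuous_real continuous_intros)
  have shift: "((\<lambda>x. exp (- a * (x + of_int c)\<^sup>2) * cos (2 * pi * real j * x)) has_integral integral {of_int c..of_int c + 1} f) {0..1}"
    for c :: int
  proof -
    have "(f has_integral integral {of_int c..of_int c + 1} f) (cbox (of_int c) (of_int c + 1))"
      using int_f by (simp add: integrable_integral)
    then have "((\<lambda>x. f (1 * x + of_int c)) has_integral (1 / (\<bar>1\<bar> ^ DIM(real))) *\<^sub>R integral {of_int c..of_int c + 1} f)
       ((\<lambda>x. (1/1) *\<^sub>R x + - ((1/1) *\<^sub>R of_int c)) ` cbox (of_int c) (of_int c + 1))"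
      using has_integral_affinity[of f "integral {of_int c..of_int c + 1} f" "of_int c" "of_int c + 1" 1 "of_int c"] by simp
    moreover have "(\<lambda>x. (1/1) *\<^sub>R x + - ((1/1) *\<^sub>R of_int c)) ` cbox (of_int c) (of_int c + 1) = {0..1::real}"
      by (simp add: image_add_atLeastAtMost' flip: diff_conv_add_uminus)
    moreover have "cos (2 * pi * real j * (x + of_int c)) = cos (2 * pi * real j * x)" for x
    proof -
      have "cos (2 * pi * real j * x + 2 * pi * of_int (int j * c)) = cos (2 * pi * real j * x)"
        unfolding cos_add by (simp add: mult.commute[of _ "2*pi"] cos_int_2pin sin_int_2pin del: of_int_mult)
      then show ?thesis by (simp add: algebra_simps)
    qed
    ultimately show ?thesis by (simp add: f_def)
  qed
  have "((\<lambda>x. (\<Sum>m<K. gauss_pair a m x) * cos (2 * pi * real j * x) +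
      (exp (- a * (x + of_int (int K))\<^sup>2) * cos (2 * pi * real j * x) +
       exp (- a * (x + of_int (- int K - 1))\<^sup>2) * cos (2 * pi * real j * x))) has_integral
     (integral {- real K..real K} f + (integral {of_int (int K)..of_int (int K) + 1} f +
        integral {of_int (- int K - 1)..of_int (- int K - 1) + 1} f))) {0..1}"
    using Suc.IH by (intro has_integral_add shift) (simp add: f_def)
  moreover have "integral {- real K..real K} f + (integral {of_int (int K)..of_int (int K) + 1} f +
        integral {of_int (- int K - 1)..of_int (- int K - 1) + 1} f) = integral {- real (Suc K)..real (Suc K)} f"
  proof -
    have "integral {- real (Suc K)..real (Suc K)} f =
      integral {- real (Suc K)..- real K} f + integral {- real K..real (Suc K)} f"
      by (rule Henstock_Kurzweil_Integration.integral_combine [symmetric]) (auto intro: int_f)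
    also have "integral {- real K..real (Suc K)} f = integral {- real K..real K} f + integral {real K..real (Suc K)} f"
      by (rule Henstock_Kurzweil_Integration.integral_combine [symmetric]) (auto intro: int_f)
    finally have "integral {- real (Suc K)..real (Suc K)} f = integral {- real (Suc K)..- real K} f +
      (integral {- real K..real K} f + integral {real K..real (Suc K)} f)" .
    moreover have "real K + 1 = real (Suc K)" "real_of_int (- int K - 1) = - real (Suc K)" "- real (Suc K) + 1 = - real K"
      by simp_all
    ultimately show ?thesis by (simp only: of_int_of_nat_eq add_ac)
  qed
  ultimately show ?case
    by (simp add: f_def gauss_pair_def algebra_simps)
qed

lemma gaussian_cos_integral_tendsto:
  assumes a: "a > 0"
  shows "(\<lambda>K. integral {- real K..real K} (\<lambda>x. exp (- a * x\<^sup>2) * cos (2 * pi * s * x)))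
     \<longlonglongrightarrow> sqrt (pi / a) * exp (- (pi\<^sup>2 * s\<^sup>2 / a))"
proof -
  define f where "f = (\<lambda>x. exp (- a * x\<^sup>2) * cos (2 * pi * s * x))"
  have hb: "has_bochner_integral lborel f (sqrt (pi / a) * exp (- (pi\<^sup>2 * s\<^sup>2 / a)))"
    unfolding f_def by (rule has_bochner_integral_gaussian_cos[OF a])
  then have int_f: "integrable lborel f" by (simp add: has_bochner_integral_iff)
  have "(\<lambda>K. LINT x|lborel. indicat_real {- real K..real K} x *\<^sub>R f x) \<longlonglongrightarrow> (LINT x|lborel. f x)"
  proof (rule integral_dominated_convergence[where w = "\<lambda>x. norm (f x)"])
    show "AE x in lborel. (\<lambda>K. indicat_real {- real K..real K} x *\<^sub>R f x) \<longlonglongrightarrow> f x"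
    proof (intro AE_I2 tendsto_eventually)
      fix x :: real
      have "eventually (\<lambda>K. \<bar>x\<bar> \<le> real K) sequentially" by (rule eventually_sequentiallyI[of "nat \<lceil>\<bar>x\<bar>\<rceil>"]) linarith
      then show "\<forall>\<^sub>F K in sequentially. indicat_real {- real K..real K} x *\<^sub>R f x = f x"
        by eventually_elim (auto simp: indicator_def)
    qed
  qed (use int_f in \<open>auto simp: indicator_def\<close>)
  moreover have "(LINT x|lborel. f x) = sqrt (pi / a) * exp (- (pi\<^sup>2 * s\<^sup>2 / a))"
    using hb by (rule has_bochner_integral_integral_eq)
  moreover have "(LINT x|lborel. indicat_real {- real K..real K} x *\<^sub>R f x) = integral {- real K..real K} f" for K
  proof -
    have "set_integrable lborel {- real K..real K} f"
      unfolding f_def set_integrable_def by (intro borel_integrable_compact continuous_intros) auto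
    from set_borel_integral_eq_integral(2)[OF this] show ?thesis by (simp add: set_lebesgue_integral_def)
  qed
  ultimately show ?thesis by (simp add: f_def)
qed

text \<open>Both series converge uniformly, so they are continuous and their cosine coefficients can
  be computed termwise. The coefficients agree, and \<open>cos_coeffs_zero_imp_zero\<close> applies
  to the difference.\<close>

theorem gaussian_poisson:
  assumes a: "a > 0" and x: "x \<in> {0..1}"
  shows "(\<Sum>m. gauss_pair a m x) = (\<Sum>j. gauss_cos_coeff a j * cos (2 * pi * j * x))"
proof -
  define f where "f = (\<lambda>x. \<Sum>m. gauss_pair a m x)"
  define g where "g = (\<lambda>x. \<Sum>j. gauss_cos_coeff a j * cos (2 * pi * j * x))"
  have cont_f: "continuous_on {0..1} f"
    unfolding f_def
    by (rule uniform_limit_theorem[OF _ uniform_limit_gauss_pair[OF a]])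
       (auto intro!: always_eventually continuous_intros simp: gauss_pair_def)
  have cont_g: "continuous_on {0..1} g"
    unfolding g_def
    by (rule uniform_limit_theorem[OF _ uniform_limit_gauss_cos[OF a]])
       (auto intro!: always_eventually continuous_intros)
  have bdd_cos: "bounded ((\<lambda>x. cos (2 * pi * real j * x)) ` S)" for j S
    by (rule boundedI[of _ 1]) auto
  have bdd: "bounded (u ` {0..1})" if "continuous_on {0..1} u" for u :: "real \<Rightarrow> real"
    using compact_continuous_image[OF that] by (auto intro: compact_imp_bounded)
  have int_f: "integral {0..1} (\<lambda>x. f x * cos (2 * pi * real j * x)) = sqrt (pi / a) * exp (- (pi\<^sup>2 * (real j)\<^sup>2 / a))" for j
  proof -
    have "uniform_limit {0..1} (\<lambda>K x. (\<Sum>m<K. gauss_pair a m x) * cos (2 * pi * real j * x)) (\<lambda>x. f x * cos (2 * pi * real j * x)) sequentially"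
      unfolding f_def
      by (intro uniform_lim_mult uniform_limit_gauss_pair[OF a] uniform_limit_const bdd_cos)
         (use bdd[OF cont_f] in \<open>auto simp: f_def\<close>)
    then obtain I J where IJ: "\<And>K. ((\<lambda>x. (\<Sum>m<K. gauss_pair a m x) * cos (2 * pi * real j * x)) has_integral I K) {0..1}"
        "((\<lambda>x. f x * cos (2 * pi * real j * x)) has_integral J) {0..1}" "I \<longlonglongrightarrow> J"
      by (rule uniform_limit_integral) (auto intro!: continuous_intros simp: gauss_pair_def)
    have "I K = integral {- real K..real K} (\<lambda>x. exp (- a * x\<^sup>2) * cos (2 * pi * real j * x))" for K
      using has_integral_unique[OF IJ(1) integral_gauss_pair_cos[OF a]] .
    then have "J = sqrt (pi / a) * exp (- (pi\<^sup>2 * (real j)\<^sup>2 / a))"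
      using LIMSEQ_unique[OF IJ(3)] gaussian_cos_integral_tendsto[OF a, of "real j"] by presburger
    then show ?thesis using IJ(2) by (simp add: integral_unique)
  qed
  have int_g: "integral {0..1} (\<lambda>x. g x * cos (2 * pi * real j * x)) = sqrt (pi / a) * exp (- (pi\<^sup>2 * (real j)\<^sup>2 / a))" for j
  proof -
    have "uniform_limit {0..1} (\<lambda>K x. (\<Sum>i<K. gauss_cos_coeff a i * cos (2 * pi * i * x)) * cos (2 * pi * real j * x)) (\<lambda>x. g x * cos (2 * pi * real j * x)) sequentially"
      unfolding g_def
      by (intro uniform_lim_mult uniform_limit_gauss_cos[OF a] uniform_limit_const bdd_cos)
         (use bdd[OF cont_g] in \<open>auto simp: g_def\<close>)
    then obtain I J where IJ: "\<And>K. ((\<lambda>x. (\<Sum>i<K. gauss_cos_coeff a i * cos (2 * pi * i * x)) * cos (2 * pi * real j * x)) has_integral I K) {0..1}"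
        "((\<lambda>x. g x * cos (2 * pi * real j * x)) has_integral J) {0..1}" "I \<longlonglongrightarrow> J"
      by (rule uniform_limit_integral) (auto intro!: continuous_intros)
    have "I K = gauss_cos_coeff a j * (if j = 0 then 1 else 1/2)" if "K > j" for K
    proof -
      have "((\<lambda>x. \<Sum>i<K. gauss_cos_coeff a i * (cos (2 * pi * i * x) * cos (2 * pi * j * x))) has_integral
         (\<Sum>i<K. gauss_cos_coeff a i * (if i = j then if j = 0 then 1 else 1/2 else 0))) {0..1}"
        by (intro has_integral_sum has_integral_mult_right has_integral_cos_cos) auto
      then have "I K = (\<Sum>i<K. gauss_cos_coeff a i * (if i = j then if j = 0 then 1 else 1/2 else 0))"
        by (intro has_integral_unique[OF IJ(1)[of K]]) (simp add: sum_distrib_right mult.assoc)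
      also have "\<dots> = gauss_cos_coeff a j * (if j = 0 then 1 else 1/2)"
        using that by (simp add: if_distrib[of "\<lambda>x. _ * x"] sum.delta cong: if_cong)
      finally show ?thesis .
    qed
    then have "I \<longlonglongrightarrow> gauss_cos_coeff a j * (if j = 0 then 1 else 1/2)"
      by (intro tendsto_eventually eventually_mono[OF eventually_gt_at_top[of j]])
    from LIMSEQ_unique[OF IJ(3) this] have "J = sqrt (pi / a) * exp (- (pi\<^sup>2 * (real j)\<^sup>2 / a))"
      by (auto simp: gauss_cos_coeff_def split: if_splits)
    then show ?thesis using IJ(2) by (simp add: integral_unique)
  qed
  have "f x - g x = 0"
  proof (rule cos_coeffs_zero_imp_zero[OF _ _ _ x])
    show "continuous_on {0..1} (\<lambda>x. f x - g x)" by (intro continuous_intros cont_f cont_g)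
    show "f (1 - x) - g (1 - x) = f x - g x" for x
    proof -
      have "gauss_pair a m (1 - x) = gauss_pair a m x" for m
        by (simp add: gauss_pair_def power2_eq_square algebra_simps)
      moreover have "cos (2 * pi * real j * (1 - x)) = cos (2 * pi * real j * x)" for j
      proof -
        have "cos (2 * pi * of_int (int j) - 2 * pi * real j * x) = cos (2 * pi * real j * x)"
          unfolding cos_diff by (simp add: cos_int_2pin sin_int_2pin mult.commute[of _ "2*pi"] del: of_int_of_nat_eq)
        then show ?thesis by (simp add: algebra_simps)
      qed
      ultimately show ?thesis by (simp add: f_def g_def)
    qed
    show "integral {0..1} (\<lambda>x. (f x - g x) * cos (2 * pi * real j * x)) = 0" for j
    proof -
      have "integral {0..1} (\<lambda>x. f x * cos (2 * pi * real j * x) - g x * cos (2 * pi * real j * x)) = 0"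
        by (subst integral_diff) (auto intro!: integrable_continuous_real continuous_intros cont_f cont_g simp: int_f int_g)
      then show ?thesis by (simp add: left_diff_distrib)
    qed
  qed
  then show ?thesis by (simp add: f_def g_def)
qed

section \<open>The transformation of the generating function\<close>

text \<open>Completing the square. This is the origin of the factor \<open>exp (- t / 24)\<close>:
  with it the pentagonal series becomes a sum of Gaussians over integers prime to 6.\<close>

lemma real_pent_minus: "24 * real (pent_minus j) + 1 = (6 * real j - 1)\<^sup>2"
  and real_pent_plus: "24 * real (pent_plus j) + 1 = (6 * real j + 1)\<^sup>2"
proof -
  have tri: "2 * real (tri j) = real j * (real j + 1)"
    using arg_cong[OF two_tri[of j], of real] by (simp add: algebra_simps)
  have "real (pent_minus j) = real j * (real j - 1) + real (tri j)"
    by (cases j) (simp_all add: pent_minus_def algebra_simps)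
  then show "24 * real (pent_minus j) + 1 = (6 * real j - 1)\<^sup>2"
    using tri by (simp add: power2_eq_square algebra_simps)
  show "24 * real (pent_plus j) + 1 = (6 * real j + 1)\<^sup>2"
    using tri by (simp add: pent_plus_def power2_eq_square algebra_simps)
qed

lemma exp_pent_sum_Suc:
  fixes t :: real
  shows "exp (- t / 24) * pent_sum (Suc K) (exp (- t)) = exp (- t / 24) * pent_sum K (exp (- t)) +
     (-1) ^ Suc K * (exp (- t * (6 * real K + 5)\<^sup>2 / 24) + exp (- t * (6 * real K + 7)\<^sup>2 / 24))"
proof -
  have e: "exp (- t / 24) * exp (- t) ^ n = exp (- t * m / 24)" if "24 * real n + 1 = m" for n m
    by (simp add: exp_of_nat_mult [symmetric] exp_add [symmetric] that [symmetric] field_simps)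
  show ?thesis
    unfolding pent_sum_Suc distrib_left[of "exp (- t / 24)"]
    using e[OF real_pent_minus[of "Suc K"]] e[OF real_pent_plus[of "Suc K"]]
    by (simp add: algebra_simps)
qed

text \<open>Modulo 12 the integers prime to 6 split into residues 1 and 11 with sign plus and
  residues 5 and 7 with sign minus. These are the shifts 1/12 and 7/12 of the Gaussian with
  parameter \<open>6 t\<close>. The square \<open>(12 M + 1)^2\<close> has no partner yet and stays
  as the extra term.\<close>

lemma exp_pent_sum_eq_gauss_pair:
  fixes t :: real
  shows "exp (- t / 24) * pent_sum (2 * M) (exp (- t)) =
     (\<Sum>m<M. gauss_pair (6 * t) m (1/12) - gauss_pair (6 * t) m (7/12)) + exp (- t * (12 * real M + 1)\<^sup>2 / 24)"
proof (induction M)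
  case 0
  then show ?case by (simp add: pent_sum_def)
next
  case (Suc M)
  have g1: "gauss_pair (6 * t) M (1/12) = exp (- t * (12 * real M + 1)\<^sup>2 / 24) + exp (- t * (12 * real M + 11)\<^sup>2 / 24)"
    unfolding gauss_pair_def by (intro arg_cong2[of _ _ _ _ "(+)"] arg_cong[of _ _ exp]) (simp_all add: power2_eq_square field_simps)
  have g2: "gauss_pair (6 * t) M (7/12) = exp (- t * (12 * real M + 7)\<^sup>2 / 24) + exp (- t * (12 * real M + 5)\<^sup>2 / 24)"
    unfolding gauss_pair_def by (intro arg_cong2[of _ _ _ _ "(+)"] arg_cong[of _ _ exp]) (simp_all add: power2_eq_square field_simps)
  have double_Suc: "2 * Suc M = Suc (Suc (2 * M))" by simp
  show ?case
    unfolding double_Suc exp_pent_sum_Suc sum.lessThan_Suc g1 g2 Suc.IH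
    by (simp add: algebra_simps)
qed

text \<open>Even frequencies cancel between the shifts 1/12 and 7/12. For odd \<open>j\<close> the
  value \<open>cos (pi j / 6)\<close> is 0 if 3 divides \<open>j\<close> and
  \<open>\<plusminus> sqrt 3 / 2\<close> otherwise, so the same pentagonal series reappears at
  \<open>T\<close>. Six frequencies match one step of \<open>pent_sum\<close>, whose last square
  \<open>(6 M + 1)^2\<close> lies just outside the range \<open>j < 6 M\<close>.\<close>

lemma exp_pent_sum_eq_cos_sum:
  fixes t :: real
  assumes t: "t > 0"
  defines "T \<equiv> 4 * pi\<^sup>2 / t"
  shows "sqrt (2 * pi / t) * (exp (- T / 24) * pent_sum M (exp (- T))) =
     (\<Sum>j<6*M. gauss_cos_coeff (6 * t) j * (cos (2 * pi * j * (1/12)) - cos (2 * pi * j * (7/12))))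
      + sqrt (2 * pi / t) * ((-1) ^ M * exp (- T * (6 * real M + 1)\<^sup>2 / 24))"
proof (induction M)
  case 0
  then show ?case by (simp add: pent_sum_def)
next
  case (Suc M)
  define d where "d j = gauss_cos_coeff (6 * t) j * (cos (2 * pi * real j * (1/12)) - cos (2 * pi * real j * (7/12)))" for j
  have cos7: "cos (2 * pi * real j * (7/12)) = (-1) ^ j * cos (2 * pi * real j * (1/12))" for j
  proof -
    have "cos (2 * pi * real j * (7/12)) = cos (2 * pi * real j * (1/12) + real j * pi)" by (simp add: field_simps)
    also have "\<dots> = (-1) ^ j * cos (2 * pi * real j * (1/12))" by (simp only: cos_add cos_npi sin_npi) simp
    finally show ?thesis .
  qed
  have d_even: "d j = 0" if "even j" for j using that by (simp only: d_def cos7) simp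
  have s3: "sqrt (pi / (6 * t)) * (2 * sqrt 3) = sqrt (2 * pi / t)"
  proof -
    have "2 * sqrt 3 = sqrt 12" using real_sqrt_mult[of 4 3] by simp
    then show ?thesis by (simp add: real_sqrt_mult [symmetric])
  qed
  have d_odd: "d j = 4 * sqrt (pi / (6 * t)) * exp (- T * (real j)\<^sup>2 / 24) * cos (pi * real j / 6)" if "odd j" for j
  proof -
    have "j \<noteq> 0" using that by (intro notI) simp
    have "cos (2 * pi * real j * (1/12)) = cos (pi * real j / 6)" by simp
    then show ?thesis using that \<open>j \<noteq> 0\<close> t
      unfolding d_def cos7 gauss_cos_coeff_def T_def by (simp add: field_simps)
  qed
  have d1: "d (6 * M + 1) = sqrt (2 * pi / t) * ((-1) ^ M * exp (- T * (6 * real M + 1)\<^sup>2 / 24))"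
  proof -
    have "cos (pi * real (6 * M + 1) / 6) = cos (real M * pi + pi / 6)" by (simp add: field_simps)
    also have "\<dots> = (-1) ^ M * (sqrt 3 / 2)" by (simp add: cos_add cos_npi sin_npi cos_30)
    finally have c: "cos (pi * real (6 * M + 1) / 6) = \<dots>" .
    show ?thesis unfolding s3 [symmetric]
      by (subst d_odd, simp, simp only: c) (simp add: algebra_simps)
  qed
  have d5: "d (6 * M + 5) = - (sqrt (2 * pi / t) * ((-1) ^ M * exp (- T * (6 * real M + 5)\<^sup>2 / 24)))"
  proof -
    have "cos (pi * real (6 * M + 5) / 6) = cos (real (Suc M) * pi - pi / 6)" by (simp add: field_simps)
    also have "\<dots> = (-1) ^ Suc M * (sqrt 3 / 2)" unfolding cos_diff cos_npi sin_npi by (simp add: cos_30)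
    finally have c: "cos (pi * real (6 * M + 5) / 6) = \<dots>" .
    show ?thesis unfolding s3 [symmetric]
      by (subst d_odd, simp, simp only: c) (simp add: algebra_simps)
  qed
  have d3: "d (6 * M + 3) = 0"
  proof -
    have "cos (pi * real (6 * M + 3) / 6) = cos (real M * pi + pi / 2)"
      by (rule arg_cong[where f = cos]) (simp add: field_simps)
    also have "\<dots> = 0" by (simp add: cos_add sin_npi)
    finally show ?thesis by (subst d_odd) simp_all
  qed
  have "6 * Suc M = Suc (Suc (Suc (Suc (Suc (Suc (6 * M))))))" by simp
  then have "(\<Sum>j<6 * Suc M. d j) = (\<Sum>j<6*M. d j) + d (6 * M) + d (6 * M + 1) + d (6 * M + 2) + d (6 * M + 3) + d (6 * M + 4) + d (6 * M + 5)"
    by (simp add: eval_nat_numeral)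
  also have "\<dots> = (\<Sum>j<6*M. d j) + d (6 * M + 1) + d (6 * M + 5)" by (simp add: d_even d3)
  finally show ?case
    using Suc.IH unfolding d_def [symmetric] exp_pent_sum_Suc d1 d5 by (simp add: algebra_simps)
qed

lemma exp_neg_square_tendsto_0:
  assumes "t > 0" "a > 0" shows "(\<lambda>M. exp (- t * (a * real M + 1)\<^sup>2 / 24)) \<longlonglongrightarrow> 0"
proof -
  have "((\<lambda>x. exp (- t * (a * x + 1)\<^sup>2 / 24)) \<longlongrightarrow> 0) at_top" using assms by real_asymp
  then show ?thesis by (rule filterlim_compose) (rule filterlim_real_sequentially)
qed

lemma pent_sum_of_real: "pent_sum k (of_real x :: complex) = of_real (pent_sum k x)"
  by (simp add: pent_sum_def)

lemma pent_sum_real_tendsto: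
  assumes "t > 0" shows "(\<lambda>k. pent_sum k (exp (- t))) \<longlonglongrightarrow> Re (eval_fps euler_fps (of_real (exp (- t))))"
    and "eval_fps euler_fps (of_real (exp (- t))) = of_real (Re (eval_fps euler_fps (of_real (exp (- t)))))"
proof -
  have *: "(\<lambda>k. pent_sum k (of_real (exp (- t)) :: complex)) \<longlonglongrightarrow> eval_fps euler_fps (of_real (exp (- t)))"
    using assms by (intro pent_sum_tendsto) auto
  from tendsto_Re[OF this] show "(\<lambda>k. pent_sum k (exp (- t))) \<longlonglongrightarrow> Re (eval_fps euler_fps (of_real (exp (- t))))"
    unfolding pent_sum_of_real by simp
  from tendsto_Im[OF *] have "Im (eval_fps euler_fps (of_real (exp (- t)))) = 0"
    unfolding pent_sum_of_real by (simp add: LIMSEQ_const_iff)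
  then show "eval_fps euler_fps (of_real (exp (- t))) = of_real (Re (eval_fps euler_fps (of_real (exp (- t)))))"
    by (simp add: complex_eq_iff)
qed

lemma euler_fps_transform_real:
  assumes t: "t > 0"
  shows "exp (- t / 24) * Re (eval_fps euler_fps (of_real (exp (- t)))) =
    sqrt (2 * pi / t) * (exp (- (4 * pi\<^sup>2 / t) / 24) * Re (eval_fps euler_fps (of_real (exp (- (4 * pi\<^sup>2 / t))))))"
proof -
  define a where "a = 6 * t"
  define T where "T = 4 * pi\<^sup>2 / t"
  have a: "a > 0" and T: "T > 0" using t by (auto simp: a_def T_def)
  define d where "d j = gauss_cos_coeff a j * cos (2 * pi * real j * (1/12)) - gauss_cos_coeff a j * cos (2 * pi * real j * (7/12))" for j
  have gp: "(\<lambda>m. gauss_pair a m x) sums (\<Sum>m. gauss_pair a m x)" if "x \<in> {0..1}" for x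
    unfolding sums_def using tendsto_uniform_limitI[OF uniform_limit_gauss_pair[OF a] that] .
  have gc: "(\<lambda>j. gauss_cos_coeff a j * cos (2 * pi * real j * x)) sums (\<Sum>m. gauss_pair a m x)" if "x \<in> {0..1}" for x
    unfolding sums_def gaussian_poisson[OF a that] using tendsto_uniform_limitI[OF uniform_limit_gauss_cos[OF a] that] .
  define S where "S = (\<Sum>m. gauss_pair a m (1/12)) - (\<Sum>m. gauss_pair a m (7/12))"
  have 1: "(\<lambda>M. \<Sum>m<M. gauss_pair a m (1/12) - gauss_pair a m (7/12)) \<longlonglongrightarrow> S"
    unfolding S_def using sums_diff[OF gp[of "1/12"] gp[of "7/12"]] by (simp add: sums_def)
  have 2: "(\<lambda>M. \<Sum>j<M. d j) \<longlonglongrightarrow> S"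
    unfolding S_def d_def using sums_diff[OF gc[of "1/12"] gc[of "7/12"]] by (simp add: sums_def)
  have l1: "(\<lambda>M. exp (- t / 24) * pent_sum (2 * M) (exp (- t))) \<longlonglongrightarrow> S + 0"
    unfolding exp_pent_sum_eq_gauss_pair a_def [symmetric]
    by (intro tendsto_add 1 exp_neg_square_tendsto_0 t) simp
  have l2: "(\<lambda>M. exp (- t / 24) * pent_sum (2 * M) (exp (- t))) \<longlonglongrightarrow> exp (- t / 24) * Re (eval_fps euler_fps (of_real (exp (- t))))"
    by (intro tendsto_mult_left filterlim_compose[OF pent_sum_real_tendsto(1)[OF t]] mult_nat_left_at_top) simp
  have L: "exp (- t / 24) * Re (eval_fps euler_fps (of_real (exp (- t)))) = S"
    using LIMSEQ_unique[OF l2 l1] by simp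
  have sub: "(\<lambda>M. \<Sum>j<6*M. d j) \<longlonglongrightarrow> S"
    by (rule filterlim_compose[OF 2]) (rule mult_nat_left_at_top, simp)
  have "(\<lambda>M. (-1) ^ M * exp (- T * (6 * real M + 1)\<^sup>2 / 24)) \<longlonglongrightarrow> 0"
    by (rule tendsto_norm_zero_cancel)
       (use exp_neg_square_tendsto_0[OF T, of 6] in \<open>simp add: abs_mult power_abs\<close>)
  then have r1: "(\<lambda>M. (\<Sum>j<6*M. d j) + sqrt (2 * pi / t) * ((-1) ^ M * exp (- T * (6 * real M + 1)\<^sup>2 / 24))) \<longlonglongrightarrow> S + sqrt (2 * pi / t) * 0"
    by (intro tendsto_intros sub)
  have r2: "(\<lambda>M. sqrt (2 * pi / t) * (exp (- T / 24) * pent_sum M (exp (- T)))) \<longlonglongrightarrow>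
     sqrt (2 * pi / t) * (exp (- T / 24) * Re (eval_fps euler_fps (of_real (exp (- T)))))"
    by (intro tendsto_mult_left pent_sum_real_tendsto(1)[OF T])
  have r3: "sqrt (2 * pi / t) * (exp (- T / 24) * pent_sum M (exp (- T))) =
    (\<Sum>j<6*M. d j) + sqrt (2 * pi / t) * ((-1) ^ M * exp (- T * (6 * real M + 1)\<^sup>2 / 24))" for M
    using exp_pent_sum_eq_cos_sum[OF t, of M] unfolding d_def T_def a_def by (simp only: right_diff_distrib)
  have R: "sqrt (2 * pi / t) * (exp (- T / 24) * Re (eval_fps euler_fps (of_real (exp (- T))))) = S"
    using LIMSEQ_unique[OF r2[unfolded r3] r1] by simp
  show ?thesis using L R by (simp add: T_def)
qed

text \<open>Identity theorem on the right half plane: both sides are holomorphic there and agree on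
  the positive axis.\<close>

theorem euler_fps_transform:
  assumes z: "Re z > 0"
  shows "exp (- z / 24) * eval_fps euler_fps (exp (- z)) =
    of_real (sqrt (2 * pi)) / csqrt z * exp (- of_real (pi\<^sup>2 / 6) / z) * eval_fps euler_fps (exp (- of_real (4 * pi\<^sup>2) / z))"
proof -
  define S where "S = {z. Re z > 0}"
  define f where "f z = exp (- z / 24) * eval_fps euler_fps (exp (- z)) -
    of_real (sqrt (2 * pi)) / csqrt z * exp (- of_real (pi\<^sup>2 / 6) / z) * eval_fps euler_fps (exp (- of_real (4 * pi\<^sup>2) / z))" for z
  have open_S: "open S" unfolding S_def by (rule open_halfspace_Re_gt)
  have conn: "connected S" unfolding S_def by (intro convex_connected convex_halfspace_Re_gt)
  have hol_euler: "eval_fps euler_fps holomorphic_on ball 0 1"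
    by (intro holomorphic_on_eval_fps) (auto simp: in_eball_iff intro!: less_le_trans[OF _ fps_conv_radius_euler_fps])
  have Re_inv: "Re (of_real c / z) > 0" if "z \<in> S" "c > 0" for z c
  proof -
    have "z \<noteq> 0" using that by (auto simp: S_def)
    have "Re (of_real c / z) = c * Re z / (norm z)\<^sup>2"
      by (simp add: Re_divide cmod_def)
    then show ?thesis using that \<open>z \<noteq> 0\<close> by (simp add: S_def)
  qed
  have "f holomorphic_on S"
    unfolding f_def
  proof (intro holomorphic_intros)
    have "(\<lambda>z. exp (- z)) ` S \<subseteq> ball 0 1" by (auto simp: S_def)
    then show "(\<lambda>z. eval_fps euler_fps (exp (- z))) holomorphic_on S"
      by (intro holomorphic_on_compose_gen[OF _ hol_euler, unfolded o_def] holomorphic_intros)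
    have "norm (exp (- of_real (4 * pi\<^sup>2) / z)) < 1" if "z \<in> S" for z
      using Re_inv[OF that, of "4 * pi\<^sup>2"] by (simp del: of_real_mult of_real_power)
    then have "(\<lambda>z. exp (- of_real (4 * pi\<^sup>2) / z)) ` S \<subseteq> ball 0 1" by auto
    then show "(\<lambda>z. eval_fps euler_fps (exp (- of_real (4 * pi\<^sup>2) / z))) holomorphic_on S"
      by (intro holomorphic_on_compose_gen[OF _ hol_euler, unfolded o_def] holomorphic_intros) (auto simp: S_def)
  qed (auto simp: S_def complex_nonpos_Reals_iff)
  moreover have "f (of_real t) = 0" if "t > 0" for t
  proof -
    have T: "4 * pi\<^sup>2 / t > 0" using that by simp
    have e1: "exp (- of_real t :: complex) = of_real (exp (- t))" by (simp add: exp_of_real [symmetric])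
    have e2: "exp (- of_real (4 * pi\<^sup>2) / of_real t :: complex) = of_real (exp (- (4 * pi\<^sup>2 / t)))" by (simp add: exp_of_real [symmetric])
    have e3: "exp (- of_real t / 24 :: complex) = of_real (exp (- t / 24))" by (simp add: exp_of_real [symmetric])
    have e4: "exp (- of_real (pi\<^sup>2 / 6) / of_real t :: complex) = of_real (exp (- (4 * pi\<^sup>2 / t) / 24))"
      by (simp add: exp_of_real [symmetric])
    have e5: "of_real (sqrt (2 * pi)) / csqrt (of_real t) = (of_real (sqrt (2 * pi / t)) :: complex)"
      using that by (simp add: of_real_sqrt [symmetric] real_sqrt_divide)
    have "f (of_real t) = of_real (exp (- t / 24) * Re (eval_fps euler_fps (of_real (exp (- t)))) -
      sqrt (2 * pi / t) * (exp (- (4 * pi\<^sup>2 / t) / 24) * Re (eval_fps euler_fps (of_real (exp (- (4 * pi\<^sup>2 / t)))))))"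
      unfolding f_def e1 e2 e3 e4 e5
      by (subst pent_sum_real_tendsto(2)[OF that], subst pent_sum_real_tendsto(2)[OF T]) simp
    also have "\<dots> = 0" using euler_fps_transform_real[OF that] by simp
    finally show ?thesis .
  qed
  moreover have "(1::complex) islimpt (of_real ` {0<..})"
  proof -
    have "(\<lambda>n. of_real (1 + 1 / real (Suc n)) :: complex) \<longlonglongrightarrow> of_real (1 + 0)"
      by (intro tendsto_of_real tendsto_add tendsto_const LIMSEQ_Suc[OF lim_1_over_n])
    then show ?thesis
      unfolding islimpt_sequential
      by (intro exI[of _ "\<lambda>n. of_real (1 + 1 / real (Suc n))"]) (auto simp del: of_real_add simp: add_pos_pos)
  qed
  ultimately have "f z = 0"
    using z by (intro analytic_continuation[of f S "of_real ` {0<..}" 1 z])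
      (use open_S conn in \<open>auto simp: S_def\<close>)
  then show ?thesis by (simp add: f_def)
qed

corollary partition_fps_transform:
  assumes z: "Re z > 0"
  shows "eval_fps partition_fps (exp (- z)) =
    csqrt z / of_real (sqrt (2 * pi)) * exp (of_real (pi\<^sup>2 / 6) / z - z / 24) * eval_fps partition_fps (exp (- of_real (4 * pi\<^sup>2) / z))"
proof -
  have z0: "z \<noteq> 0" using z by auto
  have n1: "norm (exp (- z)) < 1" using z by simp
  have "Re (of_real (4 * pi\<^sup>2) / z) = (4 * pi\<^sup>2) * Re z / (norm z)\<^sup>2" by (simp add: Re_divide cmod_def)
  then have n2: "norm (exp (- of_real (4 * pi\<^sup>2) / z)) < 1"
    using z z0 by (simp del: of_real_mult of_real_power)
  have solve: "inverse P = c / s * (E1 / E2) * inverse Q"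
    if "E1 * P = s / c * E2 * Q" "P \<noteq> 0" "Q \<noteq> 0" "s \<noteq> 0" "c \<noteq> 0" "E1 \<noteq> 0" "E2 \<noteq> 0" for P Q c s E1 E2 :: complex
    using that by (simp add: field_simps)
  have e: "exp (of_real (pi\<^sup>2 / 6) / z - z / 24) = exp (- z / 24) / exp (- of_real (pi\<^sup>2 / 6) / z)"
    by (simp add: exp_diff [symmetric])
  have "csqrt z \<noteq> 0" "of_real (sqrt (2 * pi)) \<noteq> (0::complex)" using z0 by simp_all
  then show ?thesis
    unfolding eval_partition_fps[OF n1] eval_partition_fps[OF n2] e
    by (intro solve[OF euler_fps_transform[OF z]] eval_euler_fps_nonzero n1 n2 exp_not_eq_zero)
qed

section \<open>The circle method\<close>

lemma has_integral_exp_int_circle: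
  fixes j :: int
  shows "((\<lambda>\<theta>. exp (\<i> * of_int j * of_real \<theta>)) has_integral (if j = 0 then of_real (2 * pi) else 0)) {- pi..pi}"
proof (cases "j = 0")
  case True
  have "((\<lambda>_. 1::complex) has_integral (pi - (- pi)) *\<^sub>R 1) {- pi..pi}"
    using has_integral_const_real[of "1::complex" "-pi" pi] by simp
  then show ?thesis using True by (simp add: scaleR_conv_of_real)
next
  case False
  have "((\<lambda>\<theta>. exp (\<i> * of_int j * of_real \<theta>)) has_integral
     (exp (\<i> * of_int j * of_real pi) / (\<i> * of_int j) - exp (\<i> * of_int j * of_real (- pi)) / (\<i> * of_int j))) {- pi..pi}"
    using False
    by (intro fundamental_theorem_of_calculus)
       (auto intro!: derivative_eq_intros has_vector_derivative_real_field)
  moreover have "exp (\<i> * of_int j * of_real pi) = exp (\<i> * of_int j * of_real (- pi))"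
    unfolding exp_eq by (intro exI[of _ j]) (simp add: algebra_simps)
  ultimately show ?thesis using False by simp
qed

text \<open>Cauchy's coefficient formula on the circle of radius \<open>exp (- r)\<close> in the
  coordinate \<open>q = exp (- z)\<close>, obtained by integrating the uniformly convergent series
  termwise.\<close>

lemma partition_integral:
  assumes r: "r > 0"
  defines "z \<equiv> \<lambda>\<theta>. of_real r + \<i> * of_real \<theta>"
  shows "((\<lambda>\<theta>. eval_fps partition_fps (exp (- z \<theta>)) * exp (of_nat n * z \<theta>)) has_integral
     of_real (2 * pi * real (num_partitions n))) {- pi..pi}"
proof -
  define u where "u k \<theta> = of_nat (num_partitions k) * exp (- z \<theta>) ^ k * exp (of_nat n * z \<theta>)" for k \<theta>
  have u_eq: "u k \<theta> = of_real (real (num_partitions k) * exp (- r) ^ k * exp (real n * r)) * exp (\<i> * of_int (int n - int k) * of_real \<theta>)" for k \<theta>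
  proof -
    have "exp (- z \<theta>) ^ k * exp (of_nat n * z \<theta>) = exp (of_nat k * (- z \<theta>) + of_nat n * z \<theta>)"
      by (simp only: exp_of_nat_mult exp_add)
    also have "of_nat k * (- z \<theta>) + of_nat n * z \<theta> = of_real (real k * (- r) + real n * r) + \<i> * of_int (int n - int k) * of_real \<theta>"
      by (simp add: z_def algebra_simps)
    also have "exp \<dots> = of_real (exp (- r) ^ k * exp (real n * r)) * exp (\<i> * of_int (int n - int k) * of_real \<theta>)"
      by (simp only: exp_add exp_of_real exp_of_nat_mult)
    finally show ?thesis by (simp add: u_def mult.assoc)
  qed
  have rad: "ereal (norm (of_real (exp (- r)) :: complex)) < fps_conv_radius partition_fps"
    using r by (intro less_le_trans[OF _ fps_conv_radius_partition_fps]) simp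
  have ul: "uniform_limit {- pi..pi} (\<lambda>m \<theta>. \<Sum>k<m. u k \<theta>) (\<lambda>\<theta>. \<Sum>k. u k \<theta>) sequentially"
  proof (rule Weierstrass_m_test)
    show "norm (u k \<theta>) \<le> real (num_partitions k) * exp (- r) ^ k * exp (real n * r)" for k \<theta>
      unfolding u_eq by (simp add: norm_mult norm_power)
    show "summable (\<lambda>k. real (num_partitions k) * exp (- r) ^ k * exp (real n * r))"
      using norm_summable_fps[OF rad] by (intro summable_mult2) (simp add: partition_fps_def norm_mult norm_power)
  qed
  have suminf_u: "(\<Sum>k. u k \<theta>) = eval_fps partition_fps (exp (- z \<theta>)) * exp (of_nat n * z \<theta>)" for \<theta>
  proof -
    have "ereal (norm (exp (- z \<theta>))) < fps_conv_radius partition_fps"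
      using r by (intro less_le_trans[OF _ fps_conv_radius_partition_fps]) (simp add: z_def)
    from suminf_mult2[OF summable_fps[OF this], of "exp (of_nat n * z \<theta>)"] show ?thesis
      by (simp add: u_def eval_fps_def partition_fps_def)
  qed
  obtain I J where IJ: "\<And>m. ((\<lambda>\<theta>. \<Sum>k<m. u k \<theta>) has_integral I m) {- pi..pi}"
      "((\<lambda>\<theta>. \<Sum>k. u k \<theta>) has_integral J) {- pi..pi}" "I \<longlonglongrightarrow> J"
    by (rule uniform_limit_integral[OF ul]) (auto simp: u_eq intro!: continuous_intros)
  have "I m = of_real (2 * pi * real (num_partitions n))" if "n < m" for m
  proof -
    have "((\<lambda>\<theta>. \<Sum>k<m. u k \<theta>) has_integral (\<Sum>k<m. of_real (real (num_partitions k) * exp (- r) ^ k * exp (real n * r)) *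
        (if int n - int k = 0 then of_real (2 * pi) else 0))) {- pi..pi}"
      unfolding u_eq by (intro has_integral_sum has_integral_mult_right has_integral_exp_int_circle) auto
    then have "I m = (\<Sum>k<m. of_real (real (num_partitions k) * exp (- r) ^ k * exp (real n * r)) *
        (if int n - int k = 0 then of_real (2 * pi) else 0))"
      by (intro has_integral_unique[OF IJ(1)])
    also have "\<dots> = (\<Sum>k<m. if k = n then of_real (2 * pi * real (num_partitions n)) else 0)"
    proof (intro sum.cong refl)
      have "exp (- r) ^ n * exp (real n * r) = 1"
        by (simp only: exp_of_nat_mult [symmetric] exp_add [symmetric]) simp
      then show "of_real (real (num_partitions k) * exp (- r) ^ k * exp (real n * r)) * (if int n - int k = 0 then of_real (2 * pi) else 0) =
        (if k = n then complex_of_real (2 * pi * real (num_partitions n)) else 0)" for k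
        by (cases "k = n") (simp only: mult.assoc, simp)+
    qed
    also have "\<dots> = of_real (2 * pi * real (num_partitions n))" using that by simp
    finally show ?thesis .
  qed
  then have "I \<longlonglongrightarrow> of_real (2 * pi * real (num_partitions n))"
    by (intro tendsto_eventually eventually_mono[OF eventually_gt_at_top[of n]])
  from LIMSEQ_unique[OF IJ(3) this] show ?thesis using IJ(2) by (simp add: suminf_u)
qed

text \<open>The transformed integrand with the dual factor replaced by 1 and the constant
  \<open>1 / sqrt (2 pi)\<close> left out. For \<open>N = n - 1/24\<close> the term
  \<open>- z / 24\<close> of the transformation is absorbed into \<open>N\<close>.\<close>

definition hr_kernel :: "real \<Rightarrow> complex \<Rightarrow> complex" where
  "hr_kernel N z = csqrt z * exp (of_real (pi\<^sup>2 / 6) / z + of_real N * z)"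

text \<open>Contour deformation is carried out with this primitive: the integrals over the vertical
  line, the arc and the connecting segments all become differences of its values.\<close>

lemma hr_kernel_primitive:
  obtains G where "\<And>z. Re z > 0 \<Longrightarrow> (G has_field_derivative hr_kernel N z) (at z)"
proof -
  have "open {z::complex. Re z > 0}" "convex {z::complex. Re z > 0}"
    by (rule open_halfspace_Re_gt, rule convex_halfspace_Re_gt)
  moreover have "hr_kernel N holomorphic_on {z. Re z > 0}"
    unfolding hr_kernel_def by (intro holomorphic_intros) (auto simp: complex_nonpos_Reals_iff)
  ultimately obtain G where "\<And>z. z \<in> {z. Re z > 0} \<Longrightarrow> (G has_field_derivative hr_kernel N z) (at z)"
    using holomorphic_convex_primitive' by (metis at_within_open)
  then show ?thesis using that by blast
qed

lemma Re_of_real_divide: "Re (of_real c / z) = c * Re z / (norm z)\<^sup>2"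
  by (simp add: Re_divide cmod_def)

lemma norm_hr_kernel:
  "norm (hr_kernel N z) = sqrt (norm z) * exp (pi\<^sup>2 / 6 * Re z / (norm z)\<^sup>2 + N * Re z)"
  unfolding hr_kernel_def norm_mult norm_exp_eq_Re plus_complex.sel Re_of_real_divide by simp

lemma hr_kernel_vertical_integral:
  assumes G: "\<And>z. Re z > 0 \<Longrightarrow> (G has_field_derivative hr_kernel N z) (at z)" and r: "r > 0" and d: "d \<ge> 0"
  shows "((\<lambda>\<theta>. hr_kernel N (of_real r + \<i> * of_real \<theta>)) has_integral
     ((G (of_real r + \<i> * of_real d) - G (of_real r - \<i> * of_real d)) / \<i>)) {- d..d}"
proof -
  have deriv: "((\<lambda>\<theta>. G (of_real r + \<i> * of_real \<theta>) / \<i>) has_vector_derivative hr_kernel N (of_real r + \<i> * of_real \<theta>)) (at \<theta> within {- d..d})" for \<theta>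
  proof -
    have eq: "hr_kernel N (of_real r + \<i> * of_real \<theta>) * \<i> / \<i> = hr_kernel N (of_real r + \<i> * of_real \<theta>)"
      by (rule nonzero_mult_div_cancel_right) simp
    have "((\<lambda>w. G (of_real r + \<i> * w) / \<i>) has_field_derivative (hr_kernel N (of_real r + \<i> * of_real \<theta>) * \<i> / \<i>)) (at (of_real \<theta>))"
      using r by (auto intro!: derivative_eq_intros DERIV_chain2[OF G])
    then show ?thesis unfolding eq by (rule has_vector_derivative_real_field)
  qed
  have "- d \<le> d" using d by simp
  from fundamental_theorem_of_calculus[OF this deriv] show ?thesis
    unfolding diff_divide_distrib by simp
qed

text \<open>The condition on \<open>N\<close> says that \<open>r\<close> is the saddle point of the
  exponent. On the circle \<open>|z| = r\<close> the two terms \<open>pi^2 / (6 z)\<close> and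
  \<open>N z\<close> are complex conjugates, so the exponent is real there.\<close>

lemma hr_kernel_arc:
  assumes r: "r > 0" and N: "N * r = pi\<^sup>2 / 6 / r" and \<phi>: "\<bar>\<phi>\<bar> < pi"
  shows "hr_kernel N (of_real r * exp (\<i> * of_real \<phi>)) =
    of_real (sqrt r * exp (2 * (N * r) * cos \<phi>)) * exp (\<i> * of_real (\<phi> / 2))"
proof -
  have root: "csqrt (of_real r * exp (\<i> * of_real \<phi>)) = of_real (sqrt r) * exp (\<i> * of_real (\<phi> / 2))"
  proof (rule csqrt_unique)
    show "(of_real (sqrt r) * exp (\<i> * of_real (\<phi> / 2)))\<^sup>2 = of_real r * exp (\<i> * of_real \<phi>)"
      using r by (simp add: power_mult_distrib exp_double [symmetric] flip: of_real_power)
    have "cos (\<phi> / 2) > 0" using \<phi> by (intro cos_gt_zero_pi) auto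
    then show "0 < Re (of_real (sqrt r) * exp (\<i> * of_real (\<phi> / 2))) \<or>
       Re (of_real (sqrt r) * exp (\<i> * of_real (\<phi> / 2))) = 0 \<and> 0 \<le> Im (of_real (sqrt r) * exp (\<i> * of_real (\<phi> / 2)))"
      using r by (simp add: Re_exp)
  qed
  have expo: "of_real (pi\<^sup>2 / 6) / (of_real r * exp (\<i> * of_real \<phi>)) + of_real N * (of_real r * exp (\<i> * of_real \<phi>)) =
      of_real (2 * (N * r) * cos \<phi>)"
  proof -
    have "of_real (pi\<^sup>2 / 6) / (of_real r * exp (\<i> * of_real \<phi>)) = of_real (pi\<^sup>2 / 6 / r) * exp (- (\<i> * of_real \<phi>))"
      by (simp add: exp_minus field_simps)
    then have "of_real (pi\<^sup>2 / 6) / (of_real r * exp (\<i> * of_real \<phi>)) + of_real N * (of_real r * exp (\<i> * of_real \<phi>)) =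
       of_real (N * r) * (exp (\<i> * of_real \<phi>) + exp (- (\<i> * of_real \<phi>)))"
      unfolding N [symmetric] by (simp add: algebra_simps)
    also have "\<dots> = of_real (N * r) * (2 * cos (of_real \<phi>))" by (simp add: cos_exp_eq)
    finally show ?thesis by (simp add: cos_of_real)
  qed
  show ?thesis unfolding hr_kernel_def root expo exp_of_real by (simp only: of_real_mult mult_ac)
qed

text \<open>The half angle from \<open>csqrt\<close> and the full angle from
  \<open>dz = i z d\<phi>\<close> combine into \<open>3 \<phi> / 2\<close>.\<close>

lemma hr_kernel_arc_integral:
  assumes G: "\<And>z. Re z > 0 \<Longrightarrow> (G has_field_derivative hr_kernel N z) (at z)"
    and r: "r > 0" and N: "N * r = pi\<^sup>2 / 6 / r"
  shows "((\<lambda>\<phi>. r * sqrt r * (exp (2 * (N * r) * cos \<phi>) * cos (3 * \<phi> / 2))) has_integral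
     Re ((G (of_real r * exp (\<i> * of_real (pi / 3))) - G (of_real r * exp (\<i> * of_real (- (pi / 3))))) / \<i>)) {- (pi/3)..pi/3}"
proof -
  have deriv: "((\<lambda>\<phi>. G (of_real r * exp (\<i> * of_real \<phi>)) / \<i>) has_vector_derivative
      of_real (r * sqrt r * exp (2 * (N * r) * cos \<phi>)) * exp (\<i> * of_real (3 * \<phi> / 2))) (at \<phi> within {- (pi/3)..pi/3})"
    if "\<phi> \<in> {- (pi/3)..pi/3}" for \<phi>
  proof -
    have "\<bar>\<phi>\<bar> \<le> pi / 3" using that by (auto simp: abs_le_iff)
    then have phi: "\<bar>\<phi>\<bar> < pi / 2" using pi_gt_zero by linarith
    then have "cos \<phi> > 0" by (intro cos_gt_zero_pi) auto
    then have Re_pos: "Re (of_real r * exp (\<i> * of_real \<phi>)) > 0" using r by (simp add: Re_exp)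
    have "exp (\<i> * of_real (3 * \<phi> / 2)) = exp (\<i> * of_real (\<phi> / 2)) * exp (\<i> * of_real \<phi>)"
      by (simp add: exp_add [symmetric] field_simps)
    moreover have "hr_kernel N (of_real r * exp (\<i> * of_real \<phi>)) =
      of_real (sqrt r * exp (2 * (N * r) * cos \<phi>)) * exp (\<i> * of_real (\<phi> / 2))"
      using phi by (intro hr_kernel_arc r N) simp
    ultimately have eq: "hr_kernel N (of_real r * exp (\<i> * of_real \<phi>)) * (of_real r * (exp (\<i> * of_real \<phi>) * \<i>)) / \<i> =
      of_real (r * sqrt r * exp (2 * (N * r) * cos \<phi>)) * exp (\<i> * of_real (3 * \<phi> / 2))"
      by (simp only: mult.assoc [symmetric] nonzero_mult_div_cancel_right[OF complex_i_not_zero]) (simp add: mult_ac)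
    have "((\<lambda>w. G (of_real r * exp (\<i> * w)) / \<i>) has_field_derivative
      (hr_kernel N (of_real r * exp (\<i> * of_real \<phi>)) * (of_real r * (exp (\<i> * of_real \<phi>) * \<i>)) / \<i>)) (at (of_real \<phi>))"
    proof -
      have "((\<lambda>w. of_real r * exp (\<i> * w)) has_field_derivative of_real r * (exp (\<i> * of_real \<phi>) * \<i>)) (at (of_real \<phi>))"
        by (auto intro!: derivative_eq_intros)
      then show ?thesis
        by (intro DERIV_cdivide DERIV_chain2[where f = G and g = "\<lambda>w. of_real r * exp (\<i> * w)"] G[OF Re_pos])
    qed
    then show ?thesis unfolding eq by (rule has_vector_derivative_real_field)
  qed
  have "- (pi/3) \<le> pi/3" by simp
  from fundamental_theorem_of_calculus[OF this deriv]
  have "((\<lambda>\<phi>. of_real (r * sqrt r * exp (2 * (N * r) * cos \<phi>)) * exp (\<i> * of_real (3 * \<phi> / 2))) has_integral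
     (G (of_real r * exp (\<i> * of_real (pi / 3))) - G (of_real r * exp (\<i> * of_real (- (pi / 3))))) / \<i>) {- (pi/3)..pi/3}"
    unfolding diff_divide_distrib .
  from has_integral_Re[OF this] show ?thesis by (simp add: Re_exp mult.assoc)
qed

text \<open>Substitute \<open>\<tau> = 2 sin (\<phi> / 2)\<close>. Then
  \<open>2 K cos \<phi> = 2 K - K \<tau>^2\<close>, and \<open>cos (3 \<phi> / 2)\<close> is
  \<open>1 - \<tau>^2\<close> times the derivative of \<open>\<tau>\<close>. The arc ends at
  \<open>\<plusminus> pi / 3\<close> so that \<open>\<tau>\<close> runs over
  \<open>[-1, 1]\<close>.\<close>

lemma arc_integral_eq_truncated_gaussian:
  "((\<lambda>\<phi>. exp (2 * K * cos \<phi>) * cos (3 * \<phi> / 2)) has_integral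
     exp (2 * K) * integral {-1..1} (\<lambda>\<tau>. (1 - \<tau>\<^sup>2) * exp (- K * \<tau>\<^sup>2))) {- (pi/3)..pi/3}"
proof -
  have sub: "((\<lambda>\<phi>. cos (\<phi> / 2) *\<^sub>R ((1 - (2 * sin (\<phi> / 2))\<^sup>2) * exp (- K * (2 * sin (\<phi> / 2))\<^sup>2))) has_integral
     integral {2 * sin (- (pi/3) / 2)..2 * sin (pi/3/2)} (\<lambda>\<tau>. (1 - \<tau>\<^sup>2) * exp (- K * \<tau>\<^sup>2))) {- (pi/3)..pi/3}"
  proof (rule has_integral_substitution)
    show "(\<lambda>\<phi>. 2 * sin (\<phi> / 2)) ` {- (pi/3)..pi/3} \<subseteq> {-2..2}"
    proof safe
      fix x :: real
      show "2 * sin (x / 2) \<in> {-2..2}" using sin_ge_minus_one[of "x/2"] sin_le_one[of "x/2"] by auto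
    qed
    show "2 * sin (- (pi/3) / 2) \<le> 2 * sin (pi/3/2)" by (simp add: sin_30)
  qed (auto intro!: continuous_intros derivative_eq_intros)
  have "cos (\<phi> / 2) *\<^sub>R ((1 - (2 * sin (\<phi> / 2))\<^sup>2) * exp (- K * (2 * sin (\<phi> / 2))\<^sup>2)) * exp (2 * K) =
     exp (2 * K * cos \<phi>) * cos (3 * \<phi> / 2)" for \<phi>
  proof -
    define c s where "c = cos (\<phi> / 2)" and "s = sin (\<phi> / 2)"
    have cs: "c\<^sup>2 = 1 - s\<^sup>2" by (simp add: c_def s_def cos_squared_eq)
    have "cos \<phi> = 1 - 2 * s\<^sup>2" using cos_double_sin[of "\<phi> / 2"] by (simp add: s_def)
    then have "2 * K * cos \<phi> = - K * (2 * s)\<^sup>2 + 2 * K"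
      by (simp only:) (simp add: power2_eq_square algebra_simps)
    then have "exp (2 * K * cos \<phi>) = exp (- K * (2 * s)\<^sup>2) * exp (2 * K)"
      by (simp only: exp_add)
    moreover have "cos (3 * \<phi> / 2) = c * (1 - (2 * s)\<^sup>2)"
    proof -
      have "cos (3 * \<phi> / 2) = 4 * c ^ 3 - 3 * c" using cos_treble_cos[of "\<phi> / 2"] by (simp add: c_def)
      also have "\<dots> = c * (4 * c\<^sup>2 - 3)" by (simp add: power3_eq_cube power2_eq_square algebra_simps)
      finally show ?thesis unfolding cs by (simp only:) (simp add: power2_eq_square algebra_simps)
    qed
    ultimately show ?thesis by (simp add: c_def s_def)
  qed
  with has_integral_mult_left[OF sub, of "exp (2 * K)"] show ?thesis by (simp add: sin_30 mult.commute)
qed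

text \<open>For \<open>|\<tau>| \<ge> 1\<close> the Gaussian is at most
  \<open>|\<tau>| exp (- K \<tau>^2)\<close>, which has an elementary primitive; each tail
  contributes at most \<open>exp (- K) / (2 K)\<close>.\<close>

lemma truncated_gaussian_bounds:
  assumes K: "K > 0"
  shows "\<bar>integral {-1..1} (\<lambda>\<tau>. exp (- K * \<tau>\<^sup>2)) - sqrt (pi / K)\<bar> \<le> exp (- K) / K"
proof -
  define f where "f = (\<lambda>\<tau>::real. exp (- K * \<tau>\<^sup>2))"
  have int_f: "f integrable_on {u..v}" for u v
    unfolding f_def by (intro integrable_continuous_real continuous_intros)
  have right: "0 \<le> integral {1..real M} f \<and> integral {1..real M} f \<le> exp (- K) / (2 * K)" if M: "M \<ge> 1" for M
  proof
    show "0 \<le> integral {1..real M} f" by (intro integral_nonneg int_f) (simp add: f_def)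
    have "((\<lambda>\<tau>. \<tau> * f \<tau>) has_integral (- f (real M) / (2 * K) - (- f 1 / (2 * K)))) {1..real M}"
      using M K unfolding f_def
      by (intro fundamental_theorem_of_calculus)
         (auto intro!: derivative_eq_intros simp flip: has_real_derivative_iff_has_vector_derivative)
    then have "integral {1..real M} f \<le> - f (real M) / (2 * K) - (- f 1 / (2 * K))"
      by (rule has_integral_le[OF integrable_integral[OF int_f]]) (auto simp: f_def)
    also have "\<dots> \<le> exp (- K) / (2 * K)" using K by (simp add: f_def)
    finally show "integral {1..real M} f \<le> exp (- K) / (2 * K)" .
  qed
  have left: "integral {- real M..-1} f = integral {1..real M} f" for M
    using Henstock_Kurzweil_Integration.integral_reflect_real[of "real M" 1 f] by (simp add: f_def)
  have "(\<lambda>M. integral {- real M..real M} f) \<longlonglongrightarrow> sqrt (pi / K)"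
    using gaussian_cos_integral_tendsto[OF K, of 0] by (simp add: f_def)
  moreover have "\<forall>\<^sub>F M in sequentially. integral {- real M..real M} f \<in> {integral {-1..1} f..integral {-1..1} f + exp (- K) / K}"
    using eventually_ge_at_top[of "1::nat"]
  proof eventually_elim
    case (elim M)
    have "integral {- real M..real M} f = integral {- real M..-1} f + integral {-1..real M} f"
      using elim by (intro Henstock_Kurzweil_Integration.integral_combine [symmetric] int_f) auto
    also have "integral {-1..real M} f = integral {-1..1} f + integral {1..real M} f"
      using elim by (intro Henstock_Kurzweil_Integration.integral_combine [symmetric] int_f) auto
    finally have "integral {- real M..real M} f = integral {-1..1} f + 2 * integral {1..real M} f"
      by (simp add: left)
    then show ?case using right[of M] elim by (simp add: field_simps)
  qed
  ultimately have "sqrt (pi / K) \<in> {integral {-1..1} f..integral {-1..1} f + exp (- K) / K}"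
    by (intro Lim_in_closed_set[OF closed_atLeastAtMost _ sequentially_bot]) auto
  then show ?thesis by (simp add: f_def abs_le_iff)
qed

text \<open>Integration by parts with \<open>\<tau> exp (- K \<tau>^2) / (2 K)\<close>. It yields
  the factor \<open>1 - 1 / (2 K)\<close> that becomes \<open>c s - 1\<close> in the final
  formula.\<close>

lemma truncated_gaussian_weighted:
  assumes K: "K > (0::real)"
  shows "integral {-1..1} (\<lambda>\<tau>. (1 - \<tau>\<^sup>2) * exp (- K * \<tau>\<^sup>2)) =
     (1 - 1 / (2 * K)) * integral {-1..1} (\<lambda>\<tau>. exp (- K * \<tau>\<^sup>2)) + exp (- K) / K"
proof -
  have 1: "((\<lambda>\<tau>. exp (- K * \<tau>\<^sup>2) / (2 * K) - \<tau>\<^sup>2 * exp (- K * \<tau>\<^sup>2)) has_integral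
     (1 * exp (- K * 1\<^sup>2) / (2 * K) - (-1) * exp (- K * (-1)\<^sup>2) / (2 * K))) {-1..1}"
    using K by (intro fundamental_theorem_of_calculus)
      (auto intro!: derivative_eq_intros simp: field_simps power2_eq_square simp flip: has_real_derivative_iff_has_vector_derivative)
  have 2: "((\<lambda>\<tau>. (1 - 1 / (2 * K)) * exp (- K * \<tau>\<^sup>2)) has_integral (1 - 1 / (2 * K)) * integral {-1..1} (\<lambda>\<tau>. exp (- K * \<tau>\<^sup>2))) {-1..1}"
    by (intro has_integral_mult_right integrable_integral integrable_continuous_real continuous_intros)
  have "((\<lambda>\<tau>. (1 - \<tau>\<^sup>2) * exp (- K * \<tau>\<^sup>2)) has_integral
    ((1 - 1 / (2 * K)) * integral {-1..1} (\<lambda>\<tau>. exp (- K * \<tau>\<^sup>2)) + exp (- K) / K)) {-1..1}"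
  proof -
    have "(1 - 1 / (2 * K)) * exp (- K * \<tau>\<^sup>2) + (exp (- K * \<tau>\<^sup>2) / (2 * K) - \<tau>\<^sup>2 * exp (- K * \<tau>\<^sup>2)) =
        (1 - \<tau>\<^sup>2) * exp (- K * \<tau>\<^sup>2)" for \<tau> by (simp add: algebra_simps)
    moreover have "1 * exp (- K * 1\<^sup>2) / (2 * K) - (-1) * exp (- K * (-1)\<^sup>2) / (2 * K) = exp (- K) / K" by simp
    ultimately show ?thesis using has_integral_add[OF 2 1] by (simp only:)
  qed
  then show ?thesis by (rule integral_unique)
qed

section \<open>Gain away from the positive axis\<close>

lemma two_exp_minus_one_le:
  assumes "r \<ge> (0::real)" shows "2 * (exp r - 1) \<le> r * (exp r + 1)"
proof -
  have "(\<lambda>r. r * (exp r + 1) - 2 * (exp r - 1)) 0 \<le> (\<lambda>r. r * (exp r + 1) - 2 * (exp r - 1)) r"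
  proof (rule DERIV_nonneg_imp_nondecreasing[OF assms])
    fix x :: real assume x: "0 \<le> x" "x \<le> r"
    have "1 - x \<le> exp (- x)" using exp_ge_add_one_self[of "-x"] by simp
    then have "exp x * (1 - x) \<le> 1"
      by (metis exp_gt_zero exp_minus_inverse mult_le_cancel_left_pos)
    then show "\<exists>y. ((\<lambda>r. r * (exp r + 1) - 2 * (exp r - 1)) has_real_derivative y) (at x) \<and> 0 \<le> y"
      by (intro exI[of _ "1 * (exp x + 1) + exp x * x - 2 * exp x"] conjI)
         (auto intro!: derivative_eq_intros simp: algebra_simps)
  qed
  then show ?thesis by simp
qed

text \<open>Uses \<open>1 - cos d = 2 sin^2 (d / 2)\<close>; on this range the cubic Taylor error
  costs at most 1/40 of \<open>d / 2\<close>. The bound 20/27 is what \<open>d = 20 r\<close> with r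
  \<le> 1/27 requires.\<close>

lemma one_minus_cos_ge:
  assumes "0 \<le> d" "d \<le> 20/27" "d \<le> \<bar>\<theta>\<bar>" "\<bar>\<theta>\<bar> \<le> pi"
  shows "19/40 * d\<^sup>2 \<le> 1 - cos \<theta>"
proof -
  have "\<bar>sin (d/2) - (\<Sum>m<3. sin_coeff m * (d/2) ^ m)\<bar> \<le> inverse (fact 3) * \<bar>d/2\<bar> ^ 3"
    by (rule Maclaurin_sin_bound)
  then have "\<bar>sin (d/2) - d/2\<bar> \<le> (d/2) ^ 3 / 6"
    using assms(1) by (simp add: sin_coeff_def eval_nat_numeral)
  moreover have "(d/2) ^ 3 / 6 \<le> d/2 * (1/40)"
  proof -
    have "d\<^sup>2 \<le> (20/27)\<^sup>2" using assms by (intro power_mono) auto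
    then have "d * d\<^sup>2 \<le> d * (20/27)\<^sup>2" using assms(1) by (rule mult_left_mono)
    then show ?thesis using assms(1) by (simp add: power3_eq_cube power2_eq_square)
  qed
  ultimately have "39/40 * (d/2) \<le> sin (d/2)" by linarith
  then have "(39/40 * (d/2))\<^sup>2 \<le> (sin (d/2))\<^sup>2" using assms(1) by (intro power_mono) auto
  moreover have "cos d = 1 - 2 * (sin (d/2))\<^sup>2" using cos_double_sin[of "d/2"] by simp
  moreover have "cos \<theta> \<le> cos d"
    using assms cos_monotone_0_pi_le[of d "\<bar>\<theta>\<bar>"] by simp
  moreover have "19/40 * d\<^sup>2 \<le> 2 * (39/40 * (d/2))\<^sup>2" by (simp add: power2_eq_square)
  ultimately show ?thesis by linarith
qed

text \<open>The difference factors as \<open>(R + 1) / (2 (R - 1))\<close>, which is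
  \<open>coth (r / 2) / 2\<close> and hence at least \<open>1 / r\<close>, times
  \<open>2 R v / Q\<close>, which is close to 1 because \<open>v\<close> is much larger than
  \<open>r^2\<close> on this range.\<close>

lemma minor_arc_gain:
  assumes r: "0 < r" "r \<le> 1/27" and \<theta>: "20 * r \<le> \<bar>\<theta>\<bar>" "\<bar>\<theta>\<bar> \<le> pi"
  defines "q \<equiv> exp (- (of_real r + \<i> * of_real \<theta>))"
  shows "99/100 / r \<le> norm q / (1 - norm q) - Re (q / (1 - q))"
proof -
  define R where "R = exp r"
  define v where "v = 1 - cos \<theta>"
  have R: "R > 1" using r by (simp add: R_def)
  \<comment> \<open>190 is 19/40 times 20^2.\<close>
  have v: "190 * r\<^sup>2 \<le> v"
    using one_minus_cos_ge[of "20 * r" \<theta>] r \<theta> by (simp add: v_def power_mult_distrib)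
  have "r\<^sup>2 > 0" using r by simp
  then have v_pos: "v > 0" using v by linarith
  \<comment> \<open>This is the squared modulus of \<open>exp (r + i \<theta>) - 1\<close>.\<close>
  define Q where "Q = (R - 1)\<^sup>2 + 2 * R * v"
  have Q_pos: "Q > 0" using R v_pos by (simp add: Q_def add_pos_pos)
  have norm_q: "norm q / (1 - norm q) = 1 / (R - 1)"
    using R by (simp add: q_def R_def exp_minus field_simps)
  have "q / (1 - q) = 1 / (exp (of_real r + \<i> * of_real \<theta>) - 1)"
  proof -
    have "exp (of_real r + \<i> * of_real \<theta>) \<noteq> 1"
    proof
      assume "exp (of_real r + \<i> * of_real \<theta>) = 1"
      then have "norm (exp (of_real r + \<i> * of_real \<theta>)) = 1" by simp
      then show False using r by simp
    qed
    then show ?thesis unfolding q_def exp_minus by (simp add: field_simps)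
  qed
  also have "Re \<dots> = (R * cos \<theta> - 1) / Q"
  proof -
    define w where "w = exp (of_real r + \<i> * of_real \<theta>) - 1"
    have Re_w: "Re w = R * cos \<theta> - 1" and Im_w: "Im w = R * sin \<theta>"
      by (simp_all add: w_def R_def Re_exp Im_exp)
    have "(Re w)\<^sup>2 + (Im w)\<^sup>2 = R\<^sup>2 * ((cos \<theta>)\<^sup>2 + (sin \<theta>)\<^sup>2) - 2 * R * cos \<theta> + 1"
      unfolding Re_w Im_w
      by (simp add: power2_diff power_mult_distrib distrib_left del: sin_cos_squared_add sin_cos_squared_add2)
    then have "(Re w)\<^sup>2 + (Im w)\<^sup>2 = Q"
      unfolding sin_cos_squared_add2 by (simp add: Q_def v_def power2_eq_square algebra_simps)
    then show ?thesis unfolding w_def [symmetric] by (simp add: Re_divide Re_w)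
  qed
  finally have "norm q / (1 - norm q) - Re (q / (1 - q)) = 1 / (R - 1) - (R * cos \<theta> - 1) / Q"
    unfolding norm_q by simp
  also have "\<dots> = (Q - (R * cos \<theta> - 1) * (R - 1)) / ((R - 1) * Q)"
    using R Q_pos by (simp add: field_simps)
  also have "Q - (R * cos \<theta> - 1) * (R - 1) = R * (R + 1) * v"
    by (simp add: Q_def v_def power2_eq_square algebra_simps)
  also have "R * (R + 1) * v / ((R - 1) * Q) = (R + 1) / (2 * (R - 1)) * (2 * R * v / Q)"
    using R Q_pos by (simp add: field_simps)
  also have "\<dots> \<ge> 1 / r * (99/100)"
  proof (rule mult_mono)
    show "1 / r \<le> (R + 1) / (2 * (R - 1))"
      using two_exp_minus_one_le[of r] r R by (simp add: R_def field_simps)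
    have "R - 1 \<le> r * R"
    proof -
      have "1 - r \<le> exp (- r)" using exp_ge_add_one_self[of "-r"] by simp
      then have "R * (1 - r) \<le> R * exp (- r)" using R by (intro mult_left_mono) auto
      also have "R * exp (- r) = 1" by (simp add: R_def exp_minus_inverse)
      finally show ?thesis by (simp add: algebra_simps)
    qed
    then have "(R - 1)\<^sup>2 \<le> (r * R)\<^sup>2" using R by (intro power_mono) auto
    also have "\<dots> = R * (R * r\<^sup>2)" by (simp add: power2_eq_square)
    also have "\<dots> \<le> R * (2 * r\<^sup>2)"
    proof -
      have "R \<le> exp (1/2)" using r by (simp add: R_def)
      also have "\<dots> \<le> 2" using exp_bound_half[of "1/2 :: real"] by simp
      finally show ?thesis using R by (intro mult_left_mono mult_right_mono) auto
    qed
    also have "\<dots> \<le> R * (v / 95)" using v R by (intro mult_left_mono) auto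
    finally have "(R - 1)\<^sup>2 \<le> R * v / 95" by simp
    moreover have "0 < R * v" using R v_pos by simp
    ultimately have "99 * (R - 1)\<^sup>2 \<le> 2 * R * v" by linarith
    then show "99/100 \<le> 2 * R * v / Q"
      using Q_pos by (simp add: pos_le_divide_eq) (simp add: Q_def)
  qed (use r R in auto)
  finally show ?thesis by simp
qed

lemma num_partitions_0: "num_partitions 0 = 1"
proof -
  have "partitions 0 = {[]}" using bounded_partitions_eq[of 0 0] by (simp add: bounded_partitions_0)
  then show ?thesis by (simp add: num_partitions_def)
qed

text \<open>With \<open>p(0) = 1\<close> and one factor \<open>Q\<close> split off, the series is
  dominated by its value at \<open>exp (- 1)\<close>. That value is at most
  \<open>exp (pi^2 / 6)\<close> by the bound on Euler's product at \<open>y = 1\<close>, and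
  \<open>exp (1 + pi^2 / 6) \<le> 16\<close>.\<close>

lemma norm_partition_fps_minus_one_le:
  assumes "norm Q \<le> exp (- 1)"
  shows "norm (eval_fps partition_fps Q - 1) \<le> 16 * norm Q"
proof -
  have rad: "ereal (norm w) < fps_conv_radius partition_fps" if "norm w \<le> exp (- 1)" for w :: complex
  proof -
    have "norm w < 1" using that by (rule le_less_trans) simp
    then show ?thesis by (intro less_le_trans[OF _ fps_conv_radius_partition_fps]) simp
  qed
  define \<rho> where "\<rho> = exp (- 1 :: real)"
  have norm_\<rho>: "norm (of_real \<rho> :: complex) \<le> exp (- 1)" by (simp add: \<rho>_def)
  have s1: "summable (\<lambda>k. real (num_partitions (Suc k)) * \<rho> ^ Suc k)"
    using norm_summable_fps[OF rad[OF norm_\<rho>]]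
    by (subst summable_Suc_iff) (simp add: partition_fps_def norm_mult norm_power \<rho>_def)
  have s0: "summable (\<lambda>k. real (num_partitions k) * \<rho> ^ k)" using s1 by (subst (asm) summable_Suc_iff)
  have "(\<Sum>k. real (num_partitions (Suc k)) * \<rho> ^ Suc k) \<le> (\<Sum>k. real (num_partitions k) * \<rho> ^ k)"
    using suminf_split_head[OF s0] by (simp add: num_partitions_0)
  also have "\<dots> \<le> exp (pi\<^sup>2 / 6)"
  proof -
    have "of_real (\<Sum>k. real (num_partitions k) * \<rho> ^ k) = eval_fps partition_fps (of_real \<rho>)"
      unfolding eval_fps_def by (subst suminf_of_real[OF s0]) (simp add: partition_fps_def)
    also have "\<dots> = inverse (eval_fps euler_fps (of_real \<rho>))"
      by (rule eval_partition_fps) (simp add: \<rho>_def)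
    finally have "norm (of_real (\<Sum>k. real (num_partitions k) * \<rho> ^ k) :: complex) = inverse (norm (eval_fps euler_fps (of_real \<rho>)))"
      by (simp add: norm_inverse)
    also have "\<dots> \<le> inverse (exp (- (pi\<^sup>2 / 6)))"
      using norm_euler_fps_real_ge[of 1] by (intro le_imp_inverse_le) (auto simp: \<rho>_def)
    finally show ?thesis by (simp add: exp_minus)
  qed
  finally have tail: "(\<Sum>k. real (num_partitions (Suc k)) * \<rho> ^ Suc k) \<le> exp (pi\<^sup>2 / 6)" .
  have sQ: "(\<lambda>k. of_nat (num_partitions k) * Q ^ k) sums eval_fps partition_fps Q"
    using sums_eval_fps[OF rad[OF assms]] by (simp add: partition_fps_def)
  then have "(\<lambda>k. of_nat (num_partitions (Suc k)) * Q ^ Suc k) sums (eval_fps partition_fps Q - 1)"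
    by (subst sums_Suc_iff) (simp add: num_partitions_0)
  moreover have "(\<lambda>k. norm Q / \<rho> * (real (num_partitions (Suc k)) * \<rho> ^ Suc k)) sums
      (norm Q / \<rho> * (\<Sum>k. real (num_partitions (Suc k)) * \<rho> ^ Suc k))"
    by (intro sums_mult summable_sums s1)
  ultimately have "norm (eval_fps partition_fps Q - 1) \<le> norm Q / \<rho> * (\<Sum>k. real (num_partitions (Suc k)) * \<rho> ^ Suc k)"
  proof (rule norm_sums_le)
    fix k
    have "norm Q ^ k \<le> \<rho> ^ k" using assms by (intro power_mono) (auto simp: \<rho>_def)
    then have "real (num_partitions (Suc k)) * (norm Q * norm Q ^ k) \<le> real (num_partitions (Suc k)) * (norm Q * \<rho> ^ k)"
      by (intro mult_left_mono) auto
    then show "norm (of_nat (num_partitions (Suc k)) * Q ^ Suc k) \<le> norm Q / \<rho> * (real (num_partitions (Suc k)) * \<rho> ^ Suc k)"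
      by (simp add: norm_mult norm_power \<rho>_def mult_ac)
  qed
  also have "\<dots> \<le> norm Q / \<rho> * exp (pi\<^sup>2 / 6)"
    by (intro mult_left_mono tail) (simp add: \<rho>_def)
  also have "\<dots> = norm Q * exp (1 + pi\<^sup>2 / 6)" unfolding exp_add by (simp add: \<rho>_def exp_minus field_simps)
  also have "\<dots> \<le> norm Q * 16"
  proof (intro mult_left_mono)
    have "pi\<^sup>2 \<le> (3.142)\<^sup>2" using pi_approx by (intro power_mono) auto
    then have "exp (1 + pi\<^sup>2 / 6) \<le> exp (1 + 1 + 2/3)" by (simp add: power2_eq_square)
    also have "\<dots> = exp 1 * exp 1 * exp (2/3)" by (simp only: exp_add)
    also have "\<dots> \<le> 272/100 * (272/100) * (1 + 2/3 + (2/3)\<^sup>2)"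
      using e_less_272 by (intro mult_mono exp_bound) auto
    also have "\<dots> \<le> 16" by (simp add: power2_eq_square)
    finally show "exp (1 + pi\<^sup>2 / 6) \<le> 16" .
  qed simp
  finally show ?thesis by (simp add: mult.commute)
qed

section \<open>Estimates along the vertical line\<close>

lemma sqrt_two_pi_bounds: "5/2 \<le> sqrt (2 * pi)" "sqrt (2 * pi) \<le> 251/100"
proof -
  show "5/2 \<le> sqrt (2 * pi)"
    by (rule real_le_rsqrt) (use pi_approx in \<open>simp add: power2_eq_square\<close>)
  show "sqrt (2 * pi) \<le> 251/100"
    by (rule real_le_lsqrt) (use pi_approx in \<open>auto simp: power2_eq_square\<close>)
qed

lemma pi_squared_bounds: "9869/1000 \<le> pi\<^sup>2" "pi\<^sup>2 \<le> 987/100"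
proof -
  have "(3.1415)\<^sup>2 \<le> pi\<^sup>2" "pi\<^sup>2 \<le> (3.1416)\<^sup>2"
    using pi_approx by (auto intro!: power_mono)
  then show "9869/1000 \<le> pi\<^sup>2" "pi\<^sup>2 \<le> 987/100" by (simp_all add: power2_eq_square)
qed

lemma norm_has_integral_le:
  fixes f :: "real \<Rightarrow> 'a::real_normed_vector"
  assumes "0 \<le> B" "(f has_integral i) {a..b}" "a \<le> b" "\<And>x. x \<in> {a..b} \<Longrightarrow> norm (f x) \<le> B"
  shows "norm i \<le> B * (b - a)"
proof -
  have "norm i \<le> B * Henstock_Kurzweil_Integration.content (cbox a b)"
    by (rule has_integral_bound[OF assms(1)]) (use assms in \<open>simp_all only: interval_cbox\<close>)
  also have "Henstock_Kurzweil_Integration.content (cbox a b) = b - a" using assms(3) by simp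
  finally show ?thesis .
qed

text \<open>Here \<open>r\<close> is the saddle point: \<open>N * r\<close> and
  \<open>pi^2 / (6 r)\<close> share the value \<open>K\<close>, and the kernel has exponent
  \<open>2 K\<close> at \<open>r\<close>.\<close>

context
  fixes n :: nat and r N K :: real
  assumes r: "0 < r" "r \<le> 1/27" and N: "N = real n - 1/24" and NrK: "N * r = K" and K: "K = pi\<^sup>2 / 6 / r"
begin

abbreviation (input) zline :: "real \<Rightarrow> complex" where "zline \<theta> \<equiv> of_real r + \<i> * of_real \<theta>"

abbreviation (input) integrand :: "real \<Rightarrow> complex" where
  "integrand \<theta> \<equiv> eval_fps partition_fps (exp (- zline \<theta>)) * exp (of_nat n * zline \<theta>)"

lemma K_ge: "44 \<le> K"
proof -
  have "44 * r \<le> 44 * (1/27)" using r by simp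
  also have "\<dots> \<le> pi\<^sup>2 / 6" using pi_squared_bounds by simp
  finally show ?thesis using r unfolding K by (simp add: field_simps)
qed

lemma integrand_eq:
  "integrand \<theta> = hr_kernel N (zline \<theta>) / of_real (sqrt (2 * pi)) * eval_fps partition_fps (exp (- of_real (4 * pi\<^sup>2) / zline \<theta>))"
proof -
  have "exp (of_real (pi\<^sup>2 / 6) / zline \<theta> - zline \<theta> / 24) * exp (of_nat n * zline \<theta>) =
      exp (of_real (pi\<^sup>2 / 6) / zline \<theta> + of_real N * zline \<theta>)"
    unfolding exp_add [symmetric] N by (rule arg_cong[where f = exp]) (simp add: algebra_simps)
  then show ?thesis
    using r by (subst partition_fps_transform) (auto simp: hr_kernel_def mult_ac)
qed

text \<open>The argument \<open>exp (- 4 pi^2 / r)\<close> of the dual factor is tiny, so this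
  factor is within two percent of 1.\<close>

lemma norm_integrand_real_le: "norm (integrand 0) \<le> 102/100 * sqrt r / sqrt (2 * pi) * exp (2 * K)"
proof -
  have Q_le: "exp (- (4 * pi\<^sup>2 / r)) \<le> 1/1000"
  proof -
    have "39 * 27 \<le> 4 * pi\<^sup>2 * 27" using pi_squared_bounds by simp
    also have "\<dots> \<le> 4 * pi\<^sup>2 * (1 / r)" using r by (intro mult_left_mono) (auto simp: field_simps)
    finally have "1000 \<le> 4 * pi\<^sup>2 / r" by simp
    also have "\<dots> \<le> exp (4 * pi\<^sup>2 / r)" using exp_ge_add_one_self[of "4 * pi\<^sup>2 / r"] by linarith
    finally show ?thesis by (simp add: exp_minus field_simps)
  qed
  have Q_eq: "exp (- of_real (4 * pi\<^sup>2) / of_real r) = (of_real (exp (- (4 * pi\<^sup>2 / r))) :: complex)"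
    by (simp add: exp_of_real [symmetric])
  have "norm (eval_fps partition_fps (of_real (exp (- (4 * pi\<^sup>2 / r)))) - 1) \<le> 16 * norm (of_real (exp (- (4 * pi\<^sup>2 / r))) :: complex)"
  proof (rule norm_partition_fps_minus_one_le)
    have "1/1000 \<le> exp (- 1 :: real)" using exp_le by (simp add: exp_minus field_simps)
    then show "norm (of_real (exp (- (4 * pi\<^sup>2 / r))) :: complex) \<le> exp (- 1)"
      using Q_le unfolding norm_of_real abs_exp_cancel by linarith
  qed
  then have F_le: "norm (eval_fps partition_fps (of_real (exp (- (4 * pi\<^sup>2 / r))))) \<le> 102/100"
    using Q_le norm_triangle_ineq[of "eval_fps partition_fps (of_real (exp (- (4 * pi\<^sup>2 / r)))) - 1" 1] by simp
  have "norm (hr_kernel N (of_real r)) = sqrt r * exp (2 * K)"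
    unfolding norm_hr_kernel using r NrK K by (simp add: power2_eq_square field_simps)
  then have "norm (integrand 0) = sqrt r * exp (2 * K) / sqrt (2 * pi) * norm (eval_fps partition_fps (of_real (exp (- (4 * pi\<^sup>2 / r)))))"
    unfolding integrand_eq using Q_eq by (simp add: norm_mult norm_divide)
  also have "\<dots> \<le> sqrt r * exp (2 * K) / sqrt (2 * pi) * (102/100)"
    using r by (intro mult_left_mono F_le) auto
  finally show ?thesis by (simp add: mult_ac)
qed

text \<open>\<open>norm_euler_fps_ge\<close> bounds the generating function at \<open>q\<close> by
  its value at \<open>|q|\<close>, so the estimate at \<open>\<theta> = 0\<close> improves by the
  gain of \<open>minor_arc_gain\<close>.\<close>

lemma norm_integrand_minor_le:
  assumes "20 * r \<le> \<bar>\<theta>\<bar>" "\<bar>\<theta>\<bar> \<le> pi"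
  shows "norm (integrand \<theta>) \<le> 102/100 * sqrt r / sqrt (2 * pi) * exp (2 * K) * exp (- (99/100 / r))"
proof -
  define q where "q = exp (- zline \<theta>)"
  have norm_q: "norm q = exp (- r)" by (simp add: q_def)
  have q_lt: "norm q < 1" using r by (simp add: norm_q)
  define e where "e = norm (eval_fps euler_fps (of_real (exp (- r))))"
  have e_pos: "e > 0" using eval_euler_fps_nonzero[of "of_real (exp (- r))"] r by (simp add: e_def)
  have "e * exp (99/100 / r) \<le> e * exp (norm q / (1 - norm q) - Re (q / (1 - q)))"
    using minor_arc_gain[OF r assms] e_pos by (intro mult_left_mono) (auto simp: q_def)
  also have "\<dots> \<le> norm (eval_fps euler_fps q)"
    using norm_euler_fps_ge[OF q_lt] unfolding norm_q e_def .
  finally have "inverse (norm (eval_fps euler_fps q)) \<le> inverse (e * exp (99/100 / r))"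
    using e_pos by (intro le_imp_inverse_le mult_pos_pos) auto
  then have "norm (eval_fps partition_fps q) \<le> inverse (e * exp (99/100 / r))"
    by (simp only: eval_partition_fps[OF q_lt] norm_inverse)
  also have "\<dots> = norm (eval_fps partition_fps (of_real (exp (- r)))) * exp (- (99/100 / r))"
  proof -
    have "norm (eval_fps partition_fps (of_real (exp (- r)))) = inverse e"
      unfolding e_def using r by (subst eval_partition_fps) (simp_all add: norm_inverse)
    then show ?thesis by (simp only: inverse_mult_distrib exp_minus[of "99/100 / r"])
  qed
  finally have "norm (integrand \<theta>) \<le> norm (eval_fps partition_fps (of_real (exp (- r)))) * exp (- (99/100 / r)) * exp (real n * r)"
    by (simp add: norm_mult q_def)
  also have "\<dots> = norm (integrand 0) * exp (- (99/100 / r))"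
    by (simp add: norm_mult exp_of_real [symmetric])
  also have "\<dots> \<le> 102/100 * sqrt r / sqrt (2 * pi) * exp (2 * K) * exp (- (99/100 / r))"
    by (intro mult_right_mono norm_integrand_real_le) simp
  finally show ?thesis .
qed

text \<open>401 is 1 + 20^2. The second bound keeps the argument of the dual factor below
  \<open>exp (- 1)\<close>, as \<open>norm_partition_fps_minus_one_le\<close> requires.\<close>

lemma zline_bounds:
  assumes "\<bar>\<theta>\<bar> \<le> 20 * r"
  shows "norm (zline \<theta>) \<le> 1" "4 * pi\<^sup>2 * r / (norm (zline \<theta>))\<^sup>2 \<ge> 1"
proof -
  have "\<theta>\<^sup>2 \<le> (20 * r)\<^sup>2" using assms by (metis abs_ge_zero power2_abs power_mono)
  then have sq: "(norm (zline \<theta>))\<^sup>2 \<le> 401 * r\<^sup>2" by (simp add: cmod_power2 power_mult_distrib)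
  have "r\<^sup>2 \<le> (1/27)\<^sup>2" using r by (intro power_mono) auto
  then have "(norm (zline \<theta>))\<^sup>2 \<le> 1\<^sup>2" using sq by (simp add: power2_eq_square)
  then show "norm (zline \<theta>) \<le> 1" by (rule power2_le_imp_le) simp
  have "401 * r * r \<le> 4 * pi\<^sup>2 * r" using r pi_squared_bounds by (intro mult_right_mono) auto
  moreover have "norm (zline \<theta>) \<noteq> 0" using r by (auto simp: complex_eq_iff)
  ultimately show "4 * pi\<^sup>2 * r / (norm (zline \<theta>))\<^sup>2 \<ge> 1"
    using sq by (simp add: pos_le_divide_eq power2_eq_square)
qed

text \<open>With \<open>s = Re z / |z|^2\<close>, replacing the dual factor by 1 costs at most
  \<open>16 exp (- 4 pi^2 s)\<close>. This outweighs the growth \<open>exp (pi^2 s / 6)\<close> of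
  the kernel, so only \<open>exp K\<close> is left.\<close>

lemma norm_integrand_major_error_le:
  assumes "\<bar>\<theta>\<bar> \<le> 20 * r"
  shows "norm (integrand \<theta> - hr_kernel N (zline \<theta>) / of_real (sqrt (2 * pi))) \<le> 16 / sqrt (2 * pi) * exp K"
proof -
  define Q where "Q = exp (- of_real (4 * pi\<^sup>2) / zline \<theta>)"
  define s where "s = r / (norm (zline \<theta>))\<^sup>2"
  have s: "0 \<le> s" using r by (simp add: s_def)
  have "Re (- of_real (4 * pi\<^sup>2) / zline \<theta>) = - (4 * pi\<^sup>2 * r / (norm (zline \<theta>))\<^sup>2)"
    using Re_of_real_divide[of "- (4 * pi\<^sup>2)" "zline \<theta>"] by simp
  then have norm_Q: "norm Q = exp (- (4 * pi\<^sup>2 * s))" by (simp add: Q_def s_def)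
  have "norm Q \<le> exp (- 1)" unfolding norm_Q using zline_bounds(2)[OF assms] by (simp add: s_def)
  then have E: "norm (eval_fps partition_fps Q - 1) \<le> 16 * norm Q" by (rule norm_partition_fps_minus_one_le)
  have "norm (hr_kernel N (zline \<theta>)) = sqrt (norm (zline \<theta>)) * exp (pi\<^sup>2 / 6 * s + K)"
    unfolding norm_hr_kernel by (simp add: s_def NrK)
  also have "\<dots> \<le> 1 * exp (pi\<^sup>2 / 6 * s + K)" using zline_bounds(1)[OF assms] by (intro mult_right_mono) auto
  finally have g: "norm (hr_kernel N (zline \<theta>)) \<le> exp (pi\<^sup>2 / 6 * s + K)" by simp
  have "integrand \<theta> - hr_kernel N (zline \<theta>) / of_real (sqrt (2 * pi)) =
     hr_kernel N (zline \<theta>) / of_real (sqrt (2 * pi)) * (eval_fps partition_fps Q - 1)"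
    unfolding integrand_eq Q_def by (simp add: algebra_simps)
  then have "norm (integrand \<theta> - hr_kernel N (zline \<theta>) / of_real (sqrt (2 * pi))) =
     norm (hr_kernel N (zline \<theta>)) * norm (eval_fps partition_fps Q - 1) / sqrt (2 * pi)"
    by (simp add: norm_mult norm_divide)
  also have "\<dots> \<le> exp (pi\<^sup>2 / 6 * s + K) * (16 * norm Q) / sqrt (2 * pi)"
    by (intro divide_right_mono mult_mono g E) auto
  also have "exp (pi\<^sup>2 / 6 * s + K) * (16 * norm Q) = 16 * exp (pi\<^sup>2 / 6 * s + K - 4 * pi\<^sup>2 * s)"
    unfolding norm_Q by (simp add: exp_add [symmetric] exp_diff exp_minus field_simps)
  also have "\<dots> \<le> 16 * exp K" using s by simp
  finally show ?thesis by (simp add: divide_right_mono)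
qed

text \<open>The segment connects an end of the arc, at angle \<open>\<plusminus> pi / 3\<close>,
  with an end \<open>r \<plusminus> 20 i r\<close> of the major part of the line. At
  \<open>z = r (x \<plusminus> i y)\<close> the kernel has exponent
  \<open>K (x / (x^2 + y^2) + x)\<close>, well below \<open>2 K\<close>.\<close>

lemma hr_kernel_segment_le:
  assumes "\<epsilon> = 1 \<or> \<epsilon> = -1"
    and z: "z \<in> closed_segment (of_real r * Complex (1/2) (\<epsilon> * sqrt 3 / 2)) (of_real r * Complex 1 (\<epsilon> * 20))"
  shows "norm (hr_kernel N z) \<le> exp (13/10 * K)" "Re z > 0"
proof -
  obtain u where u: "0 \<le> u" "u \<le> 1"
    and z_eq: "z = (1 - u) *\<^sub>R (of_real r * Complex (1/2) (\<epsilon> * sqrt 3 / 2)) + u *\<^sub>R (of_real r * Complex 1 (\<epsilon> * 20))"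
    using z unfolding closed_segment_def by blast
  define x y where "x = (1 + u) / 2" and "y = (1 - u) * (sqrt 3 / 2) + u * 20"
  have Re_z: "Re z = r * x" and Im_z: "Im z = \<epsilon> * (r * y)"
    by (simp_all add: z_eq x_def y_def field_simps)
  have x: "1/2 \<le> x" "x \<le> 1" using u by (auto simp: x_def)
  have s3: "(sqrt 3 / 2)\<^sup>2 = 3/4" "sqrt 3 / 2 \<ge> 0" by (simp_all add: power_divide)
  have s3': "sqrt 3 / 2 \<le> 1" using real_sqrt_le_mono[of 3 4] by simp
  have y: "sqrt 3 / 2 \<le> y" "y \<le> 20" "20 * u \<le> y"
  proof -
    have "0 \<le> u * (20 - sqrt 3 / 2)" using u s3' by (intro mult_nonneg_nonneg) auto
    have "(1 - u) * t + u * 20 - t = u * (20 - t)" for t :: real by (simp add: algebra_simps)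
    then have "y - sqrt 3 / 2 = u * (20 - sqrt 3 / 2)" unfolding y_def .
    with \<open>0 \<le> u * (20 - sqrt 3 / 2)\<close> show "sqrt 3 / 2 \<le> y" by linarith
    have "0 \<le> (1 - u) * (20 - sqrt 3 / 2)" using u s3' by (intro mult_nonneg_nonneg) auto
    have "20 - ((1 - u) * t + u * 20) = (1 - u) * (20 - t)" for t :: real by (simp add: algebra_simps)
    then have "20 - y = (1 - u) * (20 - sqrt 3 / 2)" unfolding y_def .
    with \<open>0 \<le> (1 - u) * (20 - sqrt 3 / 2)\<close> show "y \<le> 20" by linarith
    show "20 * u \<le> y" using u by (simp add: y_def)
  qed
  have norm_sq: "(norm z)\<^sup>2 = r\<^sup>2 * (x\<^sup>2 + y\<^sup>2)"
    unfolding cmod_power2 Re_z Im_z using assms(1) by (auto simp: power2_eq_square algebra_simps)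
  show Re_pos: "Re z > 0" using r x by (simp add: Re_z)
  have "(sqrt 3 / 2)\<^sup>2 \<le> y\<^sup>2" using y s3 by (intro power_mono) auto
  moreover have "(1/2)\<^sup>2 \<le> x\<^sup>2" using x by (intro power_mono) auto
  ultimately have ge1: "1 \<le> x\<^sup>2 + y\<^sup>2" by (simp add: s3 power2_eq_square)
  have expo: "x / (x\<^sup>2 + y\<^sup>2) + x \<le> 13/10"
  \<comment> \<open>Near the arc \<open>x \<le> 13/20\<close> and \<open>x^2 + y^2 \<ge> 1\<close>;
    farther out the height \<open>y \<ge> 6\<close> makes the fraction at most 1/10.\<close>
  proof (cases "u \<le> 3/10")
    case True
    have "x / (x\<^sup>2 + y\<^sup>2) \<le> x / 1" using ge1 x by (intro divide_left_mono) auto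
    then have "x / (x\<^sup>2 + y\<^sup>2) \<le> x" by simp
    moreover have "x \<le> 13/20" using True by (simp add: x_def)
    ultimately show ?thesis by linarith
  next
    case False
    then have "6 \<le> y" using y by simp
    then have "6\<^sup>2 \<le> y\<^sup>2" by (intro power_mono) auto
    then have "36 \<le> y\<^sup>2" by simp
    then have "10 \<le> x\<^sup>2 + y\<^sup>2" using zero_le_power2[of x] by linarith
    then have "x / (x\<^sup>2 + y\<^sup>2) \<le> 1 / 10" using x by (intro frac_le) auto
    then show ?thesis using x by simp
  qed
  have "x\<^sup>2 \<le> 1\<^sup>2" by (rule power_mono) (use x in auto)
  moreover have "y\<^sup>2 \<le> 20\<^sup>2" by (rule power_mono) (use y s3 in linarith)+
  ultimately have "x\<^sup>2 + y\<^sup>2 \<le> 401" by simp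
  then have "(norm z)\<^sup>2 \<le> r\<^sup>2 * 401" unfolding norm_sq by (intro mult_left_mono) auto
  also have "\<dots> \<le> (1/27)\<^sup>2 * 401" using r by (intro mult_right_mono power_mono) auto
  finally have "(norm z)\<^sup>2 \<le> 1\<^sup>2" by (simp add: power2_eq_square)
  then have norm_le: "norm z \<le> 1" by (rule power2_le_imp_le) simp
  have "pi\<^sup>2 / 6 * Re z / (norm z)\<^sup>2 + N * Re z = K * (x / (x\<^sup>2 + y\<^sup>2) + x)"
  proof -
    have "pi\<^sup>2 / 6 * Re z / (norm z)\<^sup>2 = K * (x / (x\<^sup>2 + y\<^sup>2))"
      unfolding norm_sq Re_z K using r by (simp add: power2_eq_square)
    moreover have "N * Re z = K * x" by (simp add: Re_z NrK [symmetric])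
    ultimately show ?thesis by (simp add: algebra_simps)
  qed
  then have "norm (hr_kernel N z) = sqrt (norm z) * exp (K * (x / (x\<^sup>2 + y\<^sup>2) + x))"
    unfolding norm_hr_kernel by simp
  also have "\<dots> \<le> 1 * exp (K * (13/10))"
    using norm_le expo K_ge by (intro mult_mono) auto
  finally show "norm (hr_kernel N z) \<le> exp (13/10 * K)" by (simp add: mult.commute)
qed

lemma hr_kernel_primitive_segment_le:
  assumes G: "\<And>z. Re z > 0 \<Longrightarrow> (G has_field_derivative hr_kernel N z) (at z)" and "\<epsilon> = 1 \<or> \<epsilon> = -1"
  shows "norm (G (of_real r + \<i> * of_real (\<epsilon> * (20 * r))) - G (of_real r * exp (\<i> * of_real (\<epsilon> * (pi / 3))))) \<le> exp (13/10 * K)"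
proof -
  define a b where "a = of_real r * Complex (1/2) (\<epsilon> * sqrt 3 / 2)" and "b = of_real r * Complex 1 (\<epsilon> * 20)"
  have "exp (\<i> * of_real (\<epsilon> * (pi / 3))) = Complex (1/2) (\<epsilon> * sqrt 3 / 2)"
    using assms(2) by (auto simp: complex_eq_iff Re_exp Im_exp cos_60 sin_60)
  then have a_eq: "of_real r * exp (\<i> * of_real (\<epsilon> * (pi / 3))) = a" by (simp add: a_def)
  have b_eq: "of_real r + \<i> * of_real (\<epsilon> * (20 * r)) = b" by (simp add: b_def complex_eq_iff)
  have "norm (G b - G a) \<le> exp (13/10 * K) * norm (b - a)"
  proof (rule field_differentiable_bound[of "closed_segment a b"])
    fix z assume "z \<in> closed_segment a b"
    from hr_kernel_segment_le[OF assms(2) this[unfolded a_def b_def]]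
    show "norm (hr_kernel N z) \<le> exp (13/10 * K)" "(G has_field_derivative hr_kernel N z) (at z within closed_segment a b)"
      by (auto intro: has_field_derivative_at_within G)
  qed auto
  also have "norm (b - a) \<le> 1"
  proof -
    have "b - a = of_real r * Complex (1/2) (\<epsilon> * (20 - sqrt 3 / 2))"
      by (simp add: a_def b_def complex_eq_iff algebra_simps)
    then have "norm (b - a) = r * norm (Complex (1/2) (\<epsilon> * (20 - sqrt 3 / 2)))" using r by (simp add: norm_mult)
    also have "\<dots> \<le> r * (\<bar>1/2\<bar> + \<bar>\<epsilon> * (20 - sqrt 3 / 2)\<bar>)"
      using r by (intro mult_left_mono) (use cmod_le[of "Complex (1/2) (\<epsilon> * (20 - sqrt 3 / 2))"] in auto)
    also have "\<dots> \<le> r * 21"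
    proof -
      have "sqrt 3 / 2 \<le> 1" using real_sqrt_le_mono[of 3 4] by simp
      then have "\<bar>\<epsilon> * (20 - sqrt 3 / 2)\<bar> = 20 - sqrt 3 / 2" using assms(2) by auto
      moreover have "sqrt 3 / 2 \<ge> 0" by simp
      ultimately have "\<bar>1/2\<bar> + \<bar>\<epsilon> * (20 - sqrt 3 / 2)\<bar> \<le> 21" by linarith
      then show ?thesis using r by (intro mult_left_mono) auto
    qed
    also have "\<dots> \<le> 1" using r by simp
    finally show ?thesis .
  qed
  finally show ?thesis unfolding a_eq b_eq by simp
qed

text \<open>The main term is the arc integral with the full Gaussian. The minor arcs produce the
  first error term; the connecting segments, the dual factor and the Gaussian tails together stay
  below \<open>exp (13/10 * K)\<close>.\<close>

theorem two_pi_num_partitions_approx: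
  "\<bar>2 * pi * real (num_partitions n) -
     r * sqrt r / sqrt (2 * pi) * exp (2 * K) * ((1 - 1 / (2 * K)) * sqrt (pi / K))\<bar>
   \<le> 2 * pi * (102/100 * sqrt r / sqrt (2 * pi) * exp (2 * K) * exp (- (99/100 / r))) + exp (13/10 * K)"
proof -
  define d where "d = 20 * r"
  have d: "0 < d" "d \<le> 20/27" "d < pi" using r pi_approx by (auto simp: d_def)
  obtain G where G: "\<And>z. Re z > 0 \<Longrightarrow> (G has_field_derivative hr_kernel N z) (at z)"
    using hr_kernel_primitive by blast
  define Mi where "Mi = 102/100 * sqrt r / sqrt (2 * pi) * exp (2 * K) * exp (- (99/100 / r))"
  have Mi: "0 \<le> Mi" using r by (simp add: Mi_def)
  define V where "V = (G (zline d) - G (of_real r - \<i> * of_real d)) / \<i>"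
  define W where "W = (G (of_real r * exp (\<i> * of_real (pi / 3))) - G (of_real r * exp (\<i> * of_real (- (pi / 3))))) / \<i>"
  define c where "c = 1 / sqrt (2 * pi)"
  have c: "0 < c" "c \<le> 4/10" using sqrt_two_pi_bounds by (auto simp: c_def field_simps)
  have total: "(integrand has_integral of_real (2 * pi * real (num_partitions n))) {- pi..pi}"
    by (rule partition_integral[OF r(1)])
  have int: "integrand integrable_on {u..v}" if "- pi \<le> u" "v \<le> pi" for u v
    using integrable_on_subinterval[OF has_integral_integrable[OF total]] that by auto
  have J_split: "of_real (2 * pi * real (num_partitions n)) =
     integral {- pi..- d} integrand + (integral {- d..d} integrand + integral {d..pi} integrand)"
  proof -
    have "of_real (2 * pi * real (num_partitions n)) = integral {- pi..pi} integrand"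
      using integral_unique[OF total] by simp
    also have "\<dots> = integral {- pi..- d} integrand + integral {- d..pi} integrand"
      using d by (intro Henstock_Kurzweil_Integration.integral_combine [symmetric] int) auto
    also have "integral {- d..pi} integrand = integral {- d..d} integrand + integral {d..pi} integrand"
      using d by (intro Henstock_Kurzweil_Integration.integral_combine [symmetric] int) auto
    finally show ?thesis .
  qed
  have minor1: "norm (integral {- pi..- d} integrand) \<le> Mi * pi"
  proof -
    have "norm (integral {- pi..- d} integrand) \<le> Mi * (- d - (- pi))"
      using d norm_integrand_minor_le
      by (intro norm_has_integral_le[OF Mi integrable_integral[OF int]]) (auto simp: d_def Mi_def)
    also have "\<dots> \<le> Mi * pi" using Mi d by (intro mult_left_mono) auto
    finally show ?thesis .
  qed
  have minor2: "norm (integral {d..pi} integrand) \<le> Mi * pi"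
  proof -
    have "norm (integral {d..pi} integrand) \<le> Mi * (pi - d)"
      using d norm_integrand_minor_le
      by (intro norm_has_integral_le[OF Mi integrable_integral[OF int]]) (auto simp: d_def Mi_def)
    also have "\<dots> \<le> Mi * pi" using Mi d by (intro mult_left_mono) auto
    finally show ?thesis .
  qed
  have major: "norm (integral {- d..d} integrand - V / of_real (sqrt (2 * pi))) \<le> 16 * c * exp K * (2 * d)"
  proof -
    have "((\<lambda>\<theta>. integrand \<theta> - hr_kernel N (zline \<theta>) / of_real (sqrt (2 * pi))) has_integral
       (integral {- d..d} integrand - V / of_real (sqrt (2 * pi)))) {- d..d}"
      unfolding V_def using d r
      by (intro has_integral_diff has_integral_divide hr_kernel_vertical_integral[OF G] integrable_integral[OF int]) auto
    then have "norm (integral {- d..d} integrand - V / of_real (sqrt (2 * pi))) \<le> 16 / sqrt (2 * pi) * exp K * (d - (- d))"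
      using d norm_integrand_major_error_le
      by (intro norm_has_integral_le) (auto simp: d_def abs_le_iff)
    then show ?thesis by (simp add: c_def)
  qed
  have VW: "norm (V - W) \<le> 2 * exp (13/10 * K)"
  proof -
    have "V - W = ((G (zline d) - G (of_real r * exp (\<i> * of_real (pi / 3)))) -
        (G (of_real r - \<i> * of_real d) - G (of_real r * exp (\<i> * of_real (- (pi / 3)))))) / \<i>"
      by (simp add: V_def W_def algebra_simps)
    also have "norm \<dots> \<le> norm (G (zline d) - G (of_real r * exp (\<i> * of_real (pi / 3)))) +
        norm (G (of_real r - \<i> * of_real d) - G (of_real r * exp (\<i> * of_real (- (pi / 3)))))"
      unfolding norm_divide using norm_triangle_ineq4 by simp
    also have "\<dots> \<le> exp (13/10 * K) + exp (13/10 * K)"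
      using hr_kernel_primitive_segment_le[OF G, of 1] hr_kernel_primitive_segment_le[OF G, of "-1"]
      by (intro add_mono) (auto simp: d_def)
    finally show ?thesis by simp
  qed
  define I where "I = integral {-1..1} (\<lambda>\<tau>. exp (- K * \<tau>\<^sup>2))"
  have K_pos: "K > 0" using K_ge by simp
  have Re_W: "Re W = r * sqrt r * (exp (2 * K) * ((1 - 1 / (2 * K)) * I + exp (- K) / K))"
  proof -
    have "((\<lambda>\<phi>. r * sqrt r * (exp (2 * K * cos \<phi>) * cos (3 * \<phi> / 2))) has_integral Re W) {- (pi/3)..pi/3}"
      using hr_kernel_arc_integral[OF G r(1)] NrK K unfolding W_def by simp
    moreover have "((\<lambda>\<phi>. r * sqrt r * (exp (2 * K * cos \<phi>) * cos (3 * \<phi> / 2))) has_integral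
       r * sqrt r * (exp (2 * K) * integral {-1..1} (\<lambda>\<tau>. (1 - \<tau>\<^sup>2) * exp (- K * \<tau>\<^sup>2)))) {- (pi/3)..pi/3}"
      by (intro has_integral_mult_right arc_integral_eq_truncated_gaussian)
    ultimately have "Re W = r * sqrt r * (exp (2 * K) * integral {-1..1} (\<lambda>\<tau>. (1 - \<tau>\<^sup>2) * exp (- K * \<tau>\<^sup>2)))"
      by (rule has_integral_unique)
    then show ?thesis unfolding truncated_gaussian_weighted[OF K_pos] I_def .
  qed
  have W_main: "\<bar>Re W - r * sqrt r * exp (2 * K) * ((1 - 1 / (2 * K)) * sqrt (pi / K))\<bar> \<le> exp K"
  proof -
    have "Re W - r * sqrt r * exp (2 * K) * ((1 - 1 / (2 * K)) * sqrt (pi / K)) =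
       r * sqrt r * exp (2 * K) * ((1 - 1 / (2 * K)) * (I - sqrt (pi / K)) + exp (- K) / K)"
      unfolding Re_W by (simp add: algebra_simps diff_divide_distrib)
    then have "\<bar>Re W - r * sqrt r * exp (2 * K) * ((1 - 1 / (2 * K)) * sqrt (pi / K))\<bar> =
       r * sqrt r * exp (2 * K) * \<bar>(1 - 1 / (2 * K)) * (I - sqrt (pi / K)) + exp (- K) / K\<bar>"
      using r by (simp add: abs_mult)
    also have "\<dots> \<le> 1 * 1 * exp (2 * K) * exp (- K)"
    proof (intro mult_mono)
      have "\<bar>(1 - 1 / (2 * K)) * (I - sqrt (pi / K))\<bar> \<le> 1 * (exp (- K) / K)"
        unfolding abs_mult using truncated_gaussian_bounds[OF K_pos] K_ge
        by (intro mult_mono) (auto simp: I_def)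
      moreover have "2 * (exp (- K) / K) \<le> exp (- K)" using K_ge by (simp add: field_simps)
      moreover have "0 \<le> exp (- K) / K" using K_pos by simp
      ultimately show "\<bar>(1 - 1 / (2 * K)) * (I - sqrt (pi / K)) + exp (- K) / K\<bar> \<le> exp (- K)"
        by linarith
    qed (use r in auto)
    also have "\<dots> = exp K" by (simp add: exp_add [symmetric])
    finally show ?thesis .
  qed
  \<comment> \<open>The connecting segments use up 8/10 of \<open>exp (13/10 * K)\<close>; the
    errors of size \<open>exp K\<close>, with total coefficient below 17, have to fit into the
    remaining fifth.\<close>
  have small: "17 * exp K \<le> 1/5 * exp (13/10 * K)"
  proof -
    have "85 \<le> 1 + 3/10 * K + (3/10 * K)\<^sup>2 / 2"
    proof -
      have "(3/10 * 44)\<^sup>2 \<le> (3/10 * K)\<^sup>2" using K_ge by (intro power_mono) auto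
      then show ?thesis using K_ge by (simp add: power2_eq_square)
    qed
    also have "\<dots> \<le> exp (3/10 * K)" using K_ge by (intro exp_lower_Taylor_quadratic) auto
    finally have "85 * exp K \<le> exp (3/10 * K) * exp K" by (intro mult_right_mono) auto
    also have "\<dots> = exp (13/10 * K)" by (simp add: exp_add [symmetric])
    finally show ?thesis by simp
  qed
  have "2 * pi * real (num_partitions n) = Re (integral {- pi..- d} integrand) + Re (integral {d..pi} integrand) +
     Re (integral {- d..d} integrand - V / of_real (sqrt (2 * pi))) + c * Re (V - W) + c * Re W"
    using arg_cong[OF J_split, of Re] by (simp add: c_def diff_divide_distrib)
  then have "2 * pi * real (num_partitions n) - c * (r * sqrt r * exp (2 * K) * ((1 - 1 / (2 * K)) * sqrt (pi / K))) =
     Re (integral {- pi..- d} integrand) + Re (integral {d..pi} integrand) +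
     Re (integral {- d..d} integrand - V / of_real (sqrt (2 * pi))) + c * Re (V - W) +
     c * (Re W - r * sqrt r * exp (2 * K) * ((1 - 1 / (2 * K)) * sqrt (pi / K)))"
    by (simp add: algebra_simps)
  also have "\<bar>\<dots>\<bar> \<le> Mi * pi + Mi * pi + 16 * c * exp K * (2 * d) + c * (2 * exp (13/10 * K)) + c * exp K"
  proof (intro order.trans[OF abs_triangle_ineq] add_mono)
    show "\<bar>Re (integral {- pi..- d} integrand)\<bar> \<le> Mi * pi" by (rule order.trans[OF abs_Re_le_cmod minor1])
    show "\<bar>Re (integral {d..pi} integrand)\<bar> \<le> Mi * pi" by (rule order.trans[OF abs_Re_le_cmod minor2])
    show "\<bar>Re (integral {- d..d} integrand - V / of_real (sqrt (2 * pi)))\<bar> \<le> 16 * c * exp K * (2 * d)"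
      by (rule order.trans[OF abs_Re_le_cmod major])
    show "\<bar>c * Re (V - W)\<bar> \<le> c * (2 * exp (13/10 * K))"
      unfolding abs_mult using c order.trans[OF abs_Re_le_cmod VW] by (intro mult_mono) auto
    show "\<bar>c * (Re W - r * sqrt r * exp (2 * K) * ((1 - 1 / (2 * K)) * sqrt (pi / K)))\<bar> \<le> c * exp K"
      unfolding abs_mult using c W_main by (intro mult_mono) auto
  qed
  also have "\<dots> \<le> 2 * pi * Mi + exp (13/10 * K)"
  proof -
    have "16 * c * exp K * (2 * d) \<le> 16 * (4/10) * exp K * (2 * 1)"
      using c d by (intro mult_mono) auto
    moreover have "c * (2 * exp (13/10 * K)) \<le> 4/10 * (2 * exp (13/10 * K))" "c * exp K \<le> 4/10 * exp K"
      using c by (intro mult_right_mono; simp)+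
    moreover have "Mi * pi + Mi * pi = 2 * pi * Mi" by simp
    ultimately show ?thesis using small exp_gt_zero[of K] by linarith
  qed
  finally show ?thesis by (simp add: c_def Mi_def)
qed

end

section \<open>The logarithm of the main term\<close>

definition hr_const :: real where "hr_const = pi * sqrt (2/3)"

text \<open>The logarithm of \<open>exp (c s) (c s - 1) / s^3\<close> at \<open>s = sqrt x\<close>,
  without the constant factor.\<close>

definition hr_log :: "real \<Rightarrow> real" where
  "hr_log x = hr_const * sqrt x - 3 * ln (sqrt x) + ln (hr_const * sqrt x - 1)"

lemma hr_const_bounds: "256/100 \<le> hr_const" "hr_const \<le> 257/100"
proof -
  have sq: "hr_const\<^sup>2 = pi\<^sup>2 * (2/3)" by (simp add: hr_const_def power_mult_distrib)
  have nn: "0 \<le> hr_const" by (simp add: hr_const_def)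
  show "256/100 \<le> hr_const"
    by (rule power2_le_imp_le[OF _ nn]) (unfold sq, use pi_squared_bounds in \<open>simp add: power2_eq_square\<close>)
  show "hr_const \<le> 257/100"
    by (rule power2_le_imp_le) (unfold sq, use pi_squared_bounds in \<open>simp_all add: power2_eq_square\<close>)
qed

lemma exp_one_ge: "2717/1000 \<le> exp (1::real)"
  using e_approx_32 by (simp add: abs_if split: if_splits)

text \<open>Checked at \<open>x = 27\<close>. Beyond that point \<open>x^7\<close> grows by a factor
  of at most \<open>exp (7 (x / 27 - 1))\<close>, and 7/27 is below 99/100.\<close>

lemma exp_ge_power7:
  assumes x: "27 \<le> (x::real)" shows "28 * x ^ 7 \<le> exp (99/100 * x)"
proof -
  \<comment> \<open>The exponent 99/100 * 27 is split as 26 + 73/100.\<close>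
  have "(2717/1000) ^ 26 \<le> exp (1::real) ^ 26" using exp_one_ge by (intro power_mono) auto
  also have "exp (1::real) ^ 26 = exp 26" by (simp add: exp_of_nat_mult [symmetric])
  finally have "(2717/1000) ^ 26 * (1 + 73/100 + (73/100)\<^sup>2 / 2) \<le> exp 26 * exp (73/100 :: real)"
    by (intro mult_mono exp_lower_Taylor_quadratic) auto
  also have "\<dots> = exp (99/100 * 27)" by (simp add: exp_add [symmetric])
  finally have base: "28 * 27 ^ 7 \<le> exp (99/100 * 27 :: real)"
    by (rule order.trans[rotated]) (simp add: power2_eq_square power_divide)
  have "x / 27 \<le> exp (x / 27 - 1)" using exp_ge_add_one_self[of "x / 27 - 1"] by simp
  then have "(x / 27) ^ 7 \<le> exp (x / 27 - 1) ^ 7" using x by (intro power_mono) auto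
  also have "\<dots> = exp (7 * (x / 27 - 1))" by (simp add: exp_of_nat_mult [symmetric])
  also have "\<dots> \<le> exp (99/100 * (x - 27))" using x by simp
  finally have "28 * 27 ^ 7 * (x / 27) ^ 7 \<le> exp (99/100 * 27) * exp (99/100 * (x - 27))"
    using x by (intro mult_mono base) auto
  also have "\<dots> = exp (99/100 * x)"
    unfolding exp_add [symmetric] by (rule arg_cong[where f = exp]) (simp add: field_simps)
  finally show ?thesis by (simp add: power_divide)
qed

lemma abs_ln_le:
  assumes "\<bar>y - 1\<bar> \<le> e" "e \<le> 1/2" shows "\<bar>ln y\<bar> \<le> 2 * (e::real)"
proof -
  have y: "1/2 \<le> y" using assms by (auto simp: abs_le_iff)
  have e: "0 \<le> e" using assms by auto
  have "ln y \<le> y - 1" using y by (intro ln_le_minus_one) auto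
  moreover have "- ln y = ln (inverse y)" using y by (simp add: ln_inverse)
  moreover have "ln (inverse y) \<le> inverse y - 1" using y by (intro ln_le_minus_one) auto
  moreover have "inverse y - 1 = (1 - y) / y" using y by (simp add: field_simps)
  moreover have "(1 - y) / y \<le> 2 * e"
  proof -
    have "1 - y \<le> e" using assms by auto
    also have "e \<le> 2 * e * y" using mult_left_mono[OF y, of "2 * e"] e by simp
    finally show ?thesis using y by (simp add: pos_divide_le_eq)
  qed
  ultimately show ?thesis using assms e by (auto simp: abs_le_iff)
qed

text \<open>The relative error \<open>\<eta>\<close> is exponentially small in
  \<open>x = 1 / r\<close>. It is recorded only as a multiple of \<open>sqrt N ^ (- 5)\<close>, the
  order that the third difference of \<open>ln p\<close> tolerates.\<close>

theorem ln_num_partitions_approx: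
  assumes n: "1200 \<le> n"
  defines "N \<equiv> real n - 1/24"
  shows "0 < num_partitions n"
    and "\<bar>ln (real (num_partitions n)) - (ln (sqrt 3 / 12 / hr_const) + hr_log N)\<bar> \<le> 1 / (4 * sqrt N ^ 5)"
proof -
  have N: "1199 + 9/10 \<le> N" using n by (simp add: N_def)
  define w where "w = sqrt N"
  have w: "w > 0" "w\<^sup>2 = N" using N by (auto simp: w_def)
  have w34: "34 \<le> w" unfolding w_def using N by (intro real_le_rsqrt) auto
  \<comment> \<open>The solution of \<open>N r = pi^2 / (6 r)\<close>; it makes \<open>2 K\<close>
    equal to \<open>c s\<close>.\<close>
  define r where "r = pi / (sqrt 6 * w)"
  define x where "x = sqrt 6 * w / pi"
  define K where "K = hr_const * w / 2"
  have r_pos: "0 < r" using w by (simp add: r_def)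
  have rx: "r = 1 / x" by (simp add: r_def x_def)
  \<comment> \<open>The threshold 1200 just suffices: 729 * 9.87 is about 7195, and
    \<open>6 * N\<close> exceeds 7199.\<close>
  have x27: "27 \<le> x"
  proof -
    have "27 * pi \<le> sqrt (6 * N)"
    proof (rule real_le_rsqrt)
      have "(27 * pi)\<^sup>2 = 729 * pi\<^sup>2" by (simp add: power_mult_distrib)
      also have "\<dots> \<le> 729 * (987/100)" using pi_squared_bounds by simp
      also have "\<dots> \<le> 6 * N" using N by simp
      finally show "(27 * pi)\<^sup>2 \<le> 6 * N" .
    qed
    also have "\<dots> = sqrt 6 * w" by (simp add: w_def real_sqrt_mult)
    finally show ?thesis by (simp add: x_def field_simps)
  qed
  have r27: "r \<le> 1/27" using x27 by (simp add: rx field_simps)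
  have hc: "hr_const / 2 = pi / sqrt 6"
  proof (rule power2_eq_imp_eq)
    show "(hr_const / 2)\<^sup>2 = (pi / sqrt 6)\<^sup>2" by (simp add: hr_const_def power_mult_distrib power_divide)
  qed (simp_all add: hr_const_def)
  have K_eq: "K = pi / sqrt 6 * w" unfolding K_def using hc by (metis times_divide_eq_left)
  have NrK: "N * r = K"
    using w unfolding r_def K_eq w(2) [symmetric] by (simp add: power2_eq_square)
  have K_r: "K = pi\<^sup>2 / 6 / r"
    using w unfolding r_def K_eq by (simp add: power2_eq_square field_simps)
  define main where "main = r * sqrt r / sqrt (2 * pi) * exp (2 * K) * ((1 - 1 / (2 * K)) * sqrt (pi / K))"
  define err where "err = 2 * pi * (102/100 * sqrt r / sqrt (2 * pi) * exp (2 * K) * exp (- (99/100 / r))) + exp (13/10 * K)"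
  have approx: "\<bar>2 * pi * real (num_partitions n) - main\<bar> \<le> err"
    unfolding main_def err_def
    by (rule two_pi_num_partitions_approx[OF r_pos r27 _ NrK K_r]) (simp add: N_def)
  have K44: "44 \<le> K" by (rule K_ge[OF r_pos r27 _ NrK K_r]) (simp add: N_def)
  have main_eq: "main = sqrt 3 / pi * r\<^sup>2 * exp (2 * K) * (1 - 1 / (2 * K))"
  proof -
    have "sqrt r / sqrt (2 * pi) * sqrt (pi / K) = sqrt 3 / pi * r"
    proof -
      have "sqrt r / sqrt (2 * pi) * sqrt (pi / K) = sqrt (r / (2 * pi) * (pi / K))"
        by (simp add: real_sqrt_mult real_sqrt_divide)
      also have "r / (2 * pi) * (pi / K) = 3 * (r / pi)\<^sup>2"
        unfolding K_r using r_pos by (simp add: power2_eq_square)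
      finally show ?thesis using r_pos by (simp add: real_sqrt_mult)
    qed
    moreover have "main = r * (sqrt r / sqrt (2 * pi) * sqrt (pi / K)) * exp (2 * K) * (1 - 1 / (2 * K))"
      by (simp add: main_def mult_ac)
    ultimately have "main = r * (sqrt 3 / pi * r) * exp (2 * K) * (1 - 1 / (2 * K))" by (simp only:)
    then show ?thesis by (simp add: power2_eq_square mult_ac)
  qed
  have k1: "98/100 \<le> 1 - 1 / (2 * K)" using K44 by (simp add: field_simps)
  have s3: "55/100 \<le> sqrt 3 / pi"
  proof -
    have "55/100 * pi \<le> 1.73" using pi_approx by simp
    also have "1.73 \<le> sqrt 3" by (rule real_le_rsqrt) (simp add: power2_eq_square)
    finally show ?thesis by (simp add: field_simps)
  qed
  define B where "B = r\<^sup>2 * exp (2 * K)"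
  have B: "B > 0" using r_pos by (simp add: B_def)
  have main_ge: "539/1000 * B \<le> main"
  proof -
    have "55/100 * (98/100) \<le> sqrt 3 / pi * (1 - 1 / (2 * K))" using k1 s3 by (intro mult_mono) auto
    then have "539/1000 * B \<le> sqrt 3 / pi * (1 - 1 / (2 * K)) * B" using B by (intro mult_right_mono) auto
    then show ?thesis by (simp add: main_eq B_def mult_ac)
  qed
  then have main_pos: "main > 0" using B by simp
  define \<eta> where "\<eta> = x\<^sup>2 * exp (- (99/100 * x))"
  have \<eta>_pos: "\<eta> > 0" using x27 by (simp add: \<eta>_def)
  have err_le: "err \<le> \<eta> * main"
  proof -
    have e1: "2 * pi * (102/100 * sqrt r / sqrt (2 * pi) * exp (2 * K) * exp (- (99/100 / r))) \<le> 1/2 * (exp (2 * K) * exp (- (99/100 * x)))"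
    proof -
      have "2 * pi * (102/100 * sqrt r / sqrt (2 * pi)) = 102/100 * sqrt (2 * pi) * sqrt r"
      proof -
        have "2 * pi = sqrt (2 * pi) * sqrt (2 * pi)" by simp
        then show ?thesis by (simp add: field_simps)
      qed
      also have "\<dots> \<le> 102/100 * (251/100) * (195/1000)"
      proof -
        have "sqrt r \<le> 195/1000"
          using r27 by (intro real_le_lsqrt) (auto simp: power2_eq_square)
        then show ?thesis using sqrt_two_pi_bounds r_pos by (intro mult_mono) auto
      qed
      also have "\<dots> \<le> 1/2" by simp
      finally have "2 * pi * (102/100 * sqrt r / sqrt (2 * pi)) * (exp (2 * K) * exp (- (99/100 * x))) \<le> 1/2 * (exp (2 * K) * exp (- (99/100 * x)))"
        by (intro mult_right_mono) auto
      then show ?thesis unfolding rx by (simp add: mult.assoc)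
    qed
    \<comment> \<open>\<open>7/10 * K\<close> is at least 1.15 x, so from \<open>x = 27\<close> on
      it exceeds \<open>99/100 * x\<close> by more than 4, which is worth a factor 34.\<close>
    have e2: "exp (13/10 * K) \<le> 3/100 * (exp (2 * K) * exp (- (99/100 * x)))"
    proof -
      have "K = pi\<^sup>2 / 6 * x" by (simp add: K_r rx)
      also have "\<dots> \<ge> 9869/6000 * x" using pi_squared_bounds x27 by (intro mult_right_mono) auto
      finally have "7/10 * K - 99/100 * x \<ge> 4" using x27 by simp
      then have "exp 4 \<le> exp (7/10 * K - 99/100 * x)" by simp
      moreover have "34 \<le> exp (4::real)"
      proof -
        have "(2717/1000) ^ 4 \<le> exp (1::real) ^ 4" using exp_one_ge by (intro power_mono) auto
        moreover have "exp (1::real) ^ 4 = exp 4" by (simp add: exp_of_nat_mult [symmetric])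
        ultimately show ?thesis by (simp add: power_divide)
      qed
      ultimately have "34 \<le> exp (7/10 * K - 99/100 * x)" by linarith
      then have "exp (13/10 * K) * 34 \<le> exp (13/10 * K) * exp (7/10 * K - 99/100 * x)" by (intro mult_left_mono) auto
      also have "\<dots> = exp (2 * K) * exp (- (99/100 * x))" by (simp add: exp_add [symmetric])
      finally show ?thesis using exp_gt_zero[of "13/10 * K"] by linarith
    qed
    have "err \<le> 53/100 * (exp (2 * K) * exp (- (99/100 * x)))" using e1 e2 by (simp add: err_def)
    also have "exp (2 * K) * exp (- (99/100 * x)) = \<eta> * B"
      using x27 by (simp add: \<eta>_def B_def rx power2_eq_square)
    also have "53/100 * (\<eta> * B) \<le> \<eta> * (539/1000 * B)" using \<eta>_pos B by simp
    also have "\<dots> \<le> \<eta> * main" using main_ge \<eta>_pos by (intro mult_left_mono) auto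
    finally show ?thesis .
  qed
  have \<eta>_le: "\<eta> \<le> 1 / (8 * w ^ 5)"
  proof -
    \<comment> \<open>1.283 lies just above \<open>pi / sqrt 6\<close>, and its fifth power is below
      7/2. Multiplied by 8 this is the 28 of \<open>exp_ge_power7\<close>.\<close>
    have "w \<le> 1283/1000 * x"
    proof -
      have "sqrt 6 \<ge> 2449/1000" by (rule real_le_rsqrt) (simp add: power2_eq_square)
      then have "pi \<le> 1283/1000 * sqrt 6" using pi_approx by simp
      then have "w * pi \<le> w * (1283/1000 * sqrt 6)" using w by (intro mult_left_mono) auto
      then show ?thesis by (simp add: x_def field_simps)
    qed
    then have "w ^ 5 \<le> (1283/1000 * x) ^ 5" using w by (intro power_mono) auto
    also have "\<dots> \<le> 7/2 * x ^ 5"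
      unfolding power_mult_distrib using x27 by (intro mult_right_mono) (auto simp: power_divide)
    finally have "8 * w ^ 5 \<le> 28 * x ^ 5" by simp
    then have "8 * w ^ 5 * x\<^sup>2 \<le> 28 * x ^ 5 * x\<^sup>2" by (rule mult_right_mono) simp
    also have "\<dots> = 28 * x ^ 7" by (simp add: power_add [symmetric])
    also have "\<dots> \<le> exp (99/100 * x)" by (rule exp_ge_power7[OF x27])
    finally show ?thesis using w x27 by (simp add: \<eta>_def exp_minus field_simps)
  qed
  have w5: "1 / (8 * w ^ 5) \<le> 1/2"
  proof -
    have "1 \<le> w ^ 5" using w34 by (intro one_le_power) simp
    then have "1 / (8 * w ^ 5) \<le> 1 / (8 * 1)" using w by (intro divide_left_mono) auto
    then show ?thesis by simp
  qed
  define y where "y = 2 * pi * real (num_partitions n) / main"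
  have "y - 1 = (2 * pi * real (num_partitions n) - main) / main" using main_pos by (simp add: y_def field_simps)
  then have "\<bar>y - 1\<bar> = \<bar>2 * pi * real (num_partitions n) - main\<bar> / main" using main_pos by simp
  also have "\<dots> \<le> (\<eta> * main) / main" using approx err_le main_pos by (intro divide_right_mono) auto
  also have "\<dots> = \<eta>" using main_pos by simp
  finally have y1: "\<bar>y - 1\<bar> \<le> 1 / (8 * w ^ 5)" using \<eta>_le by simp
  then have y_pos: "y > 0" using w5 by (simp add: abs_le_iff)
  then show pos: "0 < num_partitions n" by (cases "num_partitions n") (auto simp: y_def)
  have ln_y: "\<bar>ln y\<bar> \<le> 2 * (1 / (8 * w ^ 5))" using y1 w5 by (rule abs_ln_le)
  have "real (num_partitions n) = y * (main / (2 * pi))" using main_pos by (simp add: y_def)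
  then have "ln (real (num_partitions n)) = ln y + ln (main / (2 * pi))"
    using ln_mult_pos[OF y_pos, of "main / (2 * pi)"] main_pos by simp
  moreover have "ln (main / (2 * pi)) = ln (sqrt 3 / 12 / hr_const) + hr_log N"
  proof -
    have c_pos: "hr_const > 0" using hr_const_bounds by simp
    have cw: "hr_const * w - 1 > 0" "2 * K = hr_const * w" using K44 by (auto simp: K_def)
    have "main / (2 * pi) = sqrt 3 / 12 / hr_const * (exp (hr_const * w) * (hr_const * w - 1) / (N * w))"
    proof -
      have "main / (2 * pi) = sqrt 3 / pi * r\<^sup>2 * exp (hr_const * w) * ((hr_const * w - 1) / (hr_const * w)) / (2 * pi)"
        unfolding main_eq cw(2) using w c_pos by (simp add: field_simps)
      also have "r\<^sup>2 = pi\<^sup>2 / (6 * N)" using w by (simp add: r_def power_divide power_mult_distrib)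
      finally show ?thesis using w N c_pos by (simp add: power2_eq_square field_simps)
    qed
    also have "ln \<dots> = ln (sqrt 3 / 12 / hr_const) + (hr_const * w + ln (hr_const * w - 1) - (ln N + ln w))"
      using c_pos cw w N by (simp add: ln_mult_pos ln_div)
    also have "ln N = 2 * ln w" using ln_realpow[of w 2] w(2) by simp
    finally show ?thesis by (simp add: hr_log_def w_def)
  qed
  ultimately show "\<bar>ln (real (num_partitions n)) - (ln (sqrt 3 / 12 / hr_const) + hr_log N)\<bar> \<le> 1 / (4 * sqrt N ^ 5)"
    using ln_y by (simp add: w_def)
qed

section \<open>The discriminant inequality for large arguments\<close>

text \<open>The depressed cubic \<open>u^3 - 3 d^2 u + c\<close> has critical values
  \<open>c \<plusminus> 2 d^3\<close>, and the hypothesis amounts to \<open>|c| < 2 d^3\<close>. Its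
  signs then alternate at \<open>- 2 d\<close>, \<open>- d\<close>, \<open>d\<close>,
  \<open>2 d\<close>.\<close>

lemma cubic_three_real_roots:
  fixes a0 a1 a2 a3 :: real
  assumes a3: "a3 > 0"
    and disc: "(a1 * a2 - a0 * a3)\<^sup>2 < 4 * (a1\<^sup>2 - a0 * a2) * (a2\<^sup>2 - a1 * a3)"
  shows "card {x. poly [:a0, 3 * a1, 3 * a2, a3:] x = 0} = 3"
proof -
  define p where "p = [:a0, 3 * a1, 3 * a2, a3:]"
  define h where "h = a2\<^sup>2 - a1 * a3"
  define c where "c = a0 * a3\<^sup>2 - 3 * a1 * a2 * a3 + 2 * a2 ^ 3"
  \<comment> \<open>The discriminant identity; it also forces \<open>h > 0\<close>, since
    \<open>4 h^3\<close> exceeds a square.\<close>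
  have "4 * h ^ 3 - c\<^sup>2 = a3\<^sup>2 * (4 * (a1\<^sup>2 - a0 * a2) * (a2\<^sup>2 - a1 * a3) - (a1 * a2 - a0 * a3)\<^sup>2)"
    unfolding h_def c_def by algebra
  also have "\<dots> > 0" using disc a3 by (intro mult_pos_pos) auto
  finally have c_less: "c\<^sup>2 < 4 * h ^ 3" by simp
  have h: "h > 0"
  proof (rule ccontr)
    assume "\<not> h > 0"
    then have "h ^ 3 \<le> 0" by (simp add: power_le_zero_eq)
    then show False using c_less zero_le_power2[of c] by linarith
  qed
  define d where "d = sqrt h"
  have d: "d > 0" "d\<^sup>2 = h" using h by (auto simp: d_def)
  have "c\<^sup>2 < (2 * d ^ 3)\<^sup>2" using c_less by (simp add: d(2) [symmetric] power_mult_distrib flip: power_mult)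
  then have "\<bar>c\<bar> < 2 * d ^ 3" using d by (metis abs_of_pos power2_less_imp_less power2_abs zero_less_power mult_pos_pos zero_less_numeral less_imp_le)
  then have c_bounds: "c < 2 * d ^ 3" "- c < 2 * d ^ 3" by auto
  have a1: "a1 = (a2\<^sup>2 - d\<^sup>2) / a3" using a3 by (simp add: d(2) h_def field_simps)
  have a0: "a0 = (c + 3 * a1 * a2 * a3 - 2 * a2 ^ 3) / a3\<^sup>2" using a3 by (simp add: c_def field_simps)
  \<comment> \<open>Depressed form of the cubic: \<open>x = (u - a2) / a3\<close>.\<close>
  have depressed: "a3\<^sup>2 * poly p ((u - a2) / a3) = u ^ 3 - 3 * d\<^sup>2 * u + c" for u
    unfolding p_def a0 a1 using a3
    by (simp add: field_simps power2_eq_square power3_eq_cube)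
  define x where "x u = (u - a2) / a3" for u
  have pos: "poly p (x u) > 0" if "u ^ 3 - 3 * d\<^sup>2 * u + c > 0" for u
    using that depressed[of u] a3 by (metis x_def zero_less_mult_pos zero_less_power)
  have neg: "poly p (x u) < 0" if "u ^ 3 - 3 * d\<^sup>2 * u + c < 0" for u
    using that depressed[of u] a3 by (metis x_def mult_less_0_iff not_less_iff_gr_or_eq zero_less_power)
  have v: "poly p (x (- 2 * d)) < 0" "poly p (x (- d)) > 0" "poly p (x d) < 0" "poly p (x (2 * d)) > 0"
    using c_bounds by (auto intro!: pos neg simp: power2_eq_square power3_eq_cube)
  have xs: "x (- 2 * d) < x (- d)" "x (- d) < x d" "x d < x (2 * d)"
    using d a3 by (auto simp: x_def divide_strict_right_mono)
  obtain x1 where x1: "x (- 2 * d) < x1" "x1 < x (- d)" "poly p x1 = 0"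
    using poly_IVT_pos[OF xs(1) v(1) v(2)] by auto
  obtain x2 where x2: "x (- d) < x2" "x2 < x d" "poly p x2 = 0"
    using poly_IVT_neg[OF xs(2) v(2) v(3)] by auto
  obtain x3 where x3: "x d < x3" "x3 < x (2 * d)" "poly p x3 = 0"
    using poly_IVT_pos[OF xs(3) v(3) v(4)] by auto
  have p0: "p \<noteq> 0" using a3 by (simp add: p_def)
  have fin: "finite {x. poly p x = 0}" using p0 by (rule poly_roots_finite)
  have "card {x1, x2, x3} = 3" using x1 x2 x3 by auto
  moreover have "{x1, x2, x3} \<subseteq> {x. poly p x = 0}" using x1 x2 x3 by auto
  ultimately have "3 \<le> card {x. poly p x = 0}" using card_mono[OF fin] by metis
  moreover have "card {x. poly p x = 0} \<le> 3"
    using card_poly_roots_bound[OF p0] a3 by (simp add: p_def)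
  ultimately show ?thesis by (simp add: p_def)
qed

section \<open>Differences of the logarithm of the main term\<close>

lemma second_difference_MVT:
  fixes f f' f'' :: "real \<Rightarrow> real"
  assumes "\<And>t. a \<le> t \<Longrightarrow> t \<le> a + 2 \<Longrightarrow> (f has_real_derivative f' t) (at t)"
    and "\<And>t. a \<le> t \<Longrightarrow> t \<le> a + 2 \<Longrightarrow> (f' has_real_derivative f'' t) (at t)"
  obtains \<xi> where "a \<le> \<xi>" "\<xi> \<le> a + 2" "f (a + 2) - 2 * f (a + 1) + f a = f'' \<xi>"
proof -
  have shift: "((\<lambda>t. f (t + 1)) has_real_derivative f' (t + 1)) (at t)" if "a \<le> t" "t \<le> a + 1" for t
    using assms(1)[of "t + 1"] that by (simp add: DERIV_shift)
  \<comment> \<open>The second difference of \<open>f\<close> is the first difference of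
    \<open>t \<mapsto> f (t + 1) - f t\<close>. The mean value theorem is applied to that function
    and then to \<open>f'\<close>.\<close>
  have "\<exists>\<eta>. a < \<eta> \<and> \<eta> < a + 1 \<and> (\<lambda>t. f (t + 1) - f t) (a + 1) - (\<lambda>t. f (t + 1) - f t) a = (a + 1 - a) * (f' (\<eta> + 1) - f' \<eta>)"
    by (rule MVT2) (auto intro!: DERIV_diff shift assms(1))
  then obtain \<eta> where \<eta>: "a < \<eta>" "\<eta> < a + 1" "f (a + 2) - 2 * f (a + 1) + f a = f' (\<eta> + 1) - f' \<eta>"
    by (auto simp: algebra_simps)
  have "\<exists>\<xi>. \<eta> < \<xi> \<and> \<xi> < \<eta> + 1 \<and> f' (\<eta> + 1) - f' \<eta> = (\<eta> + 1 - \<eta>) * f'' \<xi>"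
    using \<eta> by (intro MVT2 assms(2)) auto
  then obtain \<xi> where "\<eta> < \<xi>" "\<xi> < \<eta> + 1" "f' (\<eta> + 1) - f' \<eta> = f'' \<xi>" by auto
  then show ?thesis using that[of \<xi>] \<eta> by simp
qed

lemma third_difference_MVT:
  fixes f f' f'' f''' :: "real \<Rightarrow> real"
  assumes "\<And>t. a \<le> t \<Longrightarrow> t \<le> a + 3 \<Longrightarrow> (f has_real_derivative f' t) (at t)"
    and "\<And>t. a \<le> t \<Longrightarrow> t \<le> a + 3 \<Longrightarrow> (f' has_real_derivative f'' t) (at t)"
    and "\<And>t. a \<le> t \<Longrightarrow> t \<le> a + 3 \<Longrightarrow> (f'' has_real_derivative f''' t) (at t)"
  obtains \<xi> where "a \<le> \<xi>" "\<xi> \<le> a + 3" "f (a + 3) - 3 * f (a + 2) + 3 * f (a + 1) - f a = f''' \<xi>"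
proof -
  obtain \<eta> where \<eta>: "a \<le> \<eta>" "\<eta> \<le> a + 2"
      "(\<lambda>t. f (t + 1) - f t) (a + 2) - 2 * (\<lambda>t. f (t + 1) - f t) (a + 1) + (\<lambda>t. f (t + 1) - f t) a = f'' (\<eta> + 1) - f'' \<eta>"
  proof (rule second_difference_MVT[of a "\<lambda>t. f (t + 1) - f t" "\<lambda>t. f' (t + 1) - f' t" "\<lambda>t. f'' (t + 1) - f'' t"])
    fix t assume t: "a \<le> t" "t \<le> a + 2"
    show "((\<lambda>t. f (t + 1) - f t) has_real_derivative f' (t + 1) - f' t) (at t)"
      using assms(1)[of t] assms(1)[of "t + 1"] t by (intro DERIV_diff) (simp_all add: DERIV_shift)
    show "((\<lambda>t. f' (t + 1) - f' t) has_real_derivative f'' (t + 1) - f'' t) (at t)"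
      using assms(2)[of t] assms(2)[of "t + 1"] t by (intro DERIV_diff) (simp_all add: DERIV_shift)
  qed
  have "\<exists>\<xi>. \<eta> < \<xi> \<and> \<xi> < \<eta> + 1 \<and> f'' (\<eta> + 1) - f'' \<eta> = (\<eta> + 1 - \<eta>) * f''' \<xi>"
    using \<eta> by (intro MVT2 assms(3)) auto
  then obtain \<xi> where "\<eta> < \<xi>" "\<xi> < \<eta> + 1" "f'' (\<eta> + 1) - f'' \<eta> = f''' \<xi>" by auto
  then show ?thesis using that[of \<xi>] \<eta> by (simp add: algebra_simps)
qed

text \<open>The first three derivatives of \<^const>\<open>hr_log\<close> are polynomials in the following two functions.\<close>

definition hr_J :: "real \<Rightarrow> real" where "hr_J x = inverse (sqrt x)"

definition hr_I :: "real \<Rightarrow> real" where "hr_I x = inverse (hr_const * sqrt x - 1)"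

definition hr_log1 :: "real \<Rightarrow> real" where
  "hr_log1 x = hr_const\<^sup>2 / 2 * hr_I x - 3/2 * hr_J x ^ 2"

definition hr_log2 :: "real \<Rightarrow> real" where
  "hr_log2 x = 3/2 * hr_J x ^ 4 - hr_const ^ 3 / 4 * (hr_I x ^ 2 * hr_J x)"

definition hr_log3 :: "real \<Rightarrow> real" where
  "hr_log3 x = hr_const ^ 4 / 4 * (hr_I x ^ 3 * hr_J x ^ 2) + hr_const ^ 3 / 8 * (hr_I x ^ 2 * hr_J x ^ 3) - 3 * hr_J x ^ 6"

lemma hr_const_sqrt_gt: "x \<ge> 1 \<Longrightarrow> hr_const * sqrt x > 1"
proof -
  assume "x \<ge> 1"
  then have "1 \<le> sqrt x" by simp
  then have "hr_const * 1 \<le> hr_const * sqrt x" using hr_const_bounds by (intro mult_left_mono) auto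
  then show ?thesis using hr_const_bounds by linarith
qed

lemma hr_log_derivs:
  assumes x: "x \<ge> 1"
  shows "(hr_log has_real_derivative hr_log1 x) (at x)"
    and "(hr_log1 has_real_derivative hr_log2 x) (at x)"
    and "(hr_log2 has_real_derivative hr_log3 x) (at x)"
proof -
  define i j where "i = hr_I x" and "j = hr_J x"
  have D: "hr_const * sqrt x - 1 > 0" using hr_const_sqrt_gt[OF x] by simp
  have s: "sqrt x > 0" using x by simp
  have sqrt': "(sqrt has_real_derivative j / 2) (at x)"
    using DERIV_real_sqrt[of x] x by (simp add: j_def hr_J_def)
  have J': "(hr_J has_real_derivative - (j * (j / 2) * j)) (at x)"
    unfolding hr_J_def j_def using DERIV_inverse'[OF sqrt'] s by (simp add: j_def hr_J_def)
  have D': "((\<lambda>x. hr_const * sqrt x - 1) has_real_derivative hr_const * (j / 2)) (at x)"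
    using DERIV_diff[OF DERIV_cmult[OF sqrt', of hr_const] DERIV_const[of 1]] by simp
  have I': "(hr_I has_real_derivative - (i * (hr_const * (j / 2)) * i)) (at x)"
    unfolding hr_I_def i_def using DERIV_inverse'[OF D'] D by (simp add: i_def hr_I_def)
  \<comment> \<open>This relation removes the product of \<open>i\<close> and \<open>j\<close> from
    the derivative of \<open>hr_log\<close>.\<close>
  have key: "j * (1 + i) = hr_const * i"
    using s D by (simp add: i_def j_def hr_I_def hr_J_def field_simps)
  have "(hr_log has_real_derivative (hr_const * (j / 2) - 3 * (1 / sqrt x * (j / 2)) + 1 / (hr_const * sqrt x - 1) * (hr_const * (j / 2)))) (at x)"
    unfolding hr_log_def
    by (intro DERIV_add DERIV_diff DERIV_cmult sqrt' DERIV_chain2[OF DERIV_ln_divide sqrt'] DERIV_chain2[OF DERIV_ln_divide D'] s D)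
  moreover have "1 / sqrt x = j" "1 / (hr_const * sqrt x - 1) = i"
    by (simp_all add: i_def j_def hr_I_def hr_J_def inverse_eq_divide)
  moreover have "hr_const * (j / 2) - 3 * (j * (j / 2)) + i * (hr_const * (j / 2)) = hr_const / 2 * (j * (1 + i)) - 3/2 * j\<^sup>2"
    by (simp add: algebra_simps power2_eq_square)
  ultimately show "(hr_log has_real_derivative hr_log1 x) (at x)"
    by (simp only: key) (simp add: hr_log1_def i_def j_def power2_eq_square mult.assoc)
  show "(hr_log1 has_real_derivative hr_log2 x) (at x)"
    unfolding hr_log1_def
    by (rule derivative_eq_intros I' J' refl)+
       (simp add: hr_log2_def i_def [symmetric] j_def [symmetric] eval_nat_numeral algebra_simps)
  show "(hr_log2 has_real_derivative hr_log3 x) (at x)"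
    unfolding hr_log2_def
    by (rule derivative_eq_intros I' J' refl)+
       (simp add: hr_log3_def i_def [symmetric] j_def [symmetric] eval_nat_numeral algebra_simps)
qed

text \<open>\<open>q = c / (c s - 1)\<close> exceeds \<open>j = 1 / s\<close> by at most the factor
  100/98. With \<open>q\<close> close to \<open>j\<close> the leading parts are
  \<open>c / 4 * j^3\<close> and \<open>3 c / 8 * j^5\<close>; the remaining terms carry a further
  factor \<open>j \<le> 1/34\<close>.\<close>

lemma hr_log_deriv_bounds:
  assumes x: "x \<ge> 34\<^sup>2"
  shows "59/100 * hr_J x ^ 3 \<le> - hr_log2 x" "- hr_log2 x \<le> 7/10 * hr_J x ^ 3"
    and "0 \<le> hr_log3 x" "hr_log3 x \<le> 11/10 * hr_J x ^ 5"
proof -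
  define j q where "j = hr_J x" and "q = hr_const * hr_I x"
  have s34: "34 \<le> sqrt x" using x by (rule real_le_rsqrt)
  have j: "0 < j" "j \<le> 1/34"
    using s34 le_imp_inverse_le[OF s34] x by (simp_all add: j_def hr_J_def inverse_eq_divide)
  have "256/100 * 34 \<le> hr_const * sqrt x" using hr_const_bounds s34 by (intro mult_mono) auto
  then have cs: "50 \<le> hr_const * sqrt x" by simp
  have q_eq: "q = hr_const / (hr_const * sqrt x - 1)" by (simp add: q_def hr_I_def divide_inverse)
  have j_eq: "j = hr_const / (hr_const * sqrt x)" using hr_const_bounds by (simp add: j_def hr_J_def inverse_eq_divide)
  have jq: "j \<le> q" unfolding q_eq j_eq using cs hr_const_bounds by (intro divide_left_mono) auto
  have qj: "q \<le> 100/98 * j"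
  proof -
    have "98/100 * (hr_const * sqrt x) \<le> hr_const * sqrt x - 1" using cs by simp
    then have "q \<le> hr_const / (98/100 * (hr_const * sqrt x))"
      unfolding q_eq using cs hr_const_bounds by (intro divide_left_mono) auto
    moreover have "hr_const / (98/100 * Z) = 100/98 * (hr_const / Z)" for Z by simp
    ultimately show ?thesis unfolding j_eq by (simp only:)
  qed
  have l2: "hr_log2 x = 3/2 * j ^ 4 - hr_const / 4 * (q\<^sup>2 * j)"
    by (simp add: hr_log2_def j_def q_def power2_eq_square power3_eq_cube)
  have l3: "hr_log3 x = hr_const / 4 * (q ^ 3 * j\<^sup>2) + hr_const / 8 * (q\<^sup>2 * j ^ 3) - 3 * j ^ 6"
    by (simp add: hr_log3_def j_def q_def eval_nat_numeral mult_ac)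
  have q2: "j\<^sup>2 \<le> q\<^sup>2" "q\<^sup>2 \<le> 105/100 * j\<^sup>2"
  proof -
    show "j\<^sup>2 \<le> q\<^sup>2" using jq j by (intro power_mono) auto
    have "q\<^sup>2 \<le> (100/98 * j)\<^sup>2" using jq qj j by (intro power_mono) auto
    also have "\<dots> \<le> 105/100 * j\<^sup>2" unfolding power_mult_distrib by (intro mult_right_mono) (auto simp: power2_eq_square)
    finally show "q\<^sup>2 \<le> 105/100 * j\<^sup>2" .
  qed
  have q3: "j ^ 3 \<le> q ^ 3" "q ^ 3 \<le> 107/100 * j ^ 3"
  proof -
    show "j ^ 3 \<le> q ^ 3" using jq j by (intro power_mono) auto
    have "q ^ 3 \<le> (100/98 * j) ^ 3" using jq qj j by (intro power_mono) auto
    also have "\<dots> \<le> 107/100 * j ^ 3" unfolding power_mult_distrib using j by (intro mult_right_mono) (auto simp: power3_eq_cube)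
    finally show "q ^ 3 \<le> 107/100 * j ^ 3" .
  qed
  have j4: "j ^ 4 \<le> 1/34 * j ^ 3" using mult_right_mono[OF j(2), of "j ^ 3"] j by (simp add: eval_nat_numeral)
  have j6: "j ^ 6 \<le> 1/34 * j ^ 5" using mult_right_mono[OF j(2), of "j ^ 5"] j by (simp add: eval_nat_numeral)
  have pos: "0 < j ^ 3" "0 < j ^ 5" "0 < j ^ 4" "0 < j ^ 6" using j by simp_all
  have a1: "64/100 * j ^ 3 \<le> hr_const / 4 * (q\<^sup>2 * j)"
  proof -
    have "256/100 / 4 * (j\<^sup>2 * j) \<le> hr_const / 4 * (q\<^sup>2 * j)"
      using hr_const_bounds q2 j jq by (intro mult_mono) auto
    then show ?thesis by (simp add: eval_nat_numeral)
  qed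
  have a2: "hr_const / 4 * (q\<^sup>2 * j) \<le> 68/100 * j ^ 3"
  proof -
    have "hr_const / 4 * (q\<^sup>2 * j) \<le> 257/100 / 4 * (105/100 * j\<^sup>2 * j)"
      using hr_const_bounds q2 j jq by (intro mult_mono) auto
    also have "\<dots> = 257/100 / 4 * (105/100) * j ^ 3" by (simp add: eval_nat_numeral)
    also have "\<dots> \<le> 68/100 * j ^ 3" using pos by (intro mult_right_mono) auto
    finally show ?thesis .
  qed
  show "59/100 * hr_J x ^ 3 \<le> - hr_log2 x" "- hr_log2 x \<le> 7/10 * hr_J x ^ 3"
    unfolding l2 j_def [symmetric] using a1 a2 j4 pos by linarith+
  have b1: "64/100 * j ^ 5 \<le> hr_const / 4 * (q ^ 3 * j\<^sup>2)"
  proof -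
    have "256/100 / 4 * (j ^ 3 * j\<^sup>2) \<le> hr_const / 4 * (q ^ 3 * j\<^sup>2)"
      using hr_const_bounds q3 j jq by (intro mult_mono) auto
    then show ?thesis by (simp add: eval_nat_numeral)
  qed
  have b2: "hr_const / 4 * (q ^ 3 * j\<^sup>2) \<le> 69/100 * j ^ 5"
  proof -
    have "hr_const / 4 * (q ^ 3 * j\<^sup>2) \<le> 257/100 / 4 * (107/100 * j ^ 3 * j\<^sup>2)"
      using hr_const_bounds q3 j jq by (intro mult_mono) auto
    also have "\<dots> = 257/100 / 4 * (107/100) * j ^ 5" by (simp add: eval_nat_numeral)
    also have "\<dots> \<le> 69/100 * j ^ 5" using pos by (intro mult_right_mono) auto
    finally show ?thesis .
  qed
  have b3: "0 \<le> hr_const / 8 * (q\<^sup>2 * j ^ 3)" using hr_const_bounds j by simp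
  have b4: "hr_const / 8 * (q\<^sup>2 * j ^ 3) \<le> 34/100 * j ^ 5"
  proof -
    have "hr_const / 8 * (q\<^sup>2 * j ^ 3) \<le> 257/100 / 8 * (105/100 * j\<^sup>2 * j ^ 3)"
      using hr_const_bounds q2 j jq by (intro mult_mono) auto
    also have "\<dots> = 257/100 / 8 * (105/100) * j ^ 5" by (simp add: eval_nat_numeral)
    also have "\<dots> \<le> 34/100 * j ^ 5" using pos by (intro mult_right_mono) auto
    finally show ?thesis .
  qed
  show "0 \<le> hr_log3 x" "hr_log3 x \<le> 11/10 * hr_J x ^ 5"
    unfolding l3 j_def [symmetric] using b1 b2 b3 b4 j6 pos by linarith+
qed

section \<open>From logarithmic differences to the discriminant\<close>

lemma one_minus_exp_bounds:
  fixes X :: real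
  assumes "0 \<le> X" "X \<le> 1/20"
  shows "95/100 * X \<le> 1 - exp (- X)" "1 - exp (- X) \<le> X"
proof -
  show "1 - exp (- X) \<le> X" using exp_ge_add_one_self[of "-X"] by linarith
  have "exp (- X) * (1 + X) \<le> exp (- X) * exp X" using exp_ge_add_one_self[of X] by (intro mult_left_mono) auto
  also have "\<dots> = 1" by (simp add: exp_minus)
  finally have "exp (- X) \<le> 1 / (1 + X)" using assms by (simp add: pos_le_divide_eq)
  also have "\<dots> \<le> 1 - 95/100 * X"
  proof -
    have "0 \<le> X * (1/20 - 95/100 * X)" using assms by (intro mult_nonneg_nonneg) auto
    then have "1 \<le> (1 - 95/100 * X) * (1 + X)" by (simp add: algebra_simps)
    then show ?thesis using assms by (simp add: pos_divide_le_eq)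
  qed
  finally show "95/100 * X \<le> 1 - exp (- X)" by simp
qed

text \<open>\<open>4 a b - (a + b - a b)^2 = a b (2 (a + b) - a b) - (a - b)^2\<close>. The first
  part is at least \<open>3/8 \<tau>^9\<close>, the second at most \<open>10.24 \<tau>^10\<close>;
  the bound \<open>\<tau> \<le> 1/34\<close> decides, as 10.24 / 34 < 3/8.\<close>

lemma turan_discriminant_pos:
  fixes a b \<tau> :: real
  assumes \<tau>: "0 < \<tau>" "\<tau> \<le> 1/34"
    and a: "\<tau> ^ 3 / 2 \<le> a" "a \<le> \<tau> ^ 3" and b: "\<tau> ^ 3 / 2 \<le> b" "b \<le> \<tau> ^ 3"
    and ab: "\<bar>a - b\<bar> \<le> 32/10 * \<tau> ^ 5"
  shows "(1 - (1 - a) * (1 - b))\<^sup>2 < 4 * a * b"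
proof -
  have t3: "0 < \<tau> ^ 3" using \<tau> by simp
  have pos: "0 < a" "0 < b" using a b t3 by linarith+
  have "(a - b)\<^sup>2 \<le> (32/10 * \<tau> ^ 5)\<^sup>2" using ab by (metis abs_ge_zero power2_abs power_mono)
  also have "\<dots> = 1024/100 * (\<tau> * \<tau> ^ 9)" by (simp add: power2_eq_square eval_nat_numeral)
  also have "\<dots> \<le> 1024/100 * (1/34 * \<tau> ^ 9)" using \<tau> by (intro mult_left_mono mult_right_mono) auto
  finally have d: "(a - b)\<^sup>2 \<le> 1024/3400 * \<tau> ^ 9" by simp
  have ab_ge: "\<tau> ^ 6 / 4 \<le> a * b"
    using mult_mono[OF a(1) b(1)] pos t3 by (simp add: eval_nat_numeral)
  have "a * b \<le> a * 1"
  proof (intro mult_left_mono)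
    have "\<tau> ^ 3 \<le> 1 ^ 3" using \<tau> by (intro power_mono) auto
    then show "b \<le> 1" using b by simp
  qed (use pos in auto)
  then have "3/2 * \<tau> ^ 3 \<le> 2 * (a + b) - a * b" using a b by simp
  then have "\<tau> ^ 6 / 4 * (3/2 * \<tau> ^ 3) \<le> a * b * (2 * (a + b) - a * b)"
    using ab_ge pos t3 by (intro mult_mono) auto
  then have "3/8 * \<tau> ^ 9 \<le> a * b * (2 * (a + b) - a * b)" by (simp add: eval_nat_numeral)
  moreover have "0 < \<tau> ^ 9" using \<tau> by simp
  ultimately have "(a - b)\<^sup>2 < a * b * (2 * (a + b) - a * b)" using d by linarith
  then show ?thesis by (simp add: power2_eq_square algebra_simps)
qed

text \<open>Dividing by \<open>(a1 a2)^2\<close> leaves only the ratios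
  \<open>a0 a2 / a1^2 = exp (- X)\<close> and \<open>a1 a3 / a2^2 = exp (- Y)\<close>, and the claim
  becomes \<open>turan_discriminant_pos\<close>.\<close>

theorem turan_num_partitions_large:
  assumes n: "1201 \<le> n"
  defines "a0 \<equiv> real (num_partitions (n - 1))" and "a1 \<equiv> real (num_partitions n)"
    and "a2 \<equiv> real (num_partitions (n + 1))" and "a3 \<equiv> real (num_partitions (n + 2))"
  shows "(a1 * a2 - a0 * a3)\<^sup>2 < 4 * (a1\<^sup>2 - a0 * a2) * (a2\<^sup>2 - a1 * a3)"
proof -
  define N where "N = real n - 1/24"
  define k where "k = n - 1"
  define w where "w = sqrt (N - 1)"
  define \<tau> where "\<tau> = 1 / w"
  have N1: "1199 + 9/10 \<le> N - 1" using n by (simp add: N_def)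
  then have w: "34 \<le> w" "w\<^sup>2 = N - 1" unfolding w_def by (auto intro!: real_le_rsqrt)
  have \<tau>: "0 < \<tau>" "\<tau> \<le> 1/34" using w by (auto simp: \<tau>_def field_simps)
  define C where "C = ln (sqrt 3 / 12 / hr_const)"
  define l where "l m = ln (real (num_partitions m))" for m
  \<comment> \<open>The error of the asymptotic formula. Only its size is known, so its differences
    are bounded by the triangle inequality.\<close>
  define e where "e m = l m - (C + hr_log (real m - 1/24))" for m
  have p_pos: "0 < num_partitions m" if "1200 \<le> m" for m using ln_num_partitions_approx(1)[OF that] .
  have e_le: "\<bar>e m\<bar> \<le> \<tau> ^ 5 / 4" if "k \<le> m" for m
  proof -
    have m: "1200 \<le> m" "real n - 1 \<le> real m" using that n by (auto simp: k_def)
    have "\<bar>e m\<bar> \<le> 1 / (4 * sqrt (real m - 1/24) ^ 5)"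
      using ln_num_partitions_approx(2)[OF m(1)] by (simp add: e_def l_def C_def)
    also have "\<dots> \<le> 1 / (4 * w ^ 5)"
    proof -
      have "w \<le> sqrt (real m - 1/24)" unfolding w_def using m by (simp add: N_def)
      then have "w ^ 5 \<le> sqrt (real m - 1/24) ^ 5" using w by (intro power_mono) auto
      moreover have "0 < w ^ 5" using w by simp
      ultimately show ?thesis by (intro divide_left_mono mult_pos_pos) linarith+
    qed
    finally show ?thesis by (simp add: \<tau>_def power_one_over)
  qed
  \<comment> \<open>All mean value points lie in a window of length 3, over which
    \<open>sqrt\<close> varies by less than the factor 1.002.\<close>
  have J: "\<tau> / (1002/1000) \<le> hr_J \<xi>" "hr_J \<xi> \<le> \<tau>" if "N - 1 \<le> \<xi>" "\<xi> \<le> N + 2" for \<xi>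
  proof -
    have 1: "w \<le> sqrt \<xi>" unfolding w_def using that by simp
    have "\<xi> \<le> (1002/1000 * w)\<^sup>2" using that w N1 by (simp add: power_mult_distrib power2_eq_square)
    then have 2: "sqrt \<xi> \<le> 1002/1000 * w" using w by (intro real_le_lsqrt) auto
    have "inverse (1002/1000 * w) \<le> inverse (sqrt \<xi>)" using 1 2 w that N1 by (intro le_imp_inverse_le) auto
    then show "\<tau> / (1002/1000) \<le> hr_J \<xi>" by (simp add: hr_J_def \<tau>_def inverse_eq_divide)
    have "inverse (sqrt \<xi>) \<le> inverse w" using 1 w by (intro le_imp_inverse_le) auto
    then show "hr_J \<xi> \<le> \<tau>" by (simp add: hr_J_def \<tau>_def inverse_eq_divide)
  qed
  have ge34: "34\<^sup>2 \<le> \<xi>" "1 \<le> \<xi>" if "N - 1 \<le> \<xi>" for \<xi> using that N1 by auto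
  have second: "585/1000 * \<tau> ^ 3 \<le> - (hr_log (t + 2) - 2 * hr_log (t + 1) + hr_log t)"
      "- (hr_log (t + 2) - 2 * hr_log (t + 1) + hr_log t) \<le> 7/10 * \<tau> ^ 3"
    if t: "N - 1 \<le> t" "t \<le> N" for t
  proof -
    obtain \<xi> where \<xi>: "t \<le> \<xi>" "\<xi> \<le> t + 2" "hr_log (t + 2) - 2 * hr_log (t + 1) + hr_log t = hr_log2 \<xi>"
    proof (rule second_difference_MVT[of t hr_log hr_log1 hr_log2])
      show "(hr_log has_real_derivative hr_log1 u) (at u)" "(hr_log1 has_real_derivative hr_log2 u) (at u)"
        if "t \<le> u" "u \<le> t + 2" for u
        using that t ge34[of u] by (auto intro!: hr_log_derivs)
    qed
    have Ns: "N - 1 \<le> \<xi>" "\<xi> \<le> N + 2" using \<xi> t by auto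
    note b = hr_log_deriv_bounds[OF ge34(1)[OF Ns(1)]]
    have "0 \<le> hr_J \<xi>" by (rule order.trans[OF _ J(1)[OF Ns]]) (use \<tau> in simp)
    then have "hr_J \<xi> ^ 3 \<le> \<tau> ^ 3" using J[OF Ns] by (intro power_mono)
    then show "- (hr_log (t + 2) - 2 * hr_log (t + 1) + hr_log t) \<le> 7/10 * \<tau> ^ 3" using b(2) \<xi>(3) by linarith
    have "(\<tau> / (1002/1000)) ^ 3 \<le> hr_J \<xi> ^ 3" using J[OF Ns] \<tau> by (intro power_mono) auto
    moreover have "(\<tau> / (1002/1000)) ^ 3 = \<tau> ^ 3 * (1 / (1002/1000) ^ 3)" by (simp add: power_divide)
    moreover have "\<tau> ^ 3 * (993/1000) \<le> \<tau> ^ 3 * (1 / (1002/1000) ^ 3)"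
      using \<tau> by (intro mult_left_mono) (auto simp: power3_eq_cube)
    ultimately have "993/1000 * \<tau> ^ 3 \<le> hr_J \<xi> ^ 3" by linarith
    moreover have "0 < \<tau> ^ 3" using \<tau> by simp
    ultimately show "585/1000 * \<tau> ^ 3 \<le> - (hr_log (t + 2) - 2 * hr_log (t + 1) + hr_log t)" using b(1) \<xi>(3) by linarith
  qed
  have third: "\<bar>hr_log (N + 2) - 3 * hr_log (N + 1) + 3 * hr_log N - hr_log (N - 1)\<bar> \<le> 11/10 * \<tau> ^ 5"
  proof -
    obtain \<xi> where \<xi>: "N - 1 \<le> \<xi>" "\<xi> \<le> N - 1 + 3"
        "hr_log (N - 1 + 3) - 3 * hr_log (N - 1 + 2) + 3 * hr_log (N - 1 + 1) - hr_log (N - 1) = hr_log3 \<xi>"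
    proof (rule third_difference_MVT[of "N - 1" hr_log hr_log1 hr_log2 hr_log3])
      show "(hr_log has_real_derivative hr_log1 u) (at u)" "(hr_log1 has_real_derivative hr_log2 u) (at u)"
        "(hr_log2 has_real_derivative hr_log3 u) (at u)"
        if "N - 1 \<le> u" "u \<le> N - 1 + 3" for u
        using that ge34[of u] by (auto intro!: hr_log_derivs)
    qed
    have Ns: "N - 1 \<le> \<xi>" "\<xi> \<le> N + 2" using \<xi> by auto
    note b = hr_log_deriv_bounds[OF ge34(1)[OF Ns(1)]]
    have "0 \<le> hr_J \<xi>" by (rule order.trans[OF _ J(1)[OF Ns]]) (use \<tau> in simp)
    then have "hr_J \<xi> ^ 5 \<le> \<tau> ^ 5" using J[OF Ns] by (intro power_mono)
    then have "\<bar>hr_log3 \<xi>\<bar> \<le> 11/10 * \<tau> ^ 5" using b(3,4) by linarith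
    moreover have "N - 1 + 3 = N + 2" "N - 1 + 2 = N + 1" "N - 1 + 1 = N" by simp_all
    ultimately show ?thesis using \<xi>(3) by metis
  qed
  have t5: "\<tau> ^ 5 \<le> 1/1000 * \<tau> ^ 3"
  proof -
    have "\<tau>\<^sup>2 \<le> (1/34)\<^sup>2" using \<tau> by (intro power_mono) auto
    then have "\<tau>\<^sup>2 * \<tau> ^ 3 \<le> 1/1000 * \<tau> ^ 3" using \<tau> by (intro mult_right_mono) (auto simp: power2_eq_square)
    then show ?thesis by (simp add: eval_nat_numeral)
  qed
  have t3: "0 < \<tau> ^ 3" "\<tau> ^ 3 \<le> 1/20"
  proof -
    show "0 < \<tau> ^ 3" using \<tau> by simp
    have "\<tau> ^ 3 \<le> (1/34) ^ 3" using \<tau> by (intro power_mono) auto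
    then show "\<tau> ^ 3 \<le> 1/20" by (simp add: power3_eq_cube)
  qed
  define X Y where "X = 2 * l n - l k - l (n + 1)" and "Y = 2 * l (n + 1) - l n - l (n + 2)"
  have l_eq: "l k = C + hr_log (N - 1) + e k" "l n = C + hr_log N + e n"
      "l (n + 1) = C + hr_log (N + 1) + e (n + 1)" "l (n + 2) = C + hr_log (N + 2) + e (n + 2)"
  proof -
    have "real k - 1/24 = N - 1" "real (n + 1) - 1/24 = N + 1" "real (n + 2) - 1/24 = N + 2"
      using n by (simp_all add: N_def k_def)
    then show "l k = C + hr_log (N - 1) + e k" "l n = C + hr_log N + e n"
      "l (n + 1) = C + hr_log (N + 1) + e (n + 1)" "l (n + 2) = C + hr_log (N + 2) + e (n + 2)"
      by (simp_all add: e_def N_def)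
  qed
  have es: "\<bar>e k\<bar> \<le> \<tau> ^ 5 / 4" "\<bar>e n\<bar> \<le> \<tau> ^ 5 / 4" "\<bar>e (n + 1)\<bar> \<le> \<tau> ^ 5 / 4" "\<bar>e (n + 2)\<bar> \<le> \<tau> ^ 5 / 4"
    by (intro e_le; simp add: k_def)+
  note es' = es[THEN abs_le_D1] es[THEN abs_le_D2]
  have N_le: "N - 1 \<le> N" by simp
  have "N - 1 + 2 = N + 1" "N - 1 + 1 = N" by simp_all
  note second' = second[OF order_refl N_le, unfolded this]
  have X: "55/100 * \<tau> ^ 3 \<le> X" "X \<le> \<tau> ^ 3"
    using second' es' t5 t3 unfolding X_def l_eq by argo+
  have Y: "55/100 * \<tau> ^ 3 \<le> Y" "Y \<le> \<tau> ^ 3"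
    using second[OF N_le order_refl] es' t5 t3 unfolding Y_def l_eq by argo+
  have "X - Y = (hr_log (N + 2) - 3 * hr_log (N + 1) + 3 * hr_log N - hr_log (N - 1)) +
      (e (n + 2) - 3 * e (n + 1) + 3 * e n - e k)"
    unfolding X_def Y_def l_eq by (simp add: algebra_simps)
  \<comment> \<open>The errors enter with coefficients 1, 3, 3, 1 and add 8/4 to the 11/10 of the
    main term; 32/10 rounds up the total.\<close>
  then have XY: "\<bar>X - Y\<bar> \<le> 32/10 * \<tau> ^ 5"
    using third es \<tau> zero_less_power[OF \<tau>(1), of 5] by linarith
  define a b where "a = 1 - exp (- X)" and "b = 1 - exp (- Y)"
  have X20: "0 \<le> X" "X \<le> 1/20" and Y20: "0 \<le> Y" "Y \<le> 1/20" using X Y t3 by linarith+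
  have a: "\<tau> ^ 3 / 2 \<le> a" "a \<le> \<tau> ^ 3" using one_minus_exp_bounds[OF X20] X t3 by (auto simp: a_def)
  have b: "\<tau> ^ 3 / 2 \<le> b" "b \<le> \<tau> ^ 3" using one_minus_exp_bounds[OF Y20] Y t3 by (auto simp: b_def)
  have lip: "exp (- u) - exp (- v) \<le> v - u" if "0 \<le> u" "u \<le> v" for u v :: real
  proof -
    have "exp (- u) - exp (- v) = exp (- u) * (1 - exp (- (v - u)))"
      by (simp add: algebra_simps exp_add [symmetric] exp_diff [symmetric])
    moreover have "1 - exp (- (v - u)) \<le> v - u" using exp_ge_add_one_self[of "- (v - u)"] by linarith
    then have "exp (- u) * (1 - exp (- (v - u))) \<le> 1 * (v - u)" using that by (intro mult_mono) auto
    ultimately show ?thesis by simp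
  qed
  have ab: "\<bar>a - b\<bar> \<le> 32/10 * \<tau> ^ 5"
  proof -
    have "\<bar>a - b\<bar> \<le> \<bar>X - Y\<bar>"
      using lip[of X Y] lip[of Y X] X20 Y20 by (cases "X \<le> Y") (auto simp: a_def b_def)
    then show ?thesis using XY by linarith
  qed
  have main: "(1 - (1 - a) * (1 - b))\<^sup>2 < 4 * a * b"
    by (rule turan_discriminant_pos[OF \<tau> a b ab])
  have ps: "0 < a0" "0 < a1" "0 < a2" "0 < a3"
    using p_pos[of k] p_pos[of n] p_pos[of "n + 1"] p_pos[of "n + 2"] n by (auto simp: k_def a0_def a1_def a2_def a3_def)
  have exp_l: "exp (l k) = a0" "exp (l n) = a1" "exp (l (n + 1)) = a2" "exp (l (n + 2)) = a3"
    using ps unfolding l_def k_def a0_def a1_def a2_def a3_def by simp_all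
  have "- X = l k + l (n + 1) - 2 * l n" by (simp add: X_def)
  then have u: "1 - a = a0 * a2 / a1\<^sup>2" by (simp only: a_def exp_diff exp_add exp_double exp_l)
  have "- Y = l n + l (n + 2) - 2 * l (n + 1)" by (simp add: Y_def)
  then have v: "1 - b = a1 * a3 / a2\<^sup>2" by (simp only: b_def exp_diff exp_add exp_double exp_l)
  have "a = 1 - a0 * a2 / a1\<^sup>2" "b = 1 - a1 * a3 / a2\<^sup>2" using u v by linarith+
  then have ab_eq: "a1\<^sup>2 * a = a1\<^sup>2 - a0 * a2" "a2\<^sup>2 * b = a2\<^sup>2 - a1 * a3" using ps by (simp_all add: field_simps)
  have "a1 * a2 * (1 - (1 - a) * (1 - b)) = a1 * a2 - a0 * a3"
    unfolding u v using ps by (simp add: field_simps power2_eq_square)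
  then have "(a1 * a2 - a0 * a3)\<^sup>2 = (a1 * a2)\<^sup>2 * (1 - (1 - a) * (1 - b))\<^sup>2" by (metis power_mult_distrib)
  also have "\<dots> < (a1 * a2)\<^sup>2 * (4 * a * b)" using main ps by (intro mult_strict_left_mono) auto
  also have "\<dots> = 4 * (a1\<^sup>2 * a) * (a2\<^sup>2 * b)" by (simp add: power_mult_distrib)
  finally show "(a1 * a2 - a0 * a3)\<^sup>2 < 4 * (a1\<^sup>2 - a0 * a2) * (a2\<^sup>2 - a1 * a3)" unfolding ab_eq .
qed

section \<open>The finite check\<close>

text \<open>Extension by 0 to negative arguments states the pentagonal recurrence without case
  distinctions or truncated subtraction.\<close>

definition num_partitions_int :: "int \<Rightarrow> int" where
  "num_partitions_int i = (if i < 0 then 0 else int (num_partitions (nat i)))"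

text \<open>Coefficient \<open>m\<close> of \<open>euler_fps * partition_fps = 1\<close>, where
  \<open>pent_sum m\<close> already has the right coefficients up to degree
  \<open>m\<close>.\<close>

lemma pent_recurrence:
  assumes "m > 0"
  shows "num_partitions_int (int m) = (\<Sum>j=1..m. (-1) ^ Suc j *
    (num_partitions_int (int m - int (pent_minus j)) + num_partitions_int (int m - int (pent_plus j))))"
proof -
  have X_nth: "fps_nth (fps_X ^ a * partition_fps) m = of_int (num_partitions_int (int m - int a))" for a
    by (simp add: fps_X_power_mult_nth partition_fps_def num_partitions_int_def nat_diff_distrib' of_nat_diff nat_int_add)
  have "fps_nth (pent_sum m fps_X * partition_fps) m = fps_nth (euler_fps * partition_fps) m"
    unfolding fps_mult_nth by (intro sum.cong) (auto simp: fps_nth_pent_sum)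
  also have "\<dots> = 0" using assms by (simp add: euler_fps_times_partition_fps)
  finally have "0 = fps_nth (pent_sum m fps_X * partition_fps) m" by simp
  also have "\<dots> = fps_nth partition_fps m + (\<Sum>j=1..m. (-1) ^ j *
      (fps_nth (fps_X ^ pent_minus j * partition_fps) m + fps_nth (fps_X ^ pent_plus j * partition_fps) m))"
    unfolding pent_sum_def distrib_right sum_distrib_right fps_add_nth fps_sum_nth mult.assoc
      fps_nth_uminus_one_power_mult by (simp add: distrib_right)
  also have "\<dots> = of_int (num_partitions_int (int m) + (\<Sum>j=1..m. (-1) ^ j *
      (num_partitions_int (int m - int (pent_minus j)) + num_partitions_int (int m - int (pent_plus j)))))"
    unfolding X_nth by (simp add: partition_fps_def num_partitions_int_def)
  finally have "num_partitions_int (int m) + (\<Sum>j=1..m. (-1) ^ j *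
      (num_partitions_int (int m - int (pent_minus j)) + num_partitions_int (int m - int (pent_plus j)))) = 0"
    by (metis of_int_eq_0_iff)
  then show ?thesis by (simp add: sum_negf)
qed

text \<open>The alternating sum over the generalised pentagonal numbers, starting at the \<open>k\<close>-th pair; the second
  argument is the original argument minus the first member of this pair.\<close>

function pent_tail :: "int \<Rightarrow> int \<Rightarrow> int" where
  "pent_tail k s = (if s < 0 \<or> k < 1 then 0
     else num_partitions_int s + num_partitions_int (s - k) - pent_tail (k + 1) (s - 3 * k - 1))"
  by auto
termination by (relation "Wellfounded.measure (\<lambda>(k, s). nat (s + 1))") auto

declare pent_tail.simps [simp del]

lemma pent_minus_Suc: "int (pent_minus (Suc k)) = int (pent_plus k) + 2 * int k + 1"
  and pent_plus_Suc: "int (pent_plus (Suc k)) = int (pent_minus (Suc k)) + int k + 1"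
  by (simp_all add: pent_minus_def pent_plus_def algebra_simps)

lemma pent_minus_mono: "i \<le> j \<Longrightarrow> pent_minus i \<le> pent_minus j"
proof (induction j rule: dec_induct)
  case (step j)
  have "pent_minus j \<le> pent_plus j" by (cases j) (simp_all add: pent_minus_def pent_plus_def)
  then show ?case using step.IH pent_minus_Suc[of j] by linarith
qed simp

text \<open>Downward induction on \<open>k\<close>. The members of the \<open>k\<close>-th pair
  differ by \<open>k\<close> and consecutive values of \<open>pent_minus\<close> by
  \<open>3 k + 1\<close>, which are the shifts in \<open>pent_tail\<close>.\<close>

lemma pent_tail_eq_sum:
  assumes "k \<le> m"
  shows "pent_tail (int k + 1) (int m - int (pent_minus (Suc k))) = (\<Sum>j=Suc k..m. (-1) ^ (j - Suc k) *
    (num_partitions_int (int m - int (pent_minus j)) + num_partitions_int (int m - int (pent_plus j))))"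
  using assms
proof (induction k rule: inc_induct)
  case base
  have "int m < int (pent_minus (Suc m))" using pent_minus_ge[of "Suc m"] by linarith
  then show ?case by (subst pent_tail.simps) simp
next
  case (step k)
  have e1: "int m - int (pent_minus (Suc k)) - (int k + 1) = int m - int (pent_plus (Suc k))"
    by (simp add: pent_plus_Suc)
  have e2: "int m - int (pent_minus (Suc k)) - 3 * (int k + 1) - 1 = int m - int (pent_minus (Suc (Suc k)))"
    unfolding pent_minus_Suc[of "Suc k"] pent_plus_Suc by simp
  show ?case
  proof (cases "int m < int (pent_minus (Suc k))")
    case less: True
    have "num_partitions_int (int m - int (pent_minus j)) = 0" "num_partitions_int (int m - int (pent_plus j)) = 0"
      if "j \<in> {Suc k..m}" for j
    proof -
      have "pent_minus (Suc k) \<le> pent_minus j" using that by (intro pent_minus_mono) auto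
      moreover have "pent_minus j \<le> pent_plus j" by (cases j) (simp_all add: pent_minus_def pent_plus_def)
      ultimately show "num_partitions_int (int m - int (pent_minus j)) = 0" "num_partitions_int (int m - int (pent_plus j)) = 0"
        using less by (auto simp: num_partitions_int_def)
    qed
    then show ?thesis using less by (subst pent_tail.simps) simp
  next
    case False
    then have "pent_tail (int k + 1) (int m - int (pent_minus (Suc k))) =
      num_partitions_int (int m - int (pent_minus (Suc k))) + num_partitions_int (int m - int (pent_plus (Suc k)))
       - pent_tail (int (Suc k) + 1) (int m - int (pent_minus (Suc (Suc k))))"
      by (subst pent_tail.simps) (simp only: e1 e2, simp add: add_ac)
    also have "pent_tail (int (Suc k) + 1) (int m - int (pent_minus (Suc (Suc k)))) =
       (\<Sum>j=Suc (Suc k)..m. (-1) ^ (j - Suc (Suc k)) *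
        (num_partitions_int (int m - int (pent_minus j)) + num_partitions_int (int m - int (pent_plus j))))"
      by (rule step.IH)
    also have "\<dots> = - (\<Sum>j=Suc (Suc k)..m. (-1) ^ (j - Suc k) *
        (num_partitions_int (int m - int (pent_minus j)) + num_partitions_int (int m - int (pent_plus j))))"
      unfolding sum_negf [symmetric]
    proof (intro sum.cong refl)
      fix j assume "j \<in> {Suc (Suc k)..m}"
      then have "j - Suc k = Suc (j - Suc (Suc k))" by auto
      then show "(-1) ^ (j - Suc (Suc k)) * (num_partitions_int (int m - int (pent_minus j)) + num_partitions_int (int m - int (pent_plus j))) =
        - ((-1) ^ (j - Suc k) * (num_partitions_int (int m - int (pent_minus j)) + num_partitions_int (int m - int (pent_plus j))))"
        by simp
    qed
    finally show ?thesis using step.hyps by (subst sum.atLeast_Suc_atMost) auto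
  qed
qed

lemma num_partitions_int_rec:
  assumes "m \<ge> 1" shows "num_partitions_int m = pent_tail 1 (m - 1)"
proof -
  define M where "M = nat m"
  have m: "m = int M" "M > 0" using assms by (auto simp: M_def)
  have "num_partitions_int m = (\<Sum>j=1..M. (-1) ^ Suc j *
    (num_partitions_int (int M - int (pent_minus j)) + num_partitions_int (int M - int (pent_plus j))))"
    unfolding m by (rule pent_recurrence) (use m in simp)
  also have "\<dots> = (\<Sum>j=Suc 0..M. (-1) ^ (j - Suc 0) *
    (num_partitions_int (int M - int (pent_minus j)) + num_partitions_int (int M - int (pent_plus j))))"
  proof (intro sum.cong)
    fix j assume "j \<in> {Suc 0..M}"
    then have "Suc j = Suc (Suc (j - Suc 0))" by auto
    then have "(-1) ^ Suc j = (-1 :: int) ^ (j - Suc 0)" by (metis minus_one_power_iff even_Suc)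
    then show "(-1) ^ Suc j * (num_partitions_int (int M - int (pent_minus j)) + num_partitions_int (int M - int (pent_plus j))) =
      (-1) ^ (j - Suc 0) * (num_partitions_int (int M - int (pent_minus j)) + num_partitions_int (int M - int (pent_plus j)))"
      by simp
  qed simp
  also have "\<dots> = pent_tail 1 (m - 1)"
    using pent_tail_eq_sum[of 0 M] m by (simp add: pent_minus_def)
  finally show ?thesis .
qed

section \<open>Comparison on leading bits\<close>

definition shifted :: "nat \<Rightarrow> int \<Rightarrow> int" where "shifted k a = a div 2 ^ k"

definition turan_test :: "int \<Rightarrow> int \<Rightarrow> int \<Rightarrow> bool" where
  "turan_test u v w \<longleftrightarrow> 0 < u \<and> 0 < v \<and> w * w < 4 * (u * v)"

text \<open>Every true value, divided by a common power of two, lies in \<open>[b, b + e]\<close>.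
  The first two arguments of \<open>turan_test\<close> are therefore lower bounds and the third is
  an upper bound.\<close>

definition turan_interval_test :: "int \<Rightarrow> int \<Rightarrow> int \<Rightarrow> int \<Rightarrow> int \<Rightarrow> bool" where
  "turan_interval_test e b0 b1 b2 b3 \<longleftrightarrow>
     turan_test (b1 * b1 - (b0 + e) * (b2 + e)) (b2 * b2 - (b1 + e) * (b3 + e)) ((b1 + e) * (b2 + e) - b0 * b3)"

text \<open>At most about 45 leading bits are kept, with thresholds chosen so that \<open>turan_test\<close> still succeeds.\<close>

definition shift_amount :: "int \<Rightarrow> nat" where
  "shift_amount m = (if m < 165 then 0 else if m < 262 then 10 else if m < 380 then 20 else if m < 510 then 30
     else if m < 660 then 40 else if m < 825 then 50 else if m < 1005 then 60 else 70)"

definition shift_error :: "int \<Rightarrow> int" where "shift_error m = (if m < 165 then 0 else 1)"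

text \<open>Indexed by the largest of the four arguments, \<open>m = n + 2\<close>, so that all
  values are known when the check runs; \<open>n = 95\<close> corresponds to
  \<open>m = 97\<close>.\<close>

definition turan_check :: "int \<Rightarrow> bool" where
  "turan_check m \<longleftrightarrow> m < 97 \<or> turan_interval_test (shift_error m)
     (shifted (shift_amount m) (num_partitions_int (m - 3))) (shifted (shift_amount m) (num_partitions_int (m - 2)))
     (shifted (shift_amount m) (num_partitions_int (m - 1))) (shifted (shift_amount m) (num_partitions_int m))"

text \<open>Under \<open>imp_cong\<close> the simplifier turns the premise into a rewrite rule giving the value of
  \<open>num_partitions_int m\<close>, which is then available at all later arguments.\<close>

function check_range :: "int \<Rightarrow> int \<Rightarrow> bool" where
  "check_range m d \<longleftrightarrow> (0 < d \<longrightarrow> num_partitions_int m = pent_tail 1 (m - 1) \<longrightarrow>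
     turan_check m \<and> check_range (m + 1) (d - 1))"
  by auto
termination by (relation "Wellfounded.measure (\<lambda>(m, d). nat d)") auto

declare check_range.simps [simp del]

text \<open>The premise inside \<open>check_range\<close> is the valid recurrence
  \<open>num_partitions_int_rec\<close>, so it can be discharged at every step.\<close>

lemma check_range_imp_turan_check:
  assumes "check_range m d" "1 \<le> m" "m \<le> j" "j < m + d" shows "turan_check j"
  using assms
proof (induction m d rule: check_range.induct)
  case (1 m d)
  have rec: "num_partitions_int m = pent_tail 1 (m - 1)" using 1 by (intro num_partitions_int_rec) auto
  then have *: "turan_check m \<and> check_range (m + 1) (d - 1)"
    using 1(2-) by (subst (asm) check_range.simps) auto
  show ?case
  proof (cases "j = m")
    case True
    then show ?thesis using * by simp
  next
    case False
    then show ?thesis using * 1(2-) rec by (intro 1(1)) auto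
  qed
qed

section \<open>Rewrite rules for the evaluation\<close>

lemma check_range_simps:
  "check_range m 0"
  "check_range m 1 \<longleftrightarrow> (num_partitions_int m = pent_tail 1 (m - 1) \<longrightarrow> turan_check m)"
  "check_range m (numeral d) \<longleftrightarrow> (num_partitions_int m = pent_tail 1 (m - 1) \<longrightarrow>
     turan_check m \<and> check_range (m + 1) (numeral d - 1))"
proof -
  show *: "check_range m 0" for m by (subst check_range.simps) simp
  show "check_range m 1 \<longleftrightarrow> (num_partitions_int m = pent_tail 1 (m - 1) \<longrightarrow> turan_check m)"
    by (subst check_range.simps) (simp add: *)
  show "check_range m (numeral d) \<longleftrightarrow> (num_partitions_int m = pent_tail 1 (m - 1) \<longrightarrow>
     turan_check m \<and> check_range (m + 1) (numeral d - 1))"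
    by (subst check_range.simps) simp
qed

lemma num_partitions_int_neg: "i < 0 \<Longrightarrow> num_partitions_int i = 0"
  by (simp add: num_partitions_int_def)

lemma pent_tail_neg: "s < 0 \<Longrightarrow> pent_tail k s = 0"
  by (subst pent_tail.simps) simp

lemma pent_tail_nonneg:
  assumes "1 \<le> k" "0 \<le> s"
  shows "pent_tail k s = num_partitions_int s + num_partitions_int (s - k) - pent_tail (k + 1) (s - 3 * k - 1)"
  using assms by (subst pent_tail.simps) simp

text \<open>The numeral patterns decide the guard \<open>s < 0\<close> syntactically, so rewriting
  unfolds only evaluated arguments and stops at negative ones.\<close>

lemma pent_tail_simps:
  "pent_tail k (- 1) = 0"
  "pent_tail k (- numeral s) = 0"
  "pent_tail 1 0 = num_partitions_int 0"
  "pent_tail 1 1 = num_partitions_int 1 + num_partitions_int 0"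
  "pent_tail 1 (numeral s) = num_partitions_int (numeral s) + num_partitions_int (numeral s - 1) - pent_tail 2 (numeral s - 4)"
  "pent_tail (numeral l) 0 = num_partitions_int 0"
  "pent_tail (numeral l) 1 = num_partitions_int 1 + num_partitions_int (1 - numeral l)"
  "pent_tail (numeral l) (numeral s) = num_partitions_int (numeral s) + num_partitions_int (numeral s - numeral l)
     - pent_tail (numeral l + 1) (numeral s - 3 * numeral l - 1)"
proof -
  show "pent_tail 1 (numeral s) =
      num_partitions_int (numeral s) + num_partitions_int (numeral s - 1) - pent_tail 2 (numeral s - 4)"
    using pent_tail_nonneg[of 1 "numeral s"] by (simp only: diff_diff_eq) simp
  show "pent_tail (numeral l) 1 = num_partitions_int 1 + num_partitions_int (1 - numeral l)"
  proof -
    have "1 - 3 * numeral l - 1 < (0::int)" using zero_less_numeral[of l, where ?'a = int] by linarith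
    then show ?thesis using pent_tail_nonneg[of "numeral l" 1] by (simp only: pent_tail_neg)
  qed
qed (simp_all add: pent_tail_neg pent_tail_nonneg num_partitions_int_neg)

lemma num_partitions_int_simps:
  "num_partitions_int 0 = 1" "num_partitions_int (- 1) = 0" "num_partitions_int (- numeral k) = 0"
proof -
  have "partitions 0 = {[]}" using bounded_partitions_eq[of 0 0] by (simp add: bounded_partitions_0)
  then show "num_partitions_int 0 = 1" by (simp add: num_partitions_int_def num_partitions_def)
qed (simp_all add: num_partitions_int_def)

text \<open>Halving a binary numeral drops its last digit.\<close>

lemma shifted_simps:
  "shifted 0 x = x"
  "shifted 1 (numeral (Num.Bit0 a)) = numeral a"
  "shifted 1 (numeral (Num.Bit1 a)) = numeral a"
  "shifted (numeral k) (numeral (Num.Bit0 a)) = shifted (pred_numeral k) (numeral a)"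
  "shifted (numeral k) (numeral (Num.Bit1 a)) = shifted (pred_numeral k) (numeral a)"
proof -
  have "(numeral (Num.Bit0 a) :: int) div 2 = numeral a" "(numeral (Num.Bit1 a) :: int) div 2 = numeral a" by simp_all
  then show "shifted (numeral k) (numeral (Num.Bit0 a)) = shifted (pred_numeral k) (numeral a)"
    "shifted (numeral k) (numeral (Num.Bit1 a)) = shifted (pred_numeral k) (numeral a)"
    by (simp_all add: shifted_def numeral_eq_Suc zdiv_zmult2_eq)
qed (simp_all add: shifted_def)

text \<open>Instantiation with numerals delays the unfolding of a definition until its arguments are
  evaluated; otherwise unevaluated arguments would be duplicated.\<close>

lemmas partition_eval_simps =
  check_range_simps pent_tail_simps
  num_partitions_int_simps turan_check_def[of 1] turan_check_def[of "numeral m" for m]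
  turan_interval_test_def[of e "numeral a" "numeral b" "numeral c" "numeral d" for e a b c d]
  turan_test_def[of "numeral a" "numeral b" "numeral c" for a b c]
  shift_amount_def[of "numeral m" for m] shift_error_def[of "numeral m" for m] shifted_simps pred_numeral_simps BitM.simps
  numeral_plus_numeral numeral_times_numeral add_num_simps mult_num_simps diff_numeral_simps sub_num_simps
  arith_simps rel_simps arith_special numeral_One mult_1_right mult_1_left diff_numeral_special
  diff_self diff_0_right diff_0 add_0 add_0_right minus_zero if_True if_False simp_thms

text \<open>\<open>u P^2\<close> and \<open>v P^2\<close> bound the two factors from below and
  \<open>w P^2\<close> bounds the mixed term \<open>W\<close> from above. Squaring this upper bound
  requires \<open>0 \<le> W\<close>.\<close>

lemma turan_interval_test_sound:
  fixes a0 a1 a2 a3 b0 b1 b2 b3 e P :: int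
  assumes test: "turan_interval_test e b0 b1 b2 b3" and P: "0 < P"
    and nonneg: "0 \<le> b0" "0 \<le> b1" "0 \<le> b2" "0 \<le> b3"
    and lower: "b0 * P \<le> a0" "b1 * P \<le> a1" "b2 * P \<le> a2" "b3 * P \<le> a3"
    and upper: "a0 \<le> (b0 + e) * P" "a1 \<le> (b1 + e) * P" "a2 \<le> (b2 + e) * P" "a3 \<le> (b3 + e) * P"
  shows "(a1 * a2 - a0 * a3)\<^sup>2 < 4 * (a1\<^sup>2 - a0 * a2) * (a2\<^sup>2 - a1 * a3)"
proof -
  define u v w where "u = b1 * b1 - (b0 + e) * (b2 + e)" and "v = b2 * b2 - (b1 + e) * (b3 + e)"
    and "w = (b1 + e) * (b2 + e) - b0 * b3"
  define U V W where "U = a1\<^sup>2 - a0 * a2" and "V = a2\<^sup>2 - a1 * a3" and "W = a1 * a2 - a0 * a3"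
  have uvw: "0 < u" "0 < v" "w * w < 4 * (u * v)"
    using test by (simp_all add: turan_interval_test_def turan_test_def u_def v_def w_def)
  have bP: "0 \<le> b0 * P" "0 \<le> b1 * P" "0 \<le> b2 * P" "0 \<le> b3 * P" using nonneg P by simp_all
  then have a: "0 \<le> a0" "0 \<le> a1" "0 \<le> a2" "0 \<le> a3" using lower by linarith+
  have lo: "(b * P) * (c * P) \<le> x * y" if "0 \<le> b * P" "0 \<le> c * P" "b * P \<le> x" "c * P \<le> y" for b c x y
    using that by (intro mult_mono) auto
  have up: "x * y \<le> (b * P) * (c * P)" if "0 \<le> x" "0 \<le> y" "x \<le> b * P" "y \<le> c * P" for b c x y
    using that by (intro mult_mono) auto
  have "U \<ge> (b1 * P) * (b1 * P) - ((b0 + e) * P) * ((b2 + e) * P)"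
    unfolding U_def power2_eq_square
    using lo[OF bP(2) bP(2) lower(2) lower(2)] up[OF a(1) a(3) upper(1) upper(3)] by linarith
  then have U: "u * P\<^sup>2 \<le> U" by (simp add: u_def algebra_simps power2_eq_square)
  have "V \<ge> (b2 * P) * (b2 * P) - ((b1 + e) * P) * ((b3 + e) * P)"
    unfolding V_def power2_eq_square
    using lo[OF bP(3) bP(3) lower(3) lower(3)] up[OF a(2) a(4) upper(2) upper(4)] by linarith
  then have V: "v * P\<^sup>2 \<le> V" by (simp add: v_def algebra_simps power2_eq_square)
  have "W \<le> ((b1 + e) * P) * ((b2 + e) * P) - (b0 * P) * (b3 * P)"
    unfolding W_def
    using up[OF a(2) a(3) upper(2) upper(3)] lo[OF bP(1) bP(4) lower(1) lower(4)] by linarith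
  then have W: "W \<le> w * P\<^sup>2" by (simp add: w_def algebra_simps power2_eq_square)
  have "0 < u * P\<^sup>2" "0 < v * P\<^sup>2" using uvw P by simp_all
  then have UV: "0 < U" "0 < V" using U V by linarith+
  \<comment> \<open>Positivity of \<open>U\<close> and \<open>V\<close> gives
    \<open>a0 a1 a2 a3 \<le> (a1 a2)^2\<close>, hence \<open>a0 a3 \<le> a1 a2\<close>.\<close>
  have "0 \<le> W"
  proof (rule ccontr)
    assume "\<not> 0 \<le> W"
    then have less: "a1 * a2 < a0 * a3" by (simp add: W_def)
    have "(a0 * a2) * (a1 * a3) \<le> a1\<^sup>2 * a2\<^sup>2"
      using UV a by (intro mult_mono) (auto simp: U_def V_def)
    then have "(a1 * a2) * (a0 * a3) \<le> (a1 * a2) * (a1 * a2)" by (simp add: power2_eq_square mult_ac)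
    moreover have "a1 \<noteq> 0" "a2 \<noteq> 0" using UV a by (auto simp: U_def V_def mult_less_0_iff)
    then have "0 < a1 * a2" using a by simp
    ultimately show False using less by (simp add: mult_le_cancel_left)
  qed
  then have "W\<^sup>2 \<le> (w * P\<^sup>2)\<^sup>2" using W by (intro power_mono) auto
  also have "\<dots> = (w * w) * (P\<^sup>2)\<^sup>2" by (simp add: power2_eq_square)
  also have "\<dots> < (4 * (u * v)) * (P\<^sup>2)\<^sup>2" using uvw(3) P by (intro mult_strict_right_mono) auto
  also have "\<dots> = 4 * ((u * P\<^sup>2) * (v * P\<^sup>2))" by (simp add: power2_eq_square)
  also have "\<dots> \<le> 4 * (U * V)" using U V UV \<open>0 < v * P\<^sup>2\<close> by (intro mult_left_mono mult_mono) auto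
  finally show ?thesis by (simp only: U_def V_def W_def mult.assoc)
qed

lemma turan_check_sound:
  assumes check: "turan_check m" and m: "97 \<le> m"
  defines "a0 \<equiv> num_partitions_int (m - 3)" and "a1 \<equiv> num_partitions_int (m - 2)"
    and "a2 \<equiv> num_partitions_int (m - 1)" and "a3 \<equiv> num_partitions_int m"
  shows "(a1 * a2 - a0 * a3)\<^sup>2 < 4 * (a1\<^sup>2 - a0 * a2) * (a2\<^sup>2 - a1 * a3)"
proof -
  define k where "k = shift_amount m"
  have nonneg: "0 \<le> num_partitions_int i" for i by (simp add: num_partitions_int_def)
  have low: "shifted k a * 2 ^ k \<le> a" for a
    by (simp add: shifted_def minus_mod_eq_div_mult [symmetric])
  have up: "a \<le> (shifted k a + shift_error m) * 2 ^ k" for a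
  proof (cases "m < 165")
    case True
    then show ?thesis by (simp add: k_def shift_amount_def shift_error_def shifted_def)
  next
    case False
    have "a = shifted k a * 2 ^ k + a mod 2 ^ k" unfolding shifted_def by (rule div_mult_mod_eq [symmetric])
    also have "\<dots> \<le> shifted k a * 2 ^ k + 2 ^ k" by (simp add: order_less_imp_le)
    also have "\<dots> = (shifted k a + shift_error m) * 2 ^ k" using False by (simp add: shift_error_def distrib_right)
    finally show ?thesis .
  qed
  have nn: "0 \<le> shifted k (num_partitions_int i)" for i
    unfolding shifted_def using nonneg by (intro pos_imp_zdiv_nonneg_iff[THEN iffD2]) auto
  show ?thesis unfolding a0_def a1_def a2_def a3_def
    by (rule turan_interval_test_sound[where P = "2 ^ k" and e = "shift_error m"])
      (use check m nn low up in \<open>auto simp: turan_check_def k_def\<close>)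
qed

lemma num_partitions_pos: "0 < num_partitions n"
proof -
  have "(if n = 0 then [] else [n]) \<in> partitions n" by (simp add: partitions_def)
  then show ?thesis unfolding num_partitions_def using finite_partitions by (subst card_gt_0_iff) blast
qed

lemma check_range_1202: "check_range 1 1202"
  \<comment> \<open>The 1202 steps are implications nested inside one another, so the simplifier
    works at a depth that grows with the range.\<close>
  using [[simp_depth_limit = 10000]]
  by (simp only: partition_eval_simps cong: imp_cong)

lemma turan_num_partitions_small:
  assumes "95 \<le> n" "n \<le> 1200"
  defines "a0 \<equiv> real (num_partitions (n - 1))" and "a1 \<equiv> real (num_partitions n)"
    and "a2 \<equiv> real (num_partitions (n + 1))" and "a3 \<equiv> real (num_partitions (n + 2))"
  shows "(a1 * a2 - a0 * a3)\<^sup>2 < 4 * (a1\<^sup>2 - a0 * a2) * (a2\<^sup>2 - a1 * a3)"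
proof -
  have eq: "num_partitions_int (int n + 2 - 3) = int (num_partitions (n - 1))"
    "num_partitions_int (int n + 2 - 2) = int (num_partitions n)"
    "num_partitions_int (int n + 2 - 1) = int (num_partitions (n + 1))"
    "num_partitions_int (int n + 2) = int (num_partitions (n + 2))"
    using assms by (simp_all add: num_partitions_int_def nat_add_distrib nat_diff_distrib)
  have "turan_check (int n + 2)"
    by (rule check_range_imp_turan_check[OF check_range_1202]) (use assms in auto)
  moreover have "97 \<le> int n + 2" using assms(1) by simp
  ultimately
  have "of_int ((int (num_partitions n) * int (num_partitions (n + 1)) - int (num_partitions (n - 1)) * int (num_partitions (n + 2)))\<^sup>2)
    < (of_int (4 * ((int (num_partitions n))\<^sup>2 - int (num_partitions (n - 1)) * int (num_partitions (n + 1)))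
       * ((int (num_partitions (n + 1)))\<^sup>2 - int (num_partitions n) * int (num_partitions (n + 2)))) :: real)"
    unfolding of_int_less_iff eq [symmetric] by (rule turan_check_sound)
  then show ?thesis unfolding a0_def a1_def a2_def a3_def
    by (simp only: of_int_power of_int_diff of_int_mult of_int_numeral of_int_of_nat_eq)
qed

theorem theorem1p4:
  fixes n :: nat
  assumes "n \<ge> 95"
  shows "card {x :: real. poly [: real (num_partitions (n - 1)),
                                 3 * real (num_partitions n),
                                 3 * real (num_partitions (n + 1)),
                                 real (num_partitions (n + 2)) :] x = 0} = 3"
proof (rule cubic_three_real_roots)
  show "0 < real (num_partitions (n + 2))" by (simp add: num_partitions_pos)
  show "(real (num_partitions n) * real (num_partitions (n + 1)) - real (num_partitions (n - 1)) * real (num_partitions (n + 2)))\<^sup>2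
    < 4 * ((real (num_partitions n))\<^sup>2 - real (num_partitions (n - 1)) * real (num_partitions (n + 1)))
        * ((real (num_partitions (n + 1)))\<^sup>2 - real (num_partitions n) * real (num_partitions (n + 2)))"
  proof (cases "n \<le> 1200")
    case True
    then show ?thesis using assms by (intro turan_num_partitions_small)
  next
    case False
    then show ?thesis by (intro turan_num_partitions_large) simp
  qed
qed

end
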